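(* Let $k\ge2$ be fixed and let $2\le r<\infty$. Assume that the observations are independent across clusters (with arbitrary dependence within clusters), that $$\frac{\big(\sum_{g=1}^{G}n_g^r\big)^{2/r}}{n}\le C<\infty\quad\text{and}\quad \max_{g\in[G]}\frac{n_g^2}{n}\to0\quad(n\to\infty),$$ and that $$\lim_{M\to\infty}\sup_n\sup_{(i_1,\dots,i_k)\in[n]^k}E\big[|\varphi(W_{i_1},\dots,W_{i_k})|^r\,1\{|\varphi(W_{i_1},\dots,W_{i_k})|>M\}\big]=0 .$$ Then, as $n\to\infty$: (a) $\displaystyle U_{n,k}=\frac kn\sum_{i=1}^n\bar\varphi^{(1)}_{n,k}(W_i)+O_p\Big(\frac{m_n}n\Big)$; (b) $\displaystyle U_{n,k}=O_p\Big(\sqrt{\frac{m_n}n}\Big)=o_p(1)$. (c) If, in addition, $\sigma_{n,k}\ge\lambda>0$ for a constant $\lambda$ not depending on $n$, then $\sigma_{n,k}^{-1}\sqrt n\,U_{n,k}\xrightarrow{d}\mathcal N(0,1)$.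
   Context: For each $n$, the index set $[n]=\{1,\dots,n\}$ is partitioned into $G=G_n$ clusters $\mathcal G_1,\dots,\mathcal G_G$, with $n_g=\#\mathcal G_g$, $m_n=\max_{g\in[G]}n_g$, and $g(i)$ the cluster of unit $i$. The observations $W_1,\dots,W_n$ are random elements of a standard Borel space; "independent across clusters" means that the arrays $\{W_i\}_{i\in\mathcal G_g}$, $g\in[G]$, are mutually independent. A $k$-tuple of distinct indices is cluster-generic if its indices belong to $k$ distinct clusters. The kernel $\varphi(w_1,\dots,w_k)$ is real-valued, measurable, symmetric, and centred on cluster-generic tuples: $E[\varphi(W_{i_1},\dots,W_{i_k})]=0$ for every cluster-generic $(i_1,\dots,i_k)$. With $\mathcal P(n,k)=n(n-1)\cdots(n-k+1)$, $U_{n,k}=\frac1{\mathcal P(n,k)}\sum\varphi(W_{i_1},\dots,W_{i_k})$, the sum over ordered $k$-tuples of distinct indices in $[n]$. $\varphi^{(1)}_{(i_2,\dots,i_k)}(W_i)=E[\varphi(W_i,W_{i_2},\dots,W_{i_k})\mid W_i]$. Let $\mathcal A_i$ be the set of ordered tuples $(i_2,\dots,i_k)$ such that $(i,i_2,\dots,i_k)$ is cluster-generic, $Q_{n,i}=\#\mathcal A_i$ (positive for large $n$), and $\bar\varphi^{(1)}_{n,k}(W_i)=\frac1{Q_{n,i}}\sum_{(i_2,\dots,i_k)\in\mathcal A_i}\varphi^{(1)}_{(i_2,\dots,i_k)}(W_i)$. $\sigma_{n,k}\ge0$ is given by $\sigma_{n,k}^2=\frac{k^2}n\sum_{g=1}^GE\big[\big(\sum_{i\in\mathcal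 G_g}\bar\varphi^{(1)}_{n,k}(W_i)\big)^2\big]$. *)

theory Defs
  imports "HOL-Probability.Probability" "HOL-Combinatorics.Permutations"
begin

definition standard_borel_space :: "'w measure \<Rightarrow> bool" where
  "standard_borel_space S \<longleftrightarrow>
     (\<exists>T. completely_metrizable_space T \<and> second_countable T \<and>
          space S = topspace T \<and> sets S = sigma_sets (topspace T) {U. openin T U})"

text \<open>
  A \<open>k\<close>-tuple of indices in \<open>[n]\<close> is an element \<open>t\<close> of \<open>{1..k} \<rightarrow>\<^sub>E {1..n}\<close>, and a \<open>k\<close>-tuple of points
  of \<open>S\<close> is an element of \<open>space (PiM {1..k} (\<lambda>_. S))\<close>. A partition of \<open>[n]\<close> into clusters is the set
  of its blocks, so that sums over \<open>g \<in> [G]\<close> become sums over blocks.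
\<close>

definition symmetric_kernel :: "'w measure \<Rightarrow> nat \<Rightarrow> ((nat \<Rightarrow> 'w) \<Rightarrow> real) \<Rightarrow> bool" where
  "symmetric_kernel S k \<phi> \<longleftrightarrow>
     (\<forall>\<pi>. \<pi> permutes {1..k} \<longrightarrow> (\<forall>x \<in> space (PiM {1..k} (\<lambda>_. S)). \<phi> (x \<circ> \<pi>) = \<phi> x))"

definition cluster_of :: "nat set set \<Rightarrow> nat \<Rightarrow> nat set" where
  "cluster_of P i = (THE g. g \<in> P \<and> i \<in> g)"

definition cluster_generic :: "nat set set \<Rightarrow> nat \<Rightarrow> (nat \<Rightarrow> nat) \<Rightarrow> bool" where
  "cluster_generic P k t \<longleftrightarrow> inj_on (\<lambda>j. cluster_of P (t j)) {1..k}"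

definition max_cluster_size :: "nat set set \<Rightarrow> nat" where
  "max_cluster_size P = Max (card ` P)"

definition kernel_at ::
    "((nat \<Rightarrow> 'w) \<Rightarrow> real) \<Rightarrow> nat \<Rightarrow> (nat \<Rightarrow> 'a \<Rightarrow> 'w) \<Rightarrow> (nat \<Rightarrow> nat) \<Rightarrow> 'a \<Rightarrow> real" where
  "kernel_at \<phi> k W t \<omega> = \<phi> (\<lambda>j\<in>{1..k}. W (t j) \<omega>)"

definition U_stat ::
    "((nat \<Rightarrow> 'w) \<Rightarrow> real) \<Rightarrow> nat \<Rightarrow> nat \<Rightarrow> (nat \<Rightarrow> 'a \<Rightarrow> 'w) \<Rightarrow> 'a \<Rightarrow> real" where
  "U_stat \<phi> k n W \<omega> =
     1 / (\<Prod>j<k. real n - real j) *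
     (\<Sum>t \<in> {t \<in> {1..k} \<rightarrow>\<^sub>E {1..n}. inj_on t {1..k}}. kernel_at \<phi> k W t \<omega>)"

definition first_projection ::
    "'a measure \<Rightarrow> 'w measure \<Rightarrow> ((nat \<Rightarrow> 'w) \<Rightarrow> real) \<Rightarrow> nat \<Rightarrow> (nat \<Rightarrow> 'a \<Rightarrow> 'w) \<Rightarrow>
     nat \<Rightarrow> (nat \<Rightarrow> nat) \<Rightarrow> 'a \<Rightarrow> real" where
  "first_projection M S \<phi> k W i s =
     real_cond_exp M (vimage_algebra (space M) (W i) S) (kernel_at \<phi> k W (s(1 := i)))"

definition generic_completions :: "nat set set \<Rightarrow> nat \<Rightarrow> nat \<Rightarrow> nat \<Rightarrow> (nat \<Rightarrow> nat) set" where
  "generic_completions P k n i = {s \<in> {2..k} \<rightarrow>\<^sub>E {1..n}. cluster_generic P k (s(1 := i))}"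

text \<open>
  If there are no completions, which happens only for small \<open>n\<close> in the asymptotic regime considered,
  the average takes the value \<open>0\<close>.
\<close>

definition mean_projection ::
    "'a measure \<Rightarrow> 'w measure \<Rightarrow> nat set set \<Rightarrow> ((nat \<Rightarrow> 'w) \<Rightarrow> real) \<Rightarrow> nat \<Rightarrow> nat \<Rightarrow>
     (nat \<Rightarrow> 'a \<Rightarrow> 'w) \<Rightarrow> nat \<Rightarrow> 'a \<Rightarrow> real" where
  "mean_projection M S P \<phi> k n W i \<omega> =
     1 / real (card (generic_completions P k n i)) *
     (\<Sum>s \<in> generic_completions P k n i. first_projection M S \<phi> k W i s \<omega>)"

definition sigma_U ::
    "'a measure \<Rightarrow> 'w measure \<Rightarrow> nat set set \<Rightarrow> ((nat \<Rightarrow> 'w) \<Rightarrow> real) \<Rightarrow> nat \<Rightarrow> nat \<Rightarrow>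
     (nat \<Rightarrow> 'a \<Rightarrow> 'w) \<Rightarrow> real" where
  "sigma_U M S P \<phi> k n W =
     sqrt ((real k)\<^sup>2 / real n *
           (\<Sum>g\<in>P. \<integral>\<omega>. (\<Sum>i\<in>g. mean_projection M S P \<phi> k n W i \<omega>)\<^sup>2 \<partial>M))"

text \<open>
  Stochastic order symbols along a sequence of probability spaces. Measurability is part of the
  definitions because \<^const>\<open>measure\<close> vanishes on non-measurable sets.
\<close>

definition big_Op :: "(nat \<Rightarrow> 'a measure) \<Rightarrow> (nat \<Rightarrow> 'a \<Rightarrow> real) \<Rightarrow> (nat \<Rightarrow> real) \<Rightarrow> bool" where
  "big_Op M X a \<longleftrightarrow>
     (\<forall>\<^sub>F n in sequentially. X n \<in> borel_measurable (M n)) \<and>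
     (\<forall>\<epsilon>>0. \<exists>K>0. \<forall>\<^sub>F n in sequentially.
        measure (M n) {\<omega> \<in> space (M n). \<bar>X n \<omega>\<bar> > K * a n} \<le> \<epsilon>)"

definition small_op :: "(nat \<Rightarrow> 'a measure) \<Rightarrow> (nat \<Rightarrow> 'a \<Rightarrow> real) \<Rightarrow> (nat \<Rightarrow> real) \<Rightarrow> bool" where
  "small_op M X a \<longleftrightarrow>
     (\<forall>\<^sub>F n in sequentially. X n \<in> borel_measurable (M n)) \<and>
     (\<forall>\<epsilon>>0. (\<lambda>n. measure (M n) {\<omega> \<in> space (M n). \<bar>X n \<omega>\<bar> > \<epsilon> * a n}) \<longlonglongrightarrow> 0)"

end

theory Submission
  imports Defs
begin

text \<open>
  On cluster-generic tuples \<open>t\<close> the kernel splits as \<open>\<phi>(W\<^sub>t) = \<Sum>\<^sub>j p\<^sub>j(t) + R(t)\<close>, where \<open>p\<^sub>j(t)\<close> is the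
  conditional expectation given \<open>W\<^sub>t\<^sub>j\<close>. By independence across clusters \<open>R(t)\<close> and \<open>R(t')\<close> are
  orthogonal unless \<open>t\<close> and \<open>t'\<close> have two clusters in common, which happens for
  \<open>O(m\<^sup>2 n\<^bsup>2k-2\<^esup>)\<close> pairs only; the non-generic tuples number \<open>O(m n\<^bsup>k-1\<^esup>)\<close>. Hence \<open>U\<close> differs from its
  linear part by \<open>O(m/n)\<close> in \<open>L\<^sup>1\<close>, which is (a). The linear part is a sum of independent centred
  cluster sums of total variance \<open>O(m/n)\<close>, which is (b). Since \<open>m/\<surd>n \<rightarrow> 0\<close>, (c) follows from
  Lindeberg's theorem for the cluster sums. Lindeberg's condition is obtained by applying Jensen's
  inequality to the convex function \<open>(|x| - B)\<^sub>+ powr r\<close>, which carries the uniform integrability of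
  the kernel over to the cluster averages, together with the bound on \<open>\<Sum>\<^sub>g n\<^sub>g powr r\<close>.
\<close>

section \<open>Conditional expectations and moments\<close>

text \<open>Units need not be identically distributed, so the projection of a kernel value onto one
  entry depends on the whole tuple, and each unit enters the linear part with its own weight, its
  number of completions over the falling factorial; part of the error in (a) is the gap between
  these weights and \<open>1/n\<close>. Higher Hoeffding terms are never separated, since pairs of
  tuples with two common clusters are already rare enough.

  Errors are measured in \<open>L^1\<close>. Nongeneric tuples need not be centred, so only their
  number is exploited; moreover an \<open>L^1\<close> bound controls the shift of a characteristic
  function, which takes the place of Slutsky's theorem in (c).

  The excess lies below the tail and controls \<open>|x| powr r\<close> up to the factor
  \<open>2 powr r\<close> once \<open>|x| > 2B\<close>. It also vanishes at 0, the value of an empty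
  average.\<close>

lemma (in prob_space) real_cond_exp_indep:
  fixes f :: "'b \<times> 'c \<Rightarrow> real"
    and V Z :: "'a \<Rightarrow> 'c"
  assumes ind: "indep_var N V L Z"
    and \<alpha>[measurable]: "\<alpha> \<in> measurable N N'"
    and G: "sets G \<subseteq> sets (vimage_algebra (space M) V N)" "space G = space M"
    and \<alpha>V[measurable]: "(\<lambda>\<omega>. \<alpha> (V \<omega>)) \<in> measurable G N'"
    and f[measurable]: "f \<in> borel_measurable (N' \<Otimes>\<^sub>M L)"
    and int: "integrable M (\<lambda>\<omega>. f (\<alpha> (V \<omega>), Z \<omega>))"
  shows "AE \<omega> in M. real_cond_exp M G (\<lambda>\<omega>. f (\<alpha> (V \<omega>), Z \<omega>)) \<omega>
    = (\<integral>z. f (\<alpha> (V \<omega>), z) \<partial>distr M L Z)"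
proof -
  let ?R = "distr M N V" and ?Q = "distr M L Z"
  have V[measurable]: "V \<in> measurable M N" and Z[measurable]: "Z \<in> measurable M L"
    using ind by (auto dest: indep_var_rv1 indep_var_rv2)
  have V_space: "V \<in> space M \<rightarrow> space N" using measurable_space[OF V] by auto
  have G_events: "sets G \<subseteq> sets M"
    using G(1) measurable_sets[OF V] by (auto simp: sets_vimage_algebra2[OF V_space])
  interpret R: prob_space ?R by (rule prob_space_distr) fact
  interpret Q: prob_space ?Q by (rule prob_space_distr) fact
  interpret RQ: pair_prob_space ?R ?Q ..
  interpret G: finite_measure_subalgebra M G
    by unfold_locales (use G_events G in \<open>auto simp: subalgebra_def\<close>)
  have eq: "?R \<Otimes>\<^sub>M ?Q = distr M (N \<Otimes>\<^sub>M L) (\<lambda>\<omega>. (V \<omega>, Z \<omega>))"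
    using ind by (simp add: indep_var_distribution_eq)
  have int': "integrable (?R \<Otimes>\<^sub>M ?Q) (\<lambda>p. f (\<alpha> (fst p), snd p))"
    unfolding eq by (subst integrable_distr_eq) (use int in auto)
  \<comment> \<open>Averaging out the independent variable gives the candidate. Every set of
    \<open>G\<close> is a preimage under \<open>V\<close>, so Fubini for the product law verifies
    the defining identity.\<close>
  define g where "g a = (\<integral>z. f (a, z) \<partial>?Q)" for a
  have g[measurable]: "g \<in> borel_measurable N'"
    unfolding g_def by measurable
  have "integrable ?R (\<lambda>v. g (\<alpha> v))"
    using RQ.integrable_fst'[OF int'] by (simp add: g_def)
  then have int_g: "integrable M (\<lambda>\<omega>. g (\<alpha> (V \<omega>)))"
    by (simp add: integrable_distr_eq)
  show ?thesis
    unfolding g_def[symmetric]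
  proof (rule G.real_cond_exp_charact)
    fix B assume B: "B \<in> sets G"
    then obtain B' where B'[measurable]: "B' \<in> sets N" and B_eq: "B = V -` B' \<inter> space M"
      using G(1) by (auto simp: sets_vimage_algebra2[OF V_space])
    have int_B: "integrable (?R \<Otimes>\<^sub>M ?Q) (\<lambda>p. indicator B' (fst p) * f (\<alpha> (fst p), snd p))"
      by (rule Bochner_Integration.integrable_bound[OF int']) (auto split: split_indicator)
    have "(\<integral>\<omega>. indicator B \<omega> * f (\<alpha> (V \<omega>), Z \<omega>) \<partial>M)
        = (\<integral>\<omega>. indicator B' (V \<omega>) * f (\<alpha> (V \<omega>), Z \<omega>) \<partial>M)"
      by (intro Bochner_Integration.integral_cong) (auto simp: B_eq split: split_indicator)
    also have "\<dots> = integral\<^sup>L (?R \<Otimes>\<^sub>M ?Q) (\<lambda>p. indicator B' (fst p) * f (\<alpha> (fst p), snd p))"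
      unfolding eq by (subst integral_distr) auto
    also have "\<dots> = (\<integral>x. (\<integral>z. indicator B' x * f (\<alpha> x, z) \<partial>?Q) \<partial>?R)"
      using RQ.integral_fst'[OF int_B] by simp
    also have "\<dots> = (\<integral>x. indicator B' x * g (\<alpha> x) \<partial>?R)"
      by (simp add: g_def)
    also have "\<dots> = (\<integral>\<omega>. indicator B' (V \<omega>) * g (\<alpha> (V \<omega>)) \<partial>M)"
      by (subst integral_distr) auto
    also have "\<dots> = (\<integral>\<omega>. indicator B \<omega> * g (\<alpha> (V \<omega>)) \<partial>M)"
      by (intro Bochner_Integration.integral_cong) (auto simp: B_eq split: split_indicator)
    finally show "(\<integral>\<omega>\<in>B. f (\<alpha> (V \<omega>), Z \<omega>) \<partial>M) = (\<integral>\<omega>\<in>B. g (\<alpha> (V \<omega>)) \<partial>M)"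
      by (simp add: set_lebesgue_integral_def)
  qed (use int int_g in auto)
qed

text \<open>Both sides are the same integral over the law of \<open>Z\<close>, for the finer and the
  coarser sigma-algebra alike. It will say that whole clusters tell no more about a kernel value
  than the one entry lying in them.\<close>

lemma (in prob_space) real_cond_exp_indep_cong:
  fixes f :: "'b \<times> 'c \<Rightarrow> real"
    and V Z :: "'a \<Rightarrow> 'c"
  assumes ind: "indep_var N V L Z"
    and \<alpha>: "\<alpha> \<in> measurable N N'"
    and f: "f \<in> borel_measurable (N' \<Otimes>\<^sub>M L)"
    and int: "integrable M (\<lambda>\<omega>. f (\<alpha> (V \<omega>), Z \<omega>))"
  shows "AE \<omega> in M. real_cond_exp M (vimage_algebra (space M) V N) (\<lambda>\<omega>. f (\<alpha> (V \<omega>), Z \<omega>)) \<omega>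
    = real_cond_exp M (vimage_algebra (space M) (\<lambda>\<omega>. \<alpha> (V \<omega>)) N') (\<lambda>\<omega>. f (\<alpha> (V \<omega>), Z \<omega>)) \<omega>"
proof -
  let ?F = "vimage_algebra (space M) V N"
  let ?G = "vimage_algebra (space M) (\<lambda>\<omega>. \<alpha> (V \<omega>)) N'"
  have V: "V \<in> space M \<rightarrow> space N"
    using indep_var_rv1[OF ind] by (auto dest: measurable_space)
  have \<alpha>V: "(\<lambda>\<omega>. \<alpha> (V \<omega>)) \<in> space M \<rightarrow> space N'"
    using V \<alpha> by (auto dest: measurable_space)
  have F: "(\<lambda>\<omega>. \<alpha> (V \<omega>)) \<in> measurable ?F N'"
    using measurable_vimage_algebra1[OF V] \<alpha> by (rule measurable_compose)
  have "sets ?G \<subseteq> sets ?F"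
    using measurable_sets[OF F] by (auto simp: sets_vimage_algebra2[OF \<alpha>V])
  then have "AE \<omega> in M. real_cond_exp M ?G (\<lambda>\<omega>. f (\<alpha> (V \<omega>), Z \<omega>)) \<omega> = (\<integral>z. f (\<alpha> (V \<omega>), z) \<partial>distr M L Z)"
    by (intro real_cond_exp_indep[OF ind \<alpha> _ _ _ f int] measurable_vimage_algebra1 \<alpha>V) auto
  moreover have "AE \<omega> in M. real_cond_exp M ?F (\<lambda>\<omega>. f (\<alpha> (V \<omega>), Z \<omega>)) \<omega> = (\<integral>z. f (\<alpha> (V \<omega>), z) \<partial>distr M L Z)"
    by (intro real_cond_exp_indep[OF ind \<alpha> _ _ F f int]) auto
  ultimately show ?thesis by eventually_elim simp
qed

lemma integrable_mult_of_squares: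
  fixes f g :: "'a \<Rightarrow> real"
  assumes [measurable]: "f \<in> borel_measurable M" "g \<in> borel_measurable M"
    and "integrable M (\<lambda>x. (f x)\<^sup>2)" "integrable M (\<lambda>x. (g x)\<^sup>2)"
  shows "integrable M (\<lambda>x. f x * g x)"
proof (rule Bochner_Integration.integrable_bound)
  show "integrable M (\<lambda>x. (f x)\<^sup>2 + (g x)\<^sup>2)" using assms by simp
  have "\<bar>a * b\<bar> \<le> a\<^sup>2 + b\<^sup>2" for a b :: real
  proof -
    have "2 * \<bar>a * b\<bar> \<le> a\<^sup>2 + b\<^sup>2"
      using sum_squares_bound[of "\<bar>a\<bar>" "\<bar>b\<bar>"] by (simp add: abs_mult mult.assoc)
    then show ?thesis using abs_ge_zero[of "a * b"] by linarith
  qed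
  then show "AE x in M. norm (f x * g x) \<le> norm ((f x)\<^sup>2 + (g x)\<^sup>2)" by simp
qed simp

text \<open>Young's inequality \<open>|x| <= c/2 + x^2/(2c)\<close>, with \<open>c\<close> the
  target rate, turns an \<open>L^2\<close> rate into an \<open>L^1\<close> rate, at the price of
  \<open>(1 + b)/2\<close> instead of \<open>sqrt b\<close>.\<close>

lemma (in prob_space) expectation_abs_le_square:
  fixes X :: "'a \<Rightarrow> real"
  assumes X[measurable]: "X \<in> borel_measurable M" and int: "integrable M (\<lambda>x. (X x)\<^sup>2)"
    and le: "expectation (\<lambda>x. (X x)\<^sup>2) \<le> b * c\<^sup>2" and c: "c > 0"
  shows "expectation (\<lambda>x. \<bar>X x\<bar>) \<le> (1 + b) / 2 * c"
proof -
  have i1: "integrable M X" by (rule square_integrable_imp_integrable[OF X int])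
  have "expectation (\<lambda>x. \<bar>X x\<bar>) \<le> expectation (\<lambda>x. c / 2 + (X x)\<^sup>2 / (2 * c))"
  proof (rule integral_mono)
    show "integrable M (\<lambda>x. c / 2 + (X x)\<^sup>2 / (2 * c))" using int by simp
    show "\<bar>X x\<bar> \<le> c / 2 + (X x)\<^sup>2 / (2 * c)" for x
      using sum_squares_bound[of c "\<bar>X x\<bar>"] c by (simp add: field_simps power2_eq_square)
  qed (use i1 in simp)
  also have "\<dots> = c / 2 + expectation (\<lambda>x. (X x)\<^sup>2) / (2 * c)"
    using int by (simp add: prob_space)
  also have "\<dots> \<le> c / 2 + b * c\<^sup>2 / (2 * c)"
    using le c by (intro add_left_mono divide_right_mono) auto
  also have "\<dots> = (1 + b) / 2 * c" using c by (simp add: field_simps power2_eq_square)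
  finally show ?thesis .
qed

lemma (in prob_space) convex_real_cond_exp:
  fixes q :: "real \<Rightarrow> real"
  assumes G: "subalgebra M G" and X: "integrable M X"
    and q: "integrable M (\<lambda>\<omega>. q (X \<omega>))" "convex_on UNIV q" "q \<in> borel_measurable borel"
  shows "integrable M (\<lambda>\<omega>. q (real_cond_exp M G X \<omega>))"
    and "expectation (\<lambda>\<omega>. q (real_cond_exp M G X \<omega>)) \<le> expectation (\<lambda>\<omega>. q (X \<omega>))"
proof -
  interpret G: finite_measure_subalgebra M G by unfold_locales fact
  show int: "integrable M (\<lambda>\<omega>. q (real_cond_exp M G X \<omega>))"
    by (rule G.integrable_convex_cond_exp[where I = UNIV]) (use assms in auto)
  have "expectation (\<lambda>\<omega>. q (real_cond_exp M G X \<omega>)) \<le> expectation (real_cond_exp M G (\<lambda>\<omega>. q (X \<omega>)))"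
    by (rule integral_mono_AE[OF int])
      (use G.real_cond_exp_int(1)[OF q(1)]
        G.real_cond_exp_jensens_inequality(2)[of X UNIV, OF X _ _ q] in auto)
  also have "\<dots> = expectation (\<lambda>\<omega>. q (X \<omega>))"
    by (rule G.real_cond_exp_int(2)[OF q(1)])
  finally show "expectation (\<lambda>\<omega>. q (real_cond_exp M G X \<omega>)) \<le> expectation (\<lambda>\<omega>. q (X \<omega>))" .
qed

text \<open>Uniform integrability is stated with extended nonnegative integrals; this carries such a
  bound over to the Bochner integral, together with integrability.\<close>

lemma integral_le_of_nn_integral:
  fixes f :: "'a \<Rightarrow> real"
  assumes f: "f \<in> borel_measurable M" "\<And>x. f x \<ge> 0" and le: "(\<integral>\<^sup>+x. f x \<partial>M) \<le> ennreal c" and c: "c \<ge> 0"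
  shows "integrable M f" "(\<integral>x. f x \<partial>M) \<le> c"
proof -
  show int: "integrable M f"
    using f le by (intro integrableI_nonneg) (auto intro: le_less_trans)
  have "ennreal (\<integral>x. f x \<partial>M) \<le> ennreal c"
    using nn_integral_eq_integral[OF int] f le by simp
  then show "(\<integral>x. f x \<partial>M) \<le> c" using c by (simp add: ennreal_le_iff)
qed

lemma powr_convex_nonneg:
  assumes r: "r \<ge> 1" shows "convex_on {0..} (\<lambda>x::real. x powr r)"
proof (rule convex_onI)
  fix u x y :: real
  assume u: "0 < u" "u < 1" and xy: "x \<in> {0..}" "y \<in> {0..}"
  \<comment> \<open>Zero as an end point is settled by \<open>v powr r <= v\<close> for
    \<open>0 < v < 1\<close>; convexity on the positive axis covers the rest.\<close>
  have scale: "(v * z) powr r \<le> v * z powr r" if "0 < v" "v < 1" "z \<ge> 0" for v z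
  proof -
    have "v powr r \<le> v powr 1" using that r by (intro powr_mono') auto
    then have "v powr r * z powr r \<le> v * z powr r" using that by (intro mult_right_mono) auto
    then show ?thesis using that by (simp add: powr_mult)
  qed
  consider "x = 0" | "y = 0" | "x > 0" "y > 0" using xy by fastforce
  then show "((1 - u) *\<^sub>R x + u *\<^sub>R y) powr r \<le> (1 - u) * x powr r + u * y powr r"
  proof cases
    case 1 then show ?thesis using scale[of u y] u xy by simp
  next
    case 2 then show ?thesis using scale[of "1 - u" x] u xy by simp
  next
    case 3 then show ?thesis using convex_onD[OF powr_convex[OF r], of u x y] u by simp
  qed
qed simp

text \<open>A nondecreasing convex power is composed with the convex function
  \<open>max 0 (|x| - B)\<close>. The inner function is nonnegative, so convexity of the power on
  \<open>{0..}\<close> suffices.\<close>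

lemma convex_excess_powr:
  assumes r: "r \<ge> 1" shows "convex_on UNIV (\<lambda>x::real. (max 0 (\<bar>x\<bar> - B)) powr r)"
proof (rule convex_onI)
  fix u x y :: real
  assume u: "0 < u" "u < 1"
  let ?p = "\<lambda>x. max 0 (\<bar>x\<bar> - B)"
  have "?p ((1 - u) * x + u * y) \<le> (1 - u) * ?p x + u * ?p y"
  proof (rule max.boundedI)
    show "0 \<le> (1 - u) * ?p x + u * ?p y" using u by (intro add_nonneg_nonneg mult_nonneg_nonneg) auto
    have "\<bar>(1 - u) * x + u * y\<bar> \<le> (1 - u) * \<bar>x\<bar> + u * \<bar>y\<bar>"
      using u abs_triangle_ineq[of "(1 - u) * x" "u * y"] by (simp add: abs_mult)
    then have "\<bar>(1 - u) * x + u * y\<bar> - B \<le> (1 - u) * (\<bar>x\<bar> - B) + u * (\<bar>y\<bar> - B)"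
      by (simp add: algebra_simps)
    also have "\<dots> \<le> (1 - u) * ?p x + u * ?p y"
      using u by (intro add_mono mult_left_mono) auto
    finally show "\<bar>(1 - u) * x + u * y\<bar> - B \<le> (1 - u) * ?p x + u * ?p y" .
  qed
  then have "?p ((1 - u) * x + u * y) powr r \<le> ((1 - u) * ?p x + u * ?p y) powr r"
    using r by (intro powr_mono2) auto
  also have "\<dots> \<le> (1 - u) * ?p x powr r + u * ?p y powr r"
    using convex_onD[OF powr_convex_nonneg[OF r], of u "?p x" "?p y"] u by simp
  finally show "(?p ((1 - u) *\<^sub>R x + u *\<^sub>R y)) powr r \<le> (1 - u) * ?p x powr r + u * ?p y powr r" by simp
qed simp

text \<open>\<open>iexp\<close> is 1-Lipschitz and has modulus 1, so a perturbation small in mean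
  shifts the characteristic function little, whatever its dependence on \<open>X\<close>.\<close>

lemma (in prob_space) char_distr_add_diff_le:
  fixes X Y :: "'a \<Rightarrow> real"
  assumes X[measurable]: "X \<in> borel_measurable M" and Y: "integrable M Y"
  shows "cmod (char (distr M borel (\<lambda>\<omega>. X \<omega> + Y \<omega>)) t - char (distr M borel X) t)
    \<le> \<bar>t\<bar> * expectation (\<lambda>\<omega>. \<bar>Y \<omega>\<bar>)"
proof -
  have [measurable]: "Y \<in> borel_measurable M" using Y by simp
  have int: "integrable M (\<lambda>\<omega>. iexp (t * (X \<omega> + Y \<omega>)))" "integrable M (\<lambda>\<omega>. iexp (t * X \<omega>))"
    by (auto intro!: integrable_iexp)
  have "cmod (char (distr M borel (\<lambda>\<omega>. X \<omega> + Y \<omega>)) t - char (distr M borel X) t)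
      = cmod (expectation (\<lambda>\<omega>. iexp (t * (X \<omega> + Y \<omega>)) - iexp (t * X \<omega>)))"
    using int by (simp add: char_def integral_distr)
  also have "\<dots> \<le> expectation (\<lambda>\<omega>. cmod (iexp (t * (X \<omega> + Y \<omega>)) - iexp (t * X \<omega>)))"
    by (rule integral_norm_bound)
  also have "\<dots> \<le> expectation (\<lambda>\<omega>. \<bar>t\<bar> * \<bar>Y \<omega>\<bar>)"
  proof (rule integral_mono)
    fix \<omega>
    have "iexp (t * (X \<omega> + Y \<omega>)) - iexp (t * X \<omega>) = iexp (t * X \<omega>) * (iexp (t * Y \<omega>) - 1)"
      by (simp add: algebra_simps exp_add[symmetric])
    then have "cmod (iexp (t * (X \<omega> + Y \<omega>)) - iexp (t * X \<omega>)) = cmod (iexp (t * Y \<omega>) - 1)"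
      by (simp add: norm_mult)
    also have "\<dots> \<le> \<bar>t\<bar> * \<bar>Y \<omega>\<bar>"
      using iexp_approx1[of "t * Y \<omega>" 0] by (simp add: abs_mult)
    finally show "cmod (iexp (t * (X \<omega> + Y \<omega>)) - iexp (t * X \<omega>)) \<le> \<bar>t\<bar> * \<bar>Y \<omega>\<bar>" .
  qed (use int Y in auto)
  finally show ?thesis by simp
qed

section \<open>Markov's inequality and stochastic order symbols\<close>

lemma (in prob_space) markov_abs:
  fixes X :: "'a \<Rightarrow> real"
  assumes X: "integrable M X" and c: "c > 0"
  shows "prob {\<omega> \<in> space M. \<bar>X \<omega>\<bar> > c} \<le> expectation (\<lambda>\<omega>. \<bar>X \<omega>\<bar>) / c"
proof -
  have [measurable]: "X \<in> borel_measurable M" using X by simp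
  have "prob {\<omega> \<in> space M. \<bar>X \<omega>\<bar> > c} \<le> prob {\<omega> \<in> space M. \<bar>X \<omega>\<bar> \<ge> c}"
    by (intro finite_measure_mono) auto
  also have "\<dots> \<le> expectation (\<lambda>\<omega>. \<bar>X \<omega>\<bar>) / c"
    using X c by (intro integral_Markov_inequality_measure[where A = "{}"]) auto
  finally show ?thesis .
qed

lemma big_Op_of_expectation:
  assumes "\<forall>\<^sub>F n in sequentially. prob_space (M n) \<and> integrable (M n) (X n)
      \<and> a n > 0 \<and> (\<integral>\<omega>. \<bar>X n \<omega>\<bar> \<partial>M n) \<le> c * a n"
  shows "big_Op M X a"
  unfolding big_Op_def
proof (intro conjI allI impI)
  show "\<forall>\<^sub>F n in sequentially. X n \<in> borel_measurable (M n)"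
    using assms by eventually_elim auto
  fix e :: real assume e: "e > 0"
  \<comment> \<open>Markov's inequality yields the bound \<open>c / L\<close>; the maximum with 1
    keeps \<open>L\<close> positive even if \<open>c <= 0\<close>.\<close>
  define L where "L = max 1 (c / e)"
  have L: "L > 0" "c / L \<le> e"
  proof -
    show "L > 0" by (simp add: L_def)
    have "c / e \<le> L" by (simp add: L_def)
    then show "c / L \<le> e" using e \<open>L > 0\<close> by (simp add: field_simps)
  qed
  show "\<exists>K>0. \<forall>\<^sub>F n in sequentially. measure (M n) {\<omega> \<in> space (M n). K * a n < \<bar>X n \<omega>\<bar>} \<le> e"
  proof (intro exI conjI)
    show "\<forall>\<^sub>F n in sequentially. measure (M n) {\<omega> \<in> space (M n). L * a n < \<bar>X n \<omega>\<bar>} \<le> e"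
      using assms
    proof eventually_elim
      case (elim n)
      then interpret prob_space "M n" by simp
      have "prob {\<omega> \<in> space (M n). L * a n < \<bar>X n \<omega>\<bar>} \<le> expectation (\<lambda>\<omega>. \<bar>X n \<omega>\<bar>) / (L * a n)"
        using elim L by (intro markov_abs) auto
      also have "\<dots> \<le> c * a n / (L * a n)" using elim L by (intro divide_right_mono) auto
      also have "\<dots> = c / L" using elim by simp
      finally show ?case using L by simp
    qed
  qed (rule L)
qed

lemma small_op_of_expectation:
  assumes ev: "\<forall>\<^sub>F n in sequentially. prob_space (M n) \<and> integrable (M n) (X n)
      \<and> (\<integral>\<omega>. \<bar>X n \<omega>\<bar> \<partial>M n) \<le> b n"
    and b: "b \<longlonglongrightarrow> 0"
  shows "small_op M X (\<lambda>_. 1)"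
  unfolding small_op_def
proof (intro conjI allI impI)
  show "\<forall>\<^sub>F n in sequentially. X n \<in> borel_measurable (M n)"
    using ev by eventually_elim auto
  fix e :: real assume e: "e > 0"
  show "(\<lambda>n. measure (M n) {\<omega> \<in> space (M n). e * 1 < \<bar>X n \<omega>\<bar>}) \<longlonglongrightarrow> 0"
  proof (rule tendsto_sandwich[where f = "\<lambda>_. 0" and h = "\<lambda>n. b n / e"])
    show "\<forall>\<^sub>F n in sequentially. measure (M n) {\<omega> \<in> space (M n). e * 1 < \<bar>X n \<omega>\<bar>} \<le> b n / e"
      using ev
    proof eventually_elim
      case (elim n)
      then interpret prob_space "M n" by simp
      have "prob {\<omega> \<in> space (M n). e < \<bar>X n \<omega>\<bar>} \<le> expectation (\<lambda>\<omega>. \<bar>X n \<omega>\<bar>) / e"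
        using elim e by (intro markov_abs) auto
      also have "\<dots> \<le> b n / e" using elim e by (intro divide_right_mono) auto
      finally show ?case by simp
    qed
    show "(\<lambda>n. b n / e) \<longlonglongrightarrow> 0" using tendsto_divide[OF b tendsto_const[of e]] e by simp
  qed auto
qed

section \<open>Lindeberg's central limit theorem\<close>

text \<open>Once all factors have modulus at most one, the distance of the two products is at most
  the sum of the factorwise distances, each at most \<open>(a n i)^2\<close>; uniform smallness of
  \<open>a n i\<close> makes that sum vanish.\<close>

lemma prod_one_minus_tendsto_exp:
  fixes a :: "nat \<Rightarrow> 'i \<Rightarrow> real"
  assumes nonneg: "\<And>n i. i \<in> I n \<Longrightarrow> 0 \<le> a n i"
    and sum: "\<And>n. (\<Sum>i\<in>I n. a n i) = c"
    and small: "\<And>e. e > 0 \<Longrightarrow> \<forall>\<^sub>F n in sequentially. \<forall>i\<in>I n. a n i \<le> e"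
    and fin: "\<And>n. finite (I n)"
  shows "(\<lambda>n. \<Prod>i\<in>I n. 1 - a n i) \<longlonglongrightarrow> exp (- c)"
proof -
  have c: "c \<ge> 0" using sum[of 0, symmetric] nonneg by (simp add: sum_nonneg)
  have bound: "\<bar>(1 - x) - exp (- x)\<bar> \<le> x\<^sup>2" if "0 \<le> x" "x \<le> 1" for x :: real
  proof -
    have "exp (-x) \<ge> 1 - x" using exp_ge_add_one_self[of "-x"] by simp
    moreover have "exp (-x) \<le> 1 - x + x\<^sup>2"
    proof -
      \<comment> \<open>The product on the right is \<open>1 + x^3\<close>.\<close>
      have "1 \<le> (1 - x + x\<^sup>2) * (1 + x)"
        using that by (simp add: algebra_simps power2_eq_square)
      also have "\<dots> \<le> (1 - x + x\<^sup>2) * exp x"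
        using exp_ge_add_one_self[of x] that by (intro mult_left_mono) (auto simp: add.commute)
      finally show ?thesis by (simp add: exp_minus field_simps)
    qed
    ultimately show ?thesis by simp
  qed
  have "(\<lambda>n. (\<Prod>i\<in>I n. 1 - a n i) - exp (- c)) \<longlonglongrightarrow> 0"
  proof (rule tendstoI)
    fix e :: real assume e: "e > 0"
    \<comment> \<open>The 1 keeps each \<open>1 - a n i\<close> in the unit interval; the other
      bound makes \<open>d * c < e\<close>, with \<open>c + 1\<close> in case
      \<open>c = 0\<close>.\<close>
    define d where "d = min 1 (e / (c + 1))"
    have d: "d > 0" using e c by (simp add: d_def)
    have dc: "d * c < e"
    proof -
      have "d * c \<le> e / (c + 1) * c" unfolding d_def using c by (intro mult_right_mono) auto
      also have "\<dots> < e" using e c by (simp add: field_simps)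
      finally show ?thesis .
    qed
    show "\<forall>\<^sub>F n in sequentially. dist ((\<Prod>i\<in>I n. 1 - a n i) - exp (- c)) 0 < e"
      using small[OF d]
    proof eventually_elim
      case (elim n)
      have a: "0 \<le> a n i" "a n i \<le> d" "a n i \<le> 1" if "i \<in> I n" for i
        using elim nonneg that by (auto simp: d_def)
      have "exp (- c) = (\<Prod>i\<in>I n. exp (- a n i))"
        using fin sum by (simp add: exp_sum[symmetric] sum_negf)
      then have "norm ((\<Prod>i\<in>I n. 1 - a n i) - exp (- c))
          \<le> (\<Sum>i\<in>I n. norm ((1 - a n i) - exp (- a n i)))"
        using a by (simp only:) (intro norm_prod_diff, auto)
      also have "\<dots> \<le> (\<Sum>i\<in>I n. d * a n i)"
      proof (rule sum_mono)
        fix i assume i: "i \<in> I n"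
        have "norm ((1 - a n i) - exp (- a n i)) \<le> a n i * a n i"
          using bound[of "a n i"] a[OF i] by (simp add: power2_eq_square)
        also have "\<dots> \<le> d * a n i" using a[OF i] by (intro mult_right_mono) auto
        finally show "norm ((1 - a n i) - exp (- a n i)) \<le> d * a n i" .
      qed
      also have "\<dots> = d * c" by (simp add: sum_distrib_left[symmetric] sum)
      finally show ?case using dc by simp
    qed
  qed
  then show ?thesis by (simp add: LIM_zero_iff)
qed

lemma tendsto_0_if_eventually_le:
  fixes a :: "nat \<Rightarrow> real"
  assumes nonneg: "\<And>n. 0 \<le> a n"
    and "\<And>e. e > 0 \<Longrightarrow> \<forall>\<^sub>F n in sequentially. a n \<le> e"
  shows "a \<longlonglongrightarrow> 0"
proof (rule tendstoI)
  fix e :: real assume "e > 0"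
  then have "\<forall>\<^sub>F n in sequentially. a n \<le> e / 2" by (intro assms) simp
  then show "\<forall>\<^sub>F n in sequentially. dist (a n) 0 < e"
    by eventually_elim (use nonneg \<open>e > 0\<close> in \<open>auto simp: abs_of_nonneg intro: le_less_trans[of _ "e/2"]\<close>)
qed

text \<open>The characteristic function of a summand with variance \<open>s\<close> is compared with
  \<open>1 - t^2 s / 2\<close>, and the product of the latter with \<open>exp (- t^2 / 2)\<close>.
  Each row may live on its own probability space.\<close>

theorem lindeberg_char:
  fixes X :: "nat \<Rightarrow> 'i \<Rightarrow> 'a \<Rightarrow> real"
  assumes prob: "\<And>n. prob_space (M n)"
    and fin: "\<And>n. finite (I n)"
    and indep: "\<And>n. prob_space.indep_vars (M n) (\<lambda>_. borel) (X n) (I n)"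
    and int2: "\<And>n i. i \<in> I n \<Longrightarrow> integrable (M n) (\<lambda>\<omega>. (X n i \<omega>)\<^sup>2)"
    and mean: "\<And>n i. i \<in> I n \<Longrightarrow> (\<integral>\<omega>. X n i \<omega> \<partial>M n) = 0"
    and var: "\<And>n. (\<Sum>i\<in>I n. \<integral>\<omega>. (X n i \<omega>)\<^sup>2 \<partial>M n) = 1"
    and lindeberg: "\<And>e. e > 0 \<Longrightarrow>
      (\<lambda>n. \<Sum>i\<in>I n. \<integral>\<omega>. (X n i \<omega>)\<^sup>2 * indicator {\<omega>. \<bar>X n i \<omega>\<bar> > e} \<omega> \<partial>M n) \<longlonglongrightarrow> 0"
  shows "(\<lambda>n. char (distr (M n) borel (\<lambda>\<omega>. \<Sum>i\<in>I n. X n i \<omega>)) t) \<longlonglongrightarrow> char std_normal_distribution t"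
proof -
  define s where "s n i = (\<integral>\<omega>. (X n i \<omega>)\<^sup>2 \<partial>M n)" for n i
  define L where "L e n = (\<Sum>i\<in>I n. \<integral>\<omega>. (X n i \<omega>)\<^sup>2 * indicator {\<omega>. \<bar>X n i \<omega>\<bar> > e} \<omega> \<partial>M n)" for e n
  define c where "c n i = char (distr (M n) borel (X n i)) t" for n i
  have rv[measurable]: "X n i \<in> borel_measurable (M n)" if "i \<in> I n" for n i
    using indep[of n] that by (simp add: prob_space.indep_vars_def2[OF prob])
  have s0: "s n i \<ge> 0" for n i by (simp add: s_def)
  have int_ind: "integrable (M n) (\<lambda>\<omega>. (X n i \<omega>)\<^sup>2 * indicator {\<omega>. \<bar>X n i \<omega>\<bar> > e} \<omega>)"
    if i: "i \<in> I n" for n i e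
  proof (rule Bochner_Integration.integrable_bound[OF int2[OF i]])
    have [measurable]: "X n i \<in> borel_measurable (M n)" by (rule rv[OF i])
    show "(\<lambda>\<omega>. (X n i \<omega>)\<^sup>2 * indicat_real {\<omega>. e < \<bar>X n i \<omega>\<bar>} \<omega>) \<in> borel_measurable (M n)"
      by measurable
  qed (auto split: split_indicator)
  \<comment> \<open>Cutting at level \<open>e\<close> bounds every single variance by
    \<open>e^2\<close> plus the Lindeberg sum, so no summand dominates asymptotically.\<close>
  have s_le: "s n i \<le> e\<^sup>2 + L e n" if i: "i \<in> I n" and e: "e > 0" for n i e
  proof -
    interpret prob_space "M n" by (rule prob)
    have "s n i \<le> (\<integral>\<omega>. e\<^sup>2 + (X n i \<omega>)\<^sup>2 * indicator {\<omega>. \<bar>X n i \<omega>\<bar> > e} \<omega> \<partial>M n)"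
      unfolding s_def
    proof (rule integral_mono)
      show "(X n i \<omega>)\<^sup>2 \<le> e\<^sup>2 + (X n i \<omega>)\<^sup>2 * indicator {\<omega>. \<bar>X n i \<omega>\<bar> > e} \<omega>" for \<omega>
        using e abs_le_square_iff[of "X n i \<omega>" e] by (auto split: split_indicator)
    qed (use int2[OF i] int_ind[OF i] in auto)
    also have "\<dots> = e\<^sup>2 + (\<integral>\<omega>. (X n i \<omega>)\<^sup>2 * indicator {\<omega>. \<bar>X n i \<omega>\<bar> > e} \<omega> \<partial>M n)"
      using int_ind[OF i] by (simp add: prob_space)
    also have "\<dots> \<le> e\<^sup>2 + L e n"
      unfolding L_def by (intro add_left_mono member_le_sum i fin) auto
    finally show ?thesis .
  qed
  have L0: "L e n \<ge> 0" for e n unfolding L_def by (intro sum_nonneg) auto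
  have small: "\<forall>\<^sub>F n in sequentially. \<forall>i\<in>I n. s n i \<le> e" if e: "e > 0" for e
  proof -
    have "\<forall>\<^sub>F n in sequentially. L (sqrt (e/2)) n < e / 2"
      using lindeberg[of "sqrt (e/2)"] e unfolding L_def[symmetric]
      by (intro order_tendstoD) auto
    then show ?thesis
      by eventually_elim (use s_le[of _ _ "sqrt (e/2)"] e in force)
  qed
  have lim_prod: "(\<lambda>n. \<Prod>i\<in>I n. 1 - t\<^sup>2 / 2 * s n i) \<longlonglongrightarrow> exp (- (t\<^sup>2 / 2))"
  proof (rule prod_one_minus_tendsto_exp)
    show "(\<Sum>i\<in>I n. t\<^sup>2 / 2 * s n i) = t\<^sup>2 / 2" for n
      using var[of n] by (simp only: sum_distrib_left[symmetric] s_def mult_1_right)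
    fix e :: real assume e: "e > 0"
    have "\<forall>\<^sub>F n in sequentially. \<forall>i\<in>I n. s n i \<le> e / (t\<^sup>2 + 1)"
      using e by (intro small) (simp add: add_nonneg_pos)
    then show "\<forall>\<^sub>F n in sequentially. \<forall>i\<in>I n. t\<^sup>2 / 2 * s n i \<le> e"
    proof eventually_elim
      case (elim n)
      show ?case
      proof
        fix i assume "i \<in> I n"
        then have "t\<^sup>2 / 2 * s n i \<le> (t\<^sup>2 + 1) * (e / (t\<^sup>2 + 1))"
          using elim s0 e by (intro mult_mono) auto
        also have "\<dots> = e" by (simp add: add_nonneg_eq_0_iff)
        finally show "t\<^sup>2 / 2 * s n i \<le> e" .
      qed
    qed
  qed (use s0 fin in auto)
  have one: "cmod (c n i - (1 - t\<^sup>2 / 2 * s n i))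
      \<le> t\<^sup>2 / 6 * (\<bar>t\<bar> * e * s n i) + t\<^sup>2 * (\<integral>\<omega>. (X n i \<omega>)\<^sup>2 * indicator {\<omega>. \<bar>X n i \<omega>\<bar> > e} \<omega> \<partial>M n)"
    if i: "i \<in> I n" and e: "e > 0" for n i e
  proof -
    interpret prob_space "M n" by (rule prob)
    have [measurable]: "X n i \<in> borel_measurable (M n)" by (rule rv[OF i])
    have int1: "integrable (M n) (X n i)"
      using int2[OF i] by (rule square_integrable_imp_integrable[rotated]) auto
    have "cmod (c n i - (1 - t\<^sup>2 / 2 * s n i)) = cmod (c n i - (1 - t\<^sup>2 * s n i / 2))"
      by simp
    also have "\<dots> \<le> t\<^sup>2 / 6 * expectation (\<lambda>\<omega>. min (6 * (X n i \<omega>)\<^sup>2) (\<bar>t\<bar> * \<bar>X n i \<omega>\<bar> ^ 3))"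
      unfolding c_def
      by (rule char_approx3') (use int1 int2[OF i] mean[OF i] in \<open>auto simp: s_def\<close>)
    finally have b1: "cmod (c n i - (1 - t\<^sup>2 / 2 * s n i))
      \<le> t\<^sup>2 / 6 * expectation (\<lambda>\<omega>. min (6 * (X n i \<omega>)\<^sup>2) (\<bar>t\<bar> * \<bar>X n i \<omega>\<bar> ^ 3))" .
    \<comment> \<open>Below the cut \<open>e\<close> the cubic term is at most \<open>|t| e\<close>
      times the square; above it the quadratic term is used, and Lindeberg's condition takes
      over.\<close>
    have b2: "expectation (\<lambda>\<omega>. min (6 * (X n i \<omega>)\<^sup>2) (\<bar>t\<bar> * \<bar>X n i \<omega>\<bar> ^ 3))
      \<le> expectation (\<lambda>\<omega>. \<bar>t\<bar> * e * (X n i \<omega>)\<^sup>2 + 6 * ((X n i \<omega>)\<^sup>2 * indicator {\<omega>. \<bar>X n i \<omega>\<bar> > e} \<omega>))"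
    proof (rule integral_mono)
      show "integrable (M n) (\<lambda>\<omega>. min (6 * (X n i \<omega>)\<^sup>2) (\<bar>t\<bar> * \<bar>X n i \<omega>\<bar> ^ 3))"
        by (rule Bochner_Integration.integrable_bound[where f = "\<lambda>\<omega>. 6 * (X n i \<omega>)\<^sup>2"])
           (use int2[OF i] in auto)
      show "integrable (M n) (\<lambda>\<omega>. \<bar>t\<bar> * e * (X n i \<omega>)\<^sup>2 + 6 * ((X n i \<omega>)\<^sup>2 * indicator {\<omega>. \<bar>X n i \<omega>\<bar> > e} \<omega>))"
        using int2[OF i] int_ind[OF i] by (intro Bochner_Integration.integrable_add integrable_mult_right) auto
      show "min (6 * (X n i \<omega>)\<^sup>2) (\<bar>t\<bar> * \<bar>X n i \<omega>\<bar> ^ 3)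
          \<le> \<bar>t\<bar> * e * (X n i \<omega>)\<^sup>2 + 6 * ((X n i \<omega>)\<^sup>2 * indicator {\<omega>. \<bar>X n i \<omega>\<bar> > e} \<omega>)" for \<omega>
      proof (cases "\<bar>X n i \<omega>\<bar> > e")
        case True then show ?thesis using e by (simp add: min_le_iff_disj)
      next
        case False
        have "\<bar>t\<bar> * \<bar>X n i \<omega>\<bar> ^ 3 = \<bar>t\<bar> * \<bar>X n i \<omega>\<bar> * (X n i \<omega>)\<^sup>2"
          by (simp add: power3_eq_cube power2_eq_square mult.assoc abs_mult[symmetric])
        also have "\<dots> \<le> \<bar>t\<bar> * e * (X n i \<omega>)\<^sup>2"
          using False by (intro mult_right_mono mult_left_mono) auto
        finally show ?thesis using False by (simp add: min_le_iff_disj)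
      qed
    qed
    have b3: "expectation (\<lambda>\<omega>. \<bar>t\<bar> * e * (X n i \<omega>)\<^sup>2 + 6 * ((X n i \<omega>)\<^sup>2 * indicator {\<omega>. \<bar>X n i \<omega>\<bar> > e} \<omega>))
      = \<bar>t\<bar> * e * s n i + 6 * (\<integral>\<omega>. (X n i \<omega>)\<^sup>2 * indicator {\<omega>. \<bar>X n i \<omega>\<bar> > e} \<omega> \<partial>M n)"
      using int2[OF i] int_ind[OF i] by (simp add: s_def)
    have "cmod (c n i - (1 - t\<^sup>2 / 2 * s n i)) \<le> t\<^sup>2 / 6 * (\<bar>t\<bar> * e * s n i
        + 6 * (\<integral>\<omega>. (X n i \<omega>)\<^sup>2 * indicator {\<omega>. \<bar>X n i \<omega>\<bar> > e} \<omega> \<partial>M n))"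
      unfolding b3[symmetric] by (rule order_trans[OF b1 mult_left_mono[OF b2]]) simp
    then show ?thesis by (simp add: distrib_left)
  qed
  have diff: "(\<lambda>n. (\<Prod>i\<in>I n. c n i) - of_real (\<Prod>i\<in>I n. 1 - t\<^sup>2 / 2 * s n i)) \<longlonglongrightarrow> 0"
  proof (rule tendsto_norm_zero_cancel, rule tendsto_0_if_eventually_le)
    fix e :: real assume e: "e > 0"
    \<comment> \<open>The cubic part will contribute at most \<open>e/6\<close> and the tail part at
      most \<open>e/2\<close>; the added 1 covers \<open>t = 0\<close>.\<close>
    define d where "d = e / (\<bar>t\<bar> ^ 3 + 1)"
    have d: "d > 0" using e by (simp add: d_def add_nonneg_pos)
    have "\<forall>\<^sub>F n in sequentially. L d n < e / 2 / (t\<^sup>2 + 1)"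
      using lindeberg[OF d] e unfolding L_def[symmetric]
      by (intro order_tendstoD) (auto simp: add_nonneg_pos)
    \<comment> \<open>This keeps \<open>1 - t^2 s / 2\<close> in the unit ball, as the comparison of
      products requires.\<close>
    moreover have "\<forall>\<^sub>F n in sequentially. \<forall>i\<in>I n. s n i \<le> 1 / (t\<^sup>2 + 1)"
      by (intro small) (simp add: add_nonneg_pos)
    ultimately show "\<forall>\<^sub>F n in sequentially.
        norm ((\<Prod>i\<in>I n. c n i) - of_real (\<Prod>i\<in>I n. 1 - t\<^sup>2 / 2 * s n i)) \<le> e"
    proof eventually_elim
      case (elim n)
      interpret prob_space "M n" by (rule prob)
      have pos: "t\<^sup>2 + 1 > 0" by (simp add: add_nonneg_pos)
      have le1: "norm (c n i) \<le> 1" if "i \<in> I n" for i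
        unfolding c_def by (intro real_distribution.cmod_char_le_1 real_distribution_distr rv that)
      have le2: "norm (1 - t\<^sup>2 / 2 * s n i) \<le> 1" if "i \<in> I n" for i
      proof -
        have "t\<^sup>2 * s n i \<le> (t\<^sup>2 + 1) * (1 / (t\<^sup>2 + 1))"
          using elim that s0 by (intro mult_mono) auto
        also have "\<dots> = 1" using pos by simp
        finally show ?thesis using s0[of n i] by (simp add: abs_le_iff)
      qed
      have "norm ((\<Prod>i\<in>I n. c n i) - of_real (\<Prod>i\<in>I n. 1 - t\<^sup>2 / 2 * s n i))
        = norm ((\<Prod>i\<in>I n. c n i) - (\<Prod>i\<in>I n. of_real (1 - t\<^sup>2 / 2 * s n i)))"
        by simp
      also have "\<dots> \<le> (\<Sum>i\<in>I n. cmod (c n i - of_real (1 - t\<^sup>2 / 2 * s n i)))"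
      proof (rule norm_prod_diff)
        show "cmod (of_real (1 - t\<^sup>2 / 2 * s n i)) \<le> 1" if "i \<in> I n" for i
          unfolding norm_of_real using le2[OF that] by simp
      qed (rule le1)
      also have "\<dots> \<le> (\<Sum>i\<in>I n. t\<^sup>2 / 6 * (\<bar>t\<bar> * d * s n i)
          + t\<^sup>2 * (\<integral>\<omega>. (X n i \<omega>)\<^sup>2 * indicator {\<omega>. \<bar>X n i \<omega>\<bar> > d} \<omega> \<partial>M n))"
        by (intro sum_mono) (use one d in simp)
      also have "\<dots> = t\<^sup>2 / 6 * (\<bar>t\<bar> * d) * (\<Sum>i\<in>I n. s n i) + t\<^sup>2 * L d n"
        by (simp add: sum.distrib sum_distrib_left L_def mult.assoc)
      also have "(\<Sum>i\<in>I n. s n i) = 1" using var by (simp add: s_def)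
      also have "t\<^sup>2 / 6 * (\<bar>t\<bar> * d) * 1 = d * \<bar>t\<bar> ^ 3 / 6"
        by (simp add: power3_eq_cube power2_eq_square mult.assoc abs_mult[symmetric])
      also have "\<dots> \<le> d * (\<bar>t\<bar> ^ 3 + 1) / 6"
        using d by (intro divide_right_mono mult_left_mono) auto
      also have "\<dots> = e / 6"
        using add_nonneg_pos[of "\<bar>t\<bar> ^ 3" 1] by (simp add: d_def)
      also have "t\<^sup>2 * L d n \<le> (t\<^sup>2 + 1) * (e / 2 / (t\<^sup>2 + 1))"
        using elim L0 by (intro mult_mono) auto
      also have "\<dots> = e / 2"
        by (metis less_irrefl nonzero_mult_div_cancel_left pos times_divide_eq_right)
      finally show ?case using e by simp
    qed
  qed auto
  have "char (distr (M n) borel (\<lambda>\<omega>. \<Sum>i\<in>I n. X n i \<omega>)) t = (\<Prod>i\<in>I n. c n i)" for n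
    unfolding c_def by (rule prob_space.char_distr_sum[OF prob indep])
  moreover have "(\<lambda>n. complex_of_real (\<Prod>i\<in>I n. 1 - t\<^sup>2 / 2 * s n i)) \<longlonglongrightarrow> complex_of_real (exp (- (t\<^sup>2 / 2)))"
    using lim_prod by (rule tendsto_of_real)
  ultimately show ?thesis
    using Lim_transform[OF _ diff] by (simp add: char_std_normal_distribution)
qed

section \<open>Counting tuples\<close>

text \<open>The premise on \<open>B (s(b := x))\<close> says that \<open>B\<close> ignores
  coordinate \<open>b\<close>. So the other coordinates are chosen freely and at most
  \<open>m\<close> values remain for \<open>b\<close>.\<close>

lemma card_PiE_dependent_le:
  assumes J: "finite J" "b \<in> J" and A: "finite A"
    and B: "\<And>s. finite (B s)" "\<And>s x. B (s(b := x)) = B s"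
      "\<And>s. s \<in> (J - {b}) \<rightarrow>\<^sub>E A \<Longrightarrow> card (B s) \<le> m"
  shows "card {s \<in> J \<rightarrow>\<^sub>E A. s b \<in> B s} \<le> m * card A ^ (card J - 1)"
proof -
  let ?G = "(J - {b}) \<rightarrow>\<^sub>E A"
  have fin: "finite ?G" using J A by (intro finite_PiE) auto
  have "{s \<in> J \<rightarrow>\<^sub>E A. s b \<in> B s} \<subseteq> (\<lambda>(g, y). g(b := y)) ` Sigma ?G B"
  proof safe
    fix s assume s: "s \<in> J \<rightarrow>\<^sub>E A" "s b \<in> B s"
    have "s(b := undefined) \<in> ?G" using s by (auto simp: PiE_def extensional_def)
    moreover have "s b \<in> B (s(b := undefined))" using s B(2) by simp
    ultimately show "s \<in> (\<lambda>(g, y). g(b := y)) ` Sigma ?G B"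
      by (intro image_eqI[of _ _ "(s(b := undefined), s b)"]) auto
  qed
  moreover have "finite (Sigma ?G B)" using fin B(1) by blast
  ultimately have "card {s \<in> J \<rightarrow>\<^sub>E A. s b \<in> B s} \<le> card (Sigma ?G B)"
    by (meson card_image_le card_mono finite_imageI order_trans)
  also have "\<dots> = (\<Sum>g\<in>?G. card (B g))" using fin B(1) by simp
  also have "\<dots> \<le> of_nat (card ?G) * m" using B(3) by (rule sum_bounded_above)
  also have "card ?G = card A ^ (card J - 1)"
    using J by (simp add: card_funcsetE)
  finally show ?thesis by (simp add: mult.commute)
qed

lemma card_PiE_two_le:
  assumes J: "finite J" "a \<in> J" "b \<in> J" "a \<noteq> b" and A: "finite A" and B: "finite B"
  shows "card {s \<in> J \<rightarrow>\<^sub>E A. s a \<in> B \<and> s b \<in> B} \<le> card B ^ 2 * card A ^ (card J - 2)"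
proof -
  let ?T = "\<lambda>j. if j \<in> {a, b} then B else A"
  have "{s \<in> J \<rightarrow>\<^sub>E A. s a \<in> B \<and> s b \<in> B} \<subseteq> PiE J ?T" by (auto simp: PiE_def)
  moreover have "finite (PiE J ?T)" using J A B by (intro finite_PiE) auto
  ultimately have "card {s \<in> J \<rightarrow>\<^sub>E A. s a \<in> B \<and> s b \<in> B} \<le> card (PiE J ?T)"
    by (rule card_mono[rotated])
  also have "\<dots> = (\<Prod>j\<in>J. card (?T j))" using J by (simp add: card_PiE)
  also have "\<dots> = (\<Prod>j\<in>{a, b}. card (?T j)) * (\<Prod>j\<in>J - {a, b}. card (?T j))"
    using J prod.subset_diff[of "{a, b}" J "\<lambda>j. card (?T j)"] by (simp add: mult.commute)
  also have "(\<Prod>j\<in>{a, b}. card (?T j)) = card B ^ 2" using J by (simp add: power2_eq_square)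
  also have "(\<Prod>j\<in>J - {a, b}. card (?T j)) = (\<Prod>j\<in>J - {a, b}. card A)"
    by (rule prod.cong) auto
  also have "\<dots> = card A ^ (card J - 2)" using J by (simp add: card_Diff_subset numeral_2_eq_2)
  finally show ?thesis .
qed

lemma falling_factorial_bounds:
  fixes n k :: nat
  assumes "n \<ge> k" "n > 0"
  shows "(\<Prod>j<k. real n - real j) \<le> real n ^ k"
    and "real n ^ k * (1 - real k ^ 2 / real n) \<le> (\<Prod>j<k. real n - real j)"
    and "(\<Prod>j<k. real n - real j) \<ge> 0"
proof -
  have *: "(\<Prod>j<k. real n - real j) \<le> real n ^ k
    \<and> real n ^ k * (1 - real k ^ 2 / real n) \<le> (\<Prod>j<k. real n - real j)
    \<and> (\<Prod>j<k. real n - real j) \<ge> 0"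
    using assms(1)
  proof (induction k)
    case (Suc k)
    let ?p = "\<Prod>j<k. real n - real j"
    have IH: "?p \<le> real n ^ k" "real n ^ k * (1 - real k ^ 2 / real n) \<le> ?p" "?p \<ge> 0"
      using Suc by auto
    have nk: "real n - real k \<ge> 0" "real n - real k \<le> real n" using Suc.prems by auto
    \<comment> \<open>The loss accumulates through \<open>k^2 + k <= (k + 1)^2\<close>; the product
      of the two losses has the right sign and is dropped.\<close>
    have "real n ^ Suc k * (1 - real (Suc k) ^ 2 / real n)
        \<le> real n ^ Suc k * ((1 - real k ^ 2 / real n) * (1 - real k / real n))"
    proof (rule mult_left_mono)
      have "(1 - real k ^ 2 / real n) * (1 - real k / real n)
        = 1 - (real k ^ 2 + real k) / real n + real k ^ 2 / real n * (real k / real n)"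
        unfolding add_divide_distrib by (simp only: algebra_simps)
      moreover have "real k ^ 2 / real n * (real k / real n) \<ge> 0" by simp
      moreover have "(real k ^ 2 + real k) / real n \<le> real (Suc k) ^ 2 / real n"
        by (intro divide_right_mono) (auto simp: power2_eq_square algebra_simps)
      ultimately show "1 - real (Suc k) ^ 2 / real n \<le> (1 - real k ^ 2 / real n) * (1 - real k / real n)"
        by linarith
    qed simp
    also have "\<dots> = (real n ^ k * (1 - real k ^ 2 / real n)) * (real n - real k)"
      using assms(2) by (simp add: field_simps)
    also have "\<dots> \<le> ?p * (real n - real k)"
      by (rule mult_right_mono) (use IH nk in auto)
    finally have "real n ^ Suc k * (1 - real (Suc k) ^ 2 / real n) \<le> ?p * (real n - real k)" .
    moreover have "?p * (real n - real k) \<le> real n ^ k * real n"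
      using IH nk by (intro mult_mono) auto
    ultimately show ?case using IH nk by (simp add: mult.commute)
  qed (use assms in auto)
  show "(\<Prod>j<k. real n - real j) \<le> real n ^ k"
    and "real n ^ k * (1 - real k ^ 2 / real n) \<le> (\<Prod>j<k. real n - real j)"
    and "(\<Prod>j<k. real n - real j) \<ge> 0"
    using * by auto
qed

section \<open>The Hoeffding decomposition under cluster dependence\<close>

lemma partition_on_cluster_of:
  assumes "partition_on A P" "i \<in> A"
  shows "cluster_of P i \<in> P" "i \<in> cluster_of P i"
proof -
  obtain g where g: "g \<in> P" "i \<in> g" using assms by (auto simp: partition_on_def)
  have "h = g" if "h \<in> P" "i \<in> h" for h
    using disjointD[OF partition_onD2[OF assms(1)] that(1) g(1)] g that by blast
  then have "cluster_of P i = g"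
    unfolding cluster_of_def using g by (intro the_equality) blast+
  with g show "cluster_of P i \<in> P" "i \<in> cluster_of P i" by simp_all
qed

lemma partition_on_cluster_of_eq:
  assumes "partition_on A P" "g \<in> P" "i \<in> g"
  shows "cluster_of P i = g"
proof -
  have "i \<in> A" using assms partition_onD1 by blast
  from partition_on_cluster_of[OF assms(1) this]
  show ?thesis using disjointD[OF partition_onD2[OF assms(1)] _ assms(2)] assms(3) by blast
qed

text \<open>Everything at a fixed \<open>n\<close>. The moments of the kernel enter the error bounds
  through \<open>K\<close> alone, required for all tuples, repeated indices included; their
  constants then depend on \<open>k\<close> and \<open>K\<close> only and are uniform in
  \<open>n\<close>.\<close>

locale clustered_kernel = prob_space M for M :: "'a measure" +
  fixes S :: "'w measure" and W :: "nat \<Rightarrow> 'a \<Rightarrow> 'w" and P :: "nat set set"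
    and n k :: nat and \<phi> :: "(nat \<Rightarrow> 'w) \<Rightarrow> real" and K :: real
  assumes k: "k \<ge> 2" and n: "n \<ge> 1"
    and partition: "partition_on {1..n} P"
    and W: "\<And>i. i \<in> {1..n} \<Longrightarrow> W i \<in> measurable M S"
    and indep: "indep_vars (\<lambda>g. PiM g (\<lambda>_. S)) (\<lambda>g \<omega>. \<lambda>i\<in>g. W i \<omega>) P"
    and kernel_measurable: "\<phi> \<in> borel_measurable (PiM {1..k} (\<lambda>_. S))"
    and kernel_symmetric: "symmetric_kernel S k \<phi>"
    and kernel_centred: "\<And>t. t \<in> {1..k} \<rightarrow>\<^sub>E {1..n} \<Longrightarrow> cluster_generic P k t \<Longrightarrow>
      expectation (kernel_at \<phi> k W t) = 0"
    and square_int: "\<And>t. t \<in> {1..k} \<rightarrow>\<^sub>E {1..n} \<Longrightarrow> integrable M (\<lambda>\<omega>. (kernel_at \<phi> k W t \<omega>)\<^sup>2)"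
    and second_moment: "\<And>t. t \<in> {1..k} \<rightarrow>\<^sub>E {1..n} \<Longrightarrow> expectation (\<lambda>\<omega>. (kernel_at \<phi> k W t \<omega>)\<^sup>2) \<le> K"
begin

abbreviation "cl \<equiv> cluster_of P"
abbreviation "X \<equiv> kernel_at \<phi> k W"
abbreviation "Tup \<equiv> {1..k} \<rightarrow>\<^sub>E {1..n}"

definition Generic :: "(nat \<Rightarrow> nat) set" where
  "Generic = {t \<in> Tup. cluster_generic P k t}"

text \<open>Generated by one joint map, so that its sets are preimages under that map and the lemmas
  on conditioning and independence apply with this map as \<open>V\<close>.\<close>

definition cluster_sigma :: "nat set set \<Rightarrow> 'a measure" where
  "cluster_sigma D = vimage_algebra (space M) (\<lambda>\<omega>. \<lambda>i\<in>\<Union>D. W i \<omega>) (PiM (\<Union>D) (\<lambda>_. S))"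

text \<open>Only position 1 is ever conditioned on. The projection onto position \<open>j\<close> is
  taken at the tuple with positions 1 and \<open>j\<close> exchanged, since symmetry of the kernel
  allows the entry to be moved to the front.\<close>

definition proj :: "(nat \<Rightarrow> nat) \<Rightarrow> 'a \<Rightarrow> real" where
  "proj t = real_cond_exp M (vimage_algebra (space M) (W (t 1)) S) (X t)"

text \<open>On generic tuples the conditional expectation of the remainder given any single cluster vanishes.\<close>

definition remainder :: "(nat \<Rightarrow> nat) \<Rightarrow> 'a \<Rightarrow> real" where
  "remainder t \<omega> = X t \<omega> - (\<Sum>j=1..k. proj (t \<circ> Transposition.transpose 1 j) \<omega>)"

section \<open>Clusters, tuples and transpositions of positions\<close>

lemma one_in_k[simp]: "Suc 0 \<in> {1..k}" "1 \<in> {1..k}" using k by auto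

lemma union_P: "\<Union>P = {1..n}" using partition by (simp add: partition_on_def)

lemma cl_in: "i \<in> {1..n} \<Longrightarrow> cl i \<in> P" and in_cl: "i \<in> {1..n} \<Longrightarrow> i \<in> cl i"
  using partition_on_cluster_of[OF partition] by blast+

lemma cl_eq: "g \<in> P \<Longrightarrow> i \<in> g \<Longrightarrow> cl i = g"
  by (rule partition_on_cluster_of_eq[OF partition])

lemma finite_P: "finite P"
  by (rule finite_UnionD) (simp add: union_P)

lemma P_subset: "g \<in> P \<Longrightarrow> g \<subseteq> {1..n}" using union_P by blast

lemma finite_cluster: "g \<in> P \<Longrightarrow> finite g"
  by (rule finite_subset[OF P_subset]) simp_all

lemma Tup_in: "t \<in> Tup \<Longrightarrow> j \<in> {1..k} \<Longrightarrow> t j \<in> {1..n}"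
  by (rule PiE_mem)

lemma Generic_Tup: "t \<in> Generic \<Longrightarrow> t \<in> Tup" by (simp add: Generic_def)

lemma Generic_cl_inj: "t \<in> Generic \<Longrightarrow> a \<in> {1..k} \<Longrightarrow> b \<in> {1..k} \<Longrightarrow> cl (t a) = cl (t b) \<Longrightarrow> a = b"
  unfolding Generic_def cluster_generic_def by (blast dest: inj_onD)

lemma finite_Tup: "finite Tup" by (intro finite_PiE) auto

lemma finite_Generic: "finite Generic" using finite_Tup by (simp add: Generic_def)

lemma transpose_Tup: "j \<in> {1..k} \<Longrightarrow> t \<in> Tup \<Longrightarrow> t \<circ> Transposition.transpose 1 j \<in> Tup"
  using k by (auto simp: PiE_def Pi_def extensional_def Transposition.transpose_def)

lemma transpose_Generic: assumes "j \<in> {1..k}" "t \<in> Generic" shows "t \<circ> Transposition.transpose 1 j \<in> Generic"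
proof -
  have p: "Transposition.transpose 1 j permutes {1..k}"
    using assms by (intro permutes_swap_id) auto
  have "inj_on (\<lambda>j. cl (t j)) (Transposition.transpose 1 j ` {1..k})"
    using assms permutes_image[OF p] by (simp add: Generic_def cluster_generic_def)
  then have "inj_on ((\<lambda>j. cl (t j)) \<circ> Transposition.transpose 1 j) {1..k}"
    by (intro comp_inj_on) (auto intro: inj_on_subset[OF inj_transpose])
  then show ?thesis
    using assms transpose_Tup by (auto simp: Generic_def cluster_generic_def comp_def)
qed

lemma transpose_bij_Generic:
  assumes "j \<in> {1..k}" shows "bij_betw (\<lambda>t. t \<circ> Transposition.transpose 1 j) Generic Generic"
  by (rule bij_betw_byWitness[where f' = "\<lambda>t. t \<circ> Transposition.transpose 1 j"])
    (use transpose_Generic[OF assms] in \<open>auto simp: comp_assoc\<close>)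

lemma X_transpose:
  assumes "j \<in> {1..k}" "t \<in> Tup" "\<omega> \<in> space M"
  shows "X (t \<circ> Transposition.transpose 1 j) \<omega> = X t \<omega>"
proof -
  have p: "Transposition.transpose 1 j permutes {1..k}"
    using assms by (intro permutes_swap_id) auto
  let ?x = "\<lambda>j\<in>{1..k}. W (t j) \<omega>"
  have "?x \<in> space (PiM {1..k} (\<lambda>_. S))"
    unfolding space_PiM by (intro restrict_PiE_iff[THEN iffD2] ballI measurable_space[OF W] Tup_in assms)
  then have "\<phi> (?x \<circ> Transposition.transpose 1 j) = \<phi> ?x"
    using kernel_symmetric p unfolding symmetric_kernel_def by blast
  also have "?x \<circ> Transposition.transpose 1 j = (\<lambda>i\<in>{1..k}. W ((t \<circ> Transposition.transpose 1 j) i) \<omega>)"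
    using permutes_in_image[OF p] by (auto simp: fun_eq_iff)
  finally show ?thesis unfolding kernel_at_def .
qed

lemma X_measurable_sub:
  assumes "t \<in> Tup" and "\<And>j. j \<in> {1..k} \<Longrightarrow> W (t j) \<in> measurable F S"
  shows "X t \<in> borel_measurable F"
  unfolding kernel_at_def
  by (rule measurable_compose[OF _ kernel_measurable]) (intro measurable_restrict assms)

lemma X_measurable[measurable]: "t \<in> Tup \<Longrightarrow> X t \<in> borel_measurable M"
  by (intro X_measurable_sub W Tup_in) auto

lemma X_integrable: "t \<in> Tup \<Longrightarrow> integrable M (X t)"
  by (rule square_integrable_imp_integrable[OF X_measurable square_int])

lemma K_nonneg: "K \<ge> 0"
proof -
  \<comment> \<open>A constant tuple exists because \<open>n >= 1\<close>, and the bound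
    \<open>K\<close> covers repeated indices too.\<close>
  have "(\<lambda>j\<in>{1..k}. 1) \<in> Tup" using n by auto
  have "0 \<le> expectation (\<lambda>\<omega>. (X (\<lambda>j\<in>{1..k}. 1) \<omega>)\<^sup>2)" by simp
  also have "\<dots> \<le> K" by (rule second_moment) fact
  finally show ?thesis .
qed

lemma subalgebra_W:
  assumes "i \<in> {1..n}" shows "subalgebra M (vimage_algebra (space M) (W i) S)"
proof -
  have "W i \<in> space M \<rightarrow> space S" using measurable_space[OF W[OF assms]] by auto
  then show ?thesis
    using measurable_sets[OF W[OF assms]] by (auto simp: subalgebra_def sets_vimage_algebra2)
qed

lemma proj_measurable[measurable]: "t \<in> Tup \<Longrightarrow> proj t \<in> borel_measurable M"
  unfolding proj_def by simp

lemma proj_convex: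
  fixes q :: "real \<Rightarrow> real"
  assumes t: "t \<in> Tup" and q: "integrable M (\<lambda>\<omega>. q (X t \<omega>))" "convex_on UNIV q" "q \<in> borel_measurable borel"
  shows "integrable M (\<lambda>\<omega>. q (proj t \<omega>))"
    and "expectation (\<lambda>\<omega>. q (proj t \<omega>)) \<le> expectation (\<lambda>\<omega>. q (X t \<omega>))"
  using convex_real_cond_exp[OF subalgebra_W[OF Tup_in[OF t one_in_k(2)]] X_integrable[OF t] q]
  unfolding proj_def by auto

lemma proj_square:
  assumes t: "t \<in> Tup"
  shows "integrable M (\<lambda>\<omega>. (proj t \<omega>)\<^sup>2)" "expectation (\<lambda>\<omega>. (proj t \<omega>)\<^sup>2) \<le> K"
  using proj_convex[OF t square_int[OF t] convex_power2] second_moment[OF t] by auto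

lemma proj_integrable: "t \<in> Tup \<Longrightarrow> integrable M (proj t)"
  by (rule square_integrable_imp_integrable[OF proj_measurable proj_square(1)])

lemma proj_expectation:
  assumes t: "t \<in> Generic" shows "expectation (proj t) = 0"
proof -
  have t': "t \<in> Tup" by (rule Generic_Tup[OF t])
  then have "t 1 \<in> {1..n}" by (rule Tup_in) (rule one_in_k)
  then interpret G: finite_measure_subalgebra M "vimage_algebra (space M) (W (t 1)) S"
    by unfold_locales (rule subalgebra_W)
  show ?thesis
    unfolding proj_def G.real_cond_exp_int(2)[OF X_integrable[OF t']]
    using t kernel_centred by (simp add: Generic_def)
qed

section \<open>Sigma-algebras generated by sets of clusters\<close>

lemma space_sig[simp]: "space (cluster_sigma D) = space M" by (simp add: cluster_sigma_def)

lemma restrict_W_measurable: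
  assumes "D \<subseteq> P" shows "(\<lambda>\<omega>. \<lambda>i\<in>\<Union>D. W i \<omega>) \<in> measurable M (PiM (\<Union>D) (\<lambda>_. S))"
  using assms union_P by (intro measurable_restrict W) blast

lemma sig_subalgebra:
  assumes "D \<subseteq> P" shows "subalgebra M (cluster_sigma D)"
proof -
  have "(\<lambda>\<omega>. \<lambda>i\<in>\<Union>D. W i \<omega>) \<in> space M \<rightarrow> space (PiM (\<Union>D) (\<lambda>_. S))"
    using measurable_space[OF restrict_W_measurable[OF assms]] by auto
  then show ?thesis
    using measurable_sets[OF restrict_W_measurable[OF assms]]
    by (auto simp: subalgebra_def cluster_sigma_def sets_vimage_algebra2)
qed

lemma W_sig:
  assumes "D \<subseteq> P" "i \<in> \<Union>D" shows "W i \<in> measurable (cluster_sigma D) S"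
proof -
  have "(\<lambda>\<omega>. \<lambda>i\<in>\<Union>D. W i \<omega>) \<in> measurable (cluster_sigma D) (PiM (\<Union>D) (\<lambda>_. S))"
    unfolding cluster_sigma_def
    using measurable_space[OF restrict_W_measurable[OF assms(1)]] by (intro measurable_vimage_algebra1) auto
  from measurable_compose[OF this measurable_component_singleton[OF assms(2)]]
  show ?thesis using assms(2) by simp
qed

lemma sig_from_W:
  assumes D: "D \<subseteq> P" and i: "i \<in> \<Union>D" and f: "f \<in> borel_measurable (vimage_algebra (space M) (W i) S)"
  shows "f \<in> borel_measurable (cluster_sigma D)"
proof (rule measurable_from_subalg[OF _ f])
  have "i \<in> {1..n}" using D i union_P by blast
  then have "W i \<in> space M \<rightarrow> space S" using measurable_space[OF W] by auto
  then show "subalgebra (cluster_sigma D) (vimage_algebra (space M) (W i) S)"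
    using measurable_sets[OF W_sig[OF D i]] by (auto simp: subalgebra_def sets_vimage_algebra2)
qed

lemma proj_sig:
  assumes "D \<subseteq> P" "t 1 \<in> \<Union>D" shows "proj t \<in> borel_measurable (cluster_sigma D)"
  by (rule sig_from_W[OF assms]) (simp add: proj_def)

lemma remainder_sig:
  assumes D: "D \<subseteq> P" and t: "t \<in> Tup" "\<And>j. j \<in> {1..k} \<Longrightarrow> t j \<in> \<Union>D"
  shows "remainder t \<in> borel_measurable (cluster_sigma D)"
  unfolding remainder_def
proof (intro borel_measurable_diff borel_measurable_sum)
  show "X t \<in> borel_measurable (cluster_sigma D)"
    by (intro X_measurable_sub W_sig D t)
  show "proj (t \<circ> Transposition.transpose 1 j) \<in> borel_measurable (cluster_sigma D)" if "j \<in> {1..k}" for j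
    by (intro proj_sig D) (use t(2)[OF that] in simp)
qed

lemma sig_mono_measurable:
  assumes "D \<subseteq> P" "f \<in> borel_measurable (cluster_sigma D)" shows "f \<in> borel_measurable M"
  using assms sig_subalgebra measurable_from_subalg by blast

lemma indep_var_clusters:
  assumes D: "D \<subseteq> P"
  shows "indep_var (PiM (\<Union>D) (\<lambda>_. S)) (\<lambda>\<omega>. \<lambda>i\<in>\<Union>D. W i \<omega>)
    (PiM (\<Union>(P - D)) (\<lambda>_. S)) (\<lambda>\<omega>. \<lambda>i\<in>\<Union>(P - D). W i \<omega>)"
proof -
  \<comment> \<open>\<open>Y D\<close> flattens a family of arrays, one per cluster, into a single
    array over the union; \<open>cl i\<close> finds the array that holds unit
    \<open>i\<close>.\<close>
  define Y where "Y D x = (\<lambda>i\<in>\<Union>D. x (cl i) i)" for D and x :: "nat set \<Rightarrow> nat \<Rightarrow> 'w"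
  have Y: "Y D \<in> measurable (PiM D (\<lambda>g. PiM g (\<lambda>_. S))) (PiM (\<Union>D) (\<lambda>_. S))" if D: "D \<subseteq> P" for D
    unfolding Y_def
  proof (rule measurable_restrict)
    fix i assume "i \<in> \<Union>D"
    then obtain g where "g \<in> D" "i \<in> g" by blast
    then have "i \<in> cl i" "cl i \<in> D" using D cl_eq by auto
    then have "(\<lambda>x. x (cl i)) \<in> measurable (PiM D (\<lambda>g. PiM g (\<lambda>_. S))) (PiM (cl i) (\<lambda>_. S))"
      and "(\<lambda>x. x i) \<in> measurable (PiM (cl i) (\<lambda>_. S)) S"
      by (auto intro: measurable_component_singleton)
    then show "(\<lambda>x. x (cl i) i) \<in> measurable (PiM D (\<lambda>g. PiM g (\<lambda>_. S))) S"
      by (rule measurable_compose)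
  qed
  have eq: "Y D \<circ> (\<lambda>\<omega>. \<lambda>g\<in>D. \<lambda>i\<in>g. W i \<omega>) = (\<lambda>\<omega>. \<lambda>i\<in>\<Union>D. W i \<omega>)" if D: "D \<subseteq> P" for D
    unfolding Y_def comp_def
    using D cl_eq by (intro ext restrict_ext) auto
  have "indep_var (PiM D (\<lambda>g. PiM g (\<lambda>_. S))) (\<lambda>\<omega>. \<lambda>g\<in>D. \<lambda>i\<in>g. W i \<omega>)
    (PiM (P - D) (\<lambda>g. PiM g (\<lambda>_. S))) (\<lambda>\<omega>. \<lambda>g\<in>P - D. \<lambda>i\<in>g. W i \<omega>)"
    by (rule indep_var_restrict[OF indep]) (use D in auto)
  from indep_var_compose[OF this Y Y] D show ?thesis
    by (simp add: eq)
qed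

text \<open>Independence concerns the generated sigma-algebras, so it passes to all functions
  measurable for them without writing \<open>u\<close> and \<open>v\<close> as functions of the
  arrays.\<close>

lemma indep_var_sig:
  fixes u v :: "'a \<Rightarrow> real"
  assumes D: "D \<subseteq> P" and u: "u \<in> borel_measurable (cluster_sigma D)" and v: "v \<in> borel_measurable (cluster_sigma (P - D))"
  shows "indep_var borel u borel v"
proof -
  have sub: "sigma_sets (space M) {w -` A \<inter> space M |A. A \<in> sets borel} \<subseteq>
      sigma_sets (space M) {(\<lambda>\<omega>. \<lambda>i\<in>\<Union>E. W i \<omega>) -` A \<inter> space M |A. A \<in> sets (PiM (\<Union>E) (\<lambda>_. S))}"
    if w: "w \<in> borel_measurable (cluster_sigma E)" for w :: "'a \<Rightarrow> real" and E
  proof -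
    have "{w -` A \<inter> space M |A. A \<in> sets borel} \<subseteq> sets (cluster_sigma E)"
      using measurable_sets[OF w] by auto
    then have "sigma_sets (space M) {w -` A \<inter> space M |A. A \<in> sets borel} \<subseteq> sets (cluster_sigma E)"
      using sets.sigma_sets_subset[of _ "cluster_sigma E"] by simp
    then show ?thesis by (simp add: cluster_sigma_def sets_vimage_algebra)
  qed
  have "indep_set
      (sigma_sets (space M) {(\<lambda>\<omega>. \<lambda>i\<in>\<Union>D. W i \<omega>) -` A \<inter> space M |A. A \<in> sets (PiM (\<Union>D) (\<lambda>_. S))})
      (sigma_sets (space M) {(\<lambda>\<omega>. \<lambda>i\<in>\<Union>(P - D). W i \<omega>) -` A \<inter> space M |A. A \<in> sets (PiM (\<Union>(P - D)) (\<lambda>_. S))})"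
    using indep_var_clusters[OF D] unfolding indep_var_eq by blast
  then have "indep_set (sigma_sets (space M) {u -` A \<inter> space M |A. A \<in> sets borel})
      (sigma_sets (space M) {v -` A \<inter> space M |A. A \<in> sets borel})"
    unfolding indep_set_def
    by (rule indep_sets_mono_sets) (use sub[OF u] sub[OF v] in \<open>auto split: bool.split\<close>)
  then show ?thesis
    unfolding indep_var_eq using sig_mono_measurable[of D u] sig_mono_measurable[of "P - D" v] D u v by auto
qed

section \<open>Orthogonality of the remainders\<close>

text \<open>Given the clusters in \<open>D\<close>, only the first entry of \<open>t\<close> is informative.\<close>

lemma expectation_X_mult:
  assumes D: "D \<subseteq> P" and t: "t \<in> Tup" and t1: "t 1 \<in> \<Union>D"
    and out: "\<And>j. j \<in> {2..k} \<Longrightarrow> t j \<in> \<Union>(P - D)"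
    and u: "u \<in> borel_measurable (cluster_sigma D)" and u2: "integrable M (\<lambda>\<omega>. (u \<omega>)\<^sup>2)"
  shows "expectation (\<lambda>\<omega>. u \<omega> * X t \<omega>) = expectation (\<lambda>\<omega>. u \<omega> * proj t \<omega>)"
proof -
  let ?V = "\<lambda>\<omega>. \<lambda>i\<in>\<Union>D. W i \<omega>" and ?Z = "\<lambda>\<omega>. \<lambda>i\<in>\<Union>(P - D). W i \<omega>"
  \<comment> \<open>The first argument stands for the entry inside \<open>D\<close>, the second for
    the array of all units outside \<open>D\<close>, from which the other entries are read.\<close>
  define f where "f = (\<lambda>(a, z). \<phi> (\<lambda>j\<in>{1..k}. if j = 1 then a else z (t j)))"
  have X_eq: "X t = (\<lambda>\<omega>. f (?V \<omega> (t 1), ?Z \<omega>))"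
  proof
    fix \<omega>
    have "(\<lambda>j\<in>{1..k}. W (t j) \<omega>) = (\<lambda>j\<in>{1..k}. if j = 1 then ?V \<omega> (t 1) else ?Z \<omega> (t j))"
      using t1 out by (intro restrict_ext) auto
    then show "X t \<omega> = f (?V \<omega> (t 1), ?Z \<omega>)" by (simp only: kernel_at_def f_def prod.case)
  qed
  have f: "f \<in> borel_measurable (S \<Otimes>\<^sub>M PiM (\<Union>(P - D)) (\<lambda>_. S))"
    unfolding f_def case_prod_beta
  proof (rule measurable_compose[OF _ kernel_measurable], rule measurable_restrict)
    fix j assume j: "j \<in> {1..k}"
    show "(\<lambda>x. if j = 1 then fst x else snd x (t j)) \<in> measurable (S \<Otimes>\<^sub>M PiM (\<Union>(P - D)) (\<lambda>_. S)) S"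
    proof (cases "j = 1")
      case False
      then have "t j \<in> \<Union>(P - D)" using j out by auto
      then show ?thesis
        using False by (simp del: Union_iff add: measurable_compose[OF measurable_snd measurable_component_singleton])
    qed simp
  qed
  interpret D: finite_measure_subalgebra M "cluster_sigma D"
    by unfold_locales (rule sig_subalgebra[OF D])
  have vW: "(\<lambda>\<omega>. ?V \<omega> (t 1)) = W (t 1)" using t1 by auto
  \<comment> \<open>With \<open>V\<close> the array over \<open>D\<close> and \<alpha> its
    coordinate \<open>t 1\<close>, conditioning on the clusters of \<open>D\<close> and on
    \<open>W (t 1)\<close> agree.\<close>
  have "AE \<omega> in M. real_cond_exp M (cluster_sigma D) (X t) \<omega> = proj t \<omega>"
    using real_cond_exp_indep_cong[OF indep_var_clusters[OF D] measurable_component_singleton[OF t1] f]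
      X_integrable[OF t]
    unfolding X_eq[symmetric] vW cluster_sigma_def[symmetric] proj_def[symmetric] by blast
  then have "expectation (\<lambda>\<omega>. u \<omega> * proj t \<omega>) = expectation (\<lambda>\<omega>. u \<omega> * real_cond_exp M (cluster_sigma D) (X t) \<omega>)"
    using sig_mono_measurable[OF D u] t by (intro integral_cong_AE) auto
  also have "\<dots> = expectation (\<lambda>\<omega>. u \<omega> * X t \<omega>)"
    using sig_mono_measurable[OF D u] t u u2 square_int[OF t]
    by (intro D.real_cond_exp_intg(2) integrable_mult_of_squares) auto
  finally show ?thesis by simp
qed

text \<open>Only entry \<open>j\<close> of \<open>t\<close> is visible from \<open>D\<close>. Its
  projection reproduces the pairing of \<open>u\<close> with the kernel value, while the projections
  onto the other entries are independent of \<open>u\<close> and centred.\<close>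

lemma remainder_orthogonal_sig:
  assumes D: "D \<subseteq> P" and t: "t \<in> Generic" and j: "j \<in> {1..k}" "cl (t j) \<in> D"
    and out: "\<And>l. l \<in> {1..k} - {j} \<Longrightarrow> cl (t l) \<notin> D"
    and u: "u \<in> borel_measurable (cluster_sigma D)" and u2: "integrable M (\<lambda>\<omega>. (u \<omega>)\<^sup>2)"
  shows "expectation (\<lambda>\<omega>. u \<omega> * remainder t \<omega>) = 0"
proof -
  have tT: "t \<in> Tup" by (rule Generic_Tup[OF t])
  have um[measurable]: "u \<in> borel_measurable M" by (rule sig_mono_measurable[OF D u])
  have int_u: "integrable M u" by (rule square_integrable_imp_integrable[OF um u2])
  have in_out: "t l \<in> \<Union>(P - D)" if "l \<in> {1..k} - {j}" for l
    using out[OF that] in_cl cl_in Tup_in[OF tT, of l] that by blast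
  have in_D: "t j \<in> \<Union>D" using j in_cl Tup_in[OF tT] by blast
  let ?t = "\<lambda>l. t \<circ> Transposition.transpose 1 l"
  have tl: "?t l \<in> Tup" "?t l \<in> Generic" if "l \<in> {1..k}" for l
    using transpose_Tup[OF that tT] transpose_Generic[OF that t] by auto
  have zero: "expectation (\<lambda>\<omega>. u \<omega> * proj (?t l) \<omega>) = 0" if l: "l \<in> {1..k} - {j}" for l
  proof -
    have "proj (?t l) \<in> borel_measurable (cluster_sigma (P - D))"
      by (rule proj_sig) (use in_out[OF l] in auto)
    then have "indep_var borel u borel (proj (?t l))" by (rule indep_var_sig[OF D u])
    from indep_var_lebesgue_integral[OF this int_u proj_integrable] proj_expectation tl l
    show ?thesis by simp
  qed
  have int_uX: "integrable M (\<lambda>\<omega>. u \<omega> * X t \<omega>)"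
    using tT by (intro integrable_mult_of_squares u2 square_int) auto
  have int_up: "integrable M (\<lambda>\<omega>. u \<omega> * proj (?t l) \<omega>)" if "l \<in> {1..k}" for l
    using tl[OF that] by (intro integrable_mult_of_squares u2 proj_square) auto
  \<comment> \<open>Symmetry moves the visible entry to position 1.\<close>
  have "expectation (\<lambda>\<omega>. u \<omega> * X t \<omega>) = expectation (\<lambda>\<omega>. u \<omega> * X (?t j) \<omega>)"
    by (rule Bochner_Integration.integral_cong) (use X_transpose[OF j(1) tT] in auto)
  also have "\<dots> = expectation (\<lambda>\<omega>. u \<omega> * proj (?t j) \<omega>)"
  proof (rule expectation_X_mult[OF D tl(1)[OF j(1)] _ _ u u2])
    show "?t j 1 \<in> \<Union>D" using in_D by simp
    show "?t j l \<in> \<Union>(P - D)" if "l \<in> {2..k}" for l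
    proof -
      have "Transposition.transpose 1 j l \<in> {1..k} - {j}" using that j by (auto simp: Transposition.transpose_def)
      from in_out[OF this] show ?thesis by simp
    qed
  qed
  also have "\<dots> = (\<Sum>l=1..k. expectation (\<lambda>\<omega>. u \<omega> * proj (?t l) \<omega>))"
    using zero j(1) sum.remove[of "{1..k}" j "\<lambda>l. expectation (\<lambda>\<omega>. u \<omega> * proj (?t l) \<omega>)"]
    by (simp only: finite_atLeastAtMost sum.neutral ball_simps add_0_right) (metis (no_types, lifting) add.right_neutral sum.neutral)
  finally have eq: "expectation (\<lambda>\<omega>. u \<omega> * X t \<omega>) = (\<Sum>l=1..k. expectation (\<lambda>\<omega>. u \<omega> * proj (?t l) \<omega>))" .
  have "expectation (\<lambda>\<omega>. u \<omega> * remainder t \<omega>)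
      = expectation (\<lambda>\<omega>. u \<omega> * X t \<omega> - (\<Sum>l=1..k. u \<omega> * proj (?t l) \<omega>))"
    by (simp add: remainder_def right_diff_distrib sum_distrib_left)
  also have "\<dots> = expectation (\<lambda>\<omega>. u \<omega> * X t \<omega>) - (\<Sum>l=1..k. expectation (\<lambda>\<omega>. u \<omega> * proj (?t l) \<omega>))"
    using int_uX int_up by (subst Bochner_Integration.integral_diff) auto
  finally show ?thesis using eq by simp
qed

lemma remainder_measurable[measurable]: "t \<in> Tup \<Longrightarrow> remainder t \<in> borel_measurable M"
  unfolding remainder_def using transpose_Tup by (intro borel_measurable_diff borel_measurable_sum) auto

lemma remainder_square:
  assumes t: "t \<in> Tup"
  shows "integrable M (\<lambda>\<omega>. (remainder t \<omega>)\<^sup>2)" "expectation (\<lambda>\<omega>. (remainder t \<omega>)\<^sup>2) \<le> (real k + 1)\<^sup>2 * K"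
proof -
  \<comment> \<open>Slot 0 holds the kernel value, so the remainder is a sum of \<open>k + 1\<close>
    terms with second moment at most \<open>K\<close>; Cauchy-Schwarz gives the other factor
    \<open>k + 1\<close>.\<close>
  let ?y = "\<lambda>\<omega> j. if j = 0 then X t \<omega> else - proj (t \<circ> Transposition.transpose 1 j) \<omega>"
  have sq: "(remainder t \<omega>)\<^sup>2 \<le> (real k + 1) * (\<Sum>j=0..k. (?y \<omega> j)\<^sup>2)" for \<omega>
  proof -
    have "remainder t \<omega> = (\<Sum>j=0..k. ?y \<omega> j)"
      by (simp add: remainder_def sum.atLeast_Suc_atMost[of 0 k] sum_negf)
    then have "(remainder t \<omega>)\<^sup>2 \<le> (\<Sum>j=0..k. (?y \<omega> j)\<^sup>2) * real (card {0..k})"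
      using sum_squared_le_sum_of_squares[of "?y \<omega>" "{0..k}"] by (simp only:)
    then show ?thesis by (simp add: mult.commute add.commute)
  qed
  have int_y: "integrable M (\<lambda>\<omega>. (?y \<omega> j)\<^sup>2)" "expectation (\<lambda>\<omega>. (?y \<omega> j)\<^sup>2) \<le> K" if "j \<in> {0..k}" for j
  proof -
    have "integrable M (\<lambda>\<omega>. (?y \<omega> j)\<^sup>2) \<and> expectation (\<lambda>\<omega>. (?y \<omega> j)\<^sup>2) \<le> K"
    proof (cases "j = 0")
      case False
      then have "t \<circ> Transposition.transpose 1 j \<in> Tup" using that by (intro transpose_Tup t) auto
      then show ?thesis using False proj_square by simp
    qed (use square_int[OF t] second_moment[OF t] in simp)
    then show "integrable M (\<lambda>\<omega>. (?y \<omega> j)\<^sup>2)" "expectation (\<lambda>\<omega>. (?y \<omega> j)\<^sup>2) \<le> K" by auto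
  qed
  have int_sum: "integrable M (\<lambda>\<omega>. (real k + 1) * (\<Sum>j=0..k. (?y \<omega> j)\<^sup>2))"
    using int_y by (intro integrable_mult_right Bochner_Integration.integrable_sum) blast
  show int: "integrable M (\<lambda>\<omega>. (remainder t \<omega>)\<^sup>2)"
    by (rule Bochner_Integration.integrable_bound[OF int_sum])
      (use t sq in \<open>auto intro!: AE_I2 order_trans[OF sq]\<close>)
  have "expectation (\<lambda>\<omega>. (remainder t \<omega>)\<^sup>2) \<le> expectation (\<lambda>\<omega>. (real k + 1) * (\<Sum>j=0..k. (?y \<omega> j)\<^sup>2))"
    by (rule integral_mono[OF int int_sum sq])
  also have "\<dots> = (real k + 1) * (\<Sum>j=0..k. expectation (\<lambda>\<omega>. (?y \<omega> j)\<^sup>2))"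
    using int_y by (subst integral_mult_right_zero, subst Bochner_Integration.integral_sum) blast+
  also have "\<dots> \<le> (real k + 1) * (real (card {0..k}) * K)"
    using int_y by (intro mult_left_mono sum_bounded_above) auto
  also have "\<dots> = (real k + 1)\<^sup>2 * K" by (simp add: power2_eq_square algebra_simps)
  finally show "expectation (\<lambda>\<omega>. (remainder t \<omega>)\<^sup>2) \<le> (real k + 1)\<^sup>2 * K" .
qed

text \<open>Whether \<open>t j\<close> itself lies in a cluster of \<open>t'\<close> is left open,
  so the cases of no common cluster and of exactly one are both covered.\<close>

lemma remainder_orthogonal:
  assumes t: "t \<in> Generic" "t' \<in> Generic" and j: "j \<in> {1..k}"
    and out: "\<And>l. l \<in> {1..k} - {j} \<Longrightarrow> cl (t l) \<notin> (\<lambda>l. cl (t' l)) ` {1..k}"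
  shows "expectation (\<lambda>\<omega>. remainder t' \<omega> * remainder t \<omega>) = 0"
proof (rule remainder_orthogonal_sig[OF _ t(1) j])
  \<comment> \<open>Removing only the clusters of the other entries of \<open>t\<close> leaves a set
    that contains the cluster of \<open>t j\<close> and all clusters of \<open>t'\<close>.\<close>
  let ?D = "P - (\<lambda>l. cl (t l)) ` ({1..k} - {j})"
  have T: "t \<in> Tup" "t' \<in> Tup" using t Generic_Tup by auto
  show "?D \<subseteq> P" by auto
  show "cl (t j) \<in> ?D"
    using Generic_cl_inj[OF t(1)] j cl_in Tup_in[OF T(1)] by auto
  show "cl (t l) \<notin> ?D" if "l \<in> {1..k} - {j}" for l using that by auto
  show "remainder t' \<in> borel_measurable (cluster_sigma ?D)"
  proof (rule remainder_sig[OF _ T(2)])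
    fix l assume l: "l \<in> {1..k}"
    then have "cl (t' l) \<notin> (\<lambda>l. cl (t l)) ` ({1..k} - {j})" using out by force
    then have "cl (t' l) \<in> ?D" using cl_in Tup_in[OF T(2) l] by blast
    then show "t' l \<in> \<Union>?D" using in_cl Tup_in[OF T(2) l] by blast
  qed auto
  show "integrable M (\<lambda>\<omega>. (remainder t' \<omega>)\<^sup>2)" by (rule remainder_square[OF T(2)])
qed

section \<open>Counting nongeneric tuples and correlated pairs\<close>

abbreviation "m \<equiv> max_cluster_size P"
abbreviation "mproj \<equiv> mean_projection M S P \<phi> k n W"
abbreviation "compl \<equiv> generic_completions P k n"

lemma card_cluster_le: "g \<in> P \<Longrightarrow> card g \<le> m"
  unfolding max_cluster_size_def using finite_P by (intro Max_ge) auto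

lemma m_bounds: "1 \<le> m" "m \<le> n"
proof -
  have "1 \<in> {1..n}" using n by simp
  note g = cl_in[OF this] in_cl[OF this]
  have "card (cl 1) \<ge> 1"
    using g finite_cluster[OF g(1)] by (metis One_nat_def Suc_leI card_gt_0_iff empty_iff)
  with card_cluster_le[OF g(1)] show "1 \<le> m" by simp
  have "card g \<le> n" if "g \<in> P" for g
    using card_mono[OF _ P_subset[OF that]] by simp
  then show "m \<le> n"
    unfolding max_cluster_size_def using finite_P g(1) by (intro Max.boundedI) auto
qed

text \<open>Intersecting with \<open>{1..n}\<close> makes the set finite for every index, also where
  \<open>cl\<close> has no specified value; \<open>card_PiE_dependent_le\<close> asks for
  this.\<close>

lemma card_cl_le: "i \<in> {1..n} \<Longrightarrow> card (cl i \<inter> {1..n}) \<le> m"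
  using card_cluster_le[OF cl_in] card_mono[of "cl i" "cl i \<inter> {1..n}"] finite_cluster[OF cl_in]
  by (meson inf_le1 order_trans)

lemma card_pairs_le: "card {(a, b). a \<in> {1..k} \<and> b \<in> {1..k} \<and> Q a b} \<le> k\<^sup>2"
proof -
  have "card {(a, b). a \<in> {1..k} \<and> b \<in> {1..k} \<and> Q a b} \<le> card ({1..k} \<times> {1..k})"
    by (intro card_mono) auto
  then show ?thesis by (simp add: power2_eq_square)
qed

lemma finite_pairs: "finite {(a, b). a \<in> {1..k} \<and> b \<in> {1..k} \<and> Q a b}"
  by (rule finite_subset[of _ "{1..k} \<times> {1..k}"]) auto

lemma card_UN_pairs_le:
  assumes "\<And>a b. a \<in> {1..k} \<Longrightarrow> b \<in> {1..k} \<Longrightarrow> Q a b \<Longrightarrow> card (A a b) \<le> c"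
  shows "card (\<Union>(a, b)\<in>{(a, b). a \<in> {1..k} \<and> b \<in> {1..k} \<and> Q a b}. A a b) \<le> k\<^sup>2 * c"
proof -
  let ?I = "{(a, b). a \<in> {1..k} \<and> b \<in> {1..k} \<and> Q a b}"
  have "card (\<Union>(a, b)\<in>?I. A a b) \<le> (\<Sum>p\<in>?I. card (case p of (a, b) \<Rightarrow> A a b))"
    by (rule card_UN_le[OF finite_pairs])
  also have "\<dots> \<le> of_nat (card ?I) * c"
    by (rule sum_bounded_above) (use assms in auto)
  also have "\<dots> \<le> k\<^sup>2 * c" using card_pairs_le[of Q] by simp
  finally show ?thesis .
qed

text \<open>Some entry \<open>b\<close> lies in the cluster of another entry \<open>a\<close>: at
  most \<open>k^2\<close> pairs of positions, and \<open>m\<close> values at \<open>b\<close> once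
  the rest is fixed.\<close>

lemma card_nongeneric_le: "card (Tup - Generic) \<le> k\<^sup>2 * (m * n ^ (k - 1))"
proof -
  let ?A = "\<lambda>a b. {t \<in> Tup. t b \<in> cl (t a) \<inter> {1..n}}"
  have "Tup - Generic \<subseteq> (\<Union>(a, b)\<in>{(a, b). a \<in> {1..k} \<and> b \<in> {1..k} \<and> a \<noteq> b}. ?A a b)"
  proof
    fix t assume t: "t \<in> Tup - Generic"
    then have "\<not> inj_on (\<lambda>j. cl (t j)) {1..k}" by (simp add: Generic_def cluster_generic_def)
    then obtain a b where ab: "a \<in> {1..k}" "b \<in> {1..k}" "a \<noteq> b" "cl (t a) = cl (t b)"
      by (auto simp: inj_on_def)
    then have "t b \<in> cl (t a) \<inter> {1..n}" using in_cl Tup_in t by (metis DiffD1 IntI)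
    with ab t show "t \<in> (\<Union>(a, b)\<in>{(a, b). a \<in> {1..k} \<and> b \<in> {1..k} \<and> a \<noteq> b}. ?A a b)" by blast
  qed
  then have "card (Tup - Generic) \<le> card (\<Union>(a, b)\<in>{(a, b). a \<in> {1..k} \<and> b \<in> {1..k} \<and> a \<noteq> b}. ?A a b)"
    by (rule card_mono[rotated]) (rule finite_subset[OF _ finite_Tup], auto)
  also have "\<dots> \<le> k\<^sup>2 * (m * n ^ (k - 1))"
  proof (rule card_UN_pairs_le)
    fix a b assume ab: "a \<in> {1..k}" "b \<in> {1..k}" "a \<noteq> b"
    have "card (?A a b) \<le> m * card {1..n} ^ (card {1..k} - 1)"
    proof (rule card_PiE_dependent_le)
      fix s assume "s \<in> ({1..k} - {b}) \<rightarrow>\<^sub>E {1..n}"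
      then have "s a \<in> {1..n}" by (rule PiE_mem) (use ab in simp)
      then show "card (cl (s a) \<inter> {1..n}) \<le> m" by (rule card_cl_le)
    qed (use ab in auto)
    then show "card (?A a b) \<le> m * n ^ (k - 1)" by simp
  qed
  finally show ?thesis .
qed

lemma finite_compl: "finite (compl i)"
  by (rule finite_subset[of _ "{2..k} \<rightarrow>\<^sub>E {1..n}"]) (auto simp: generic_completions_def intro: finite_PiE)

lemma upd_Tup:
  assumes "s \<in> {2..k} \<rightarrow>\<^sub>E {1..n}" "i \<in> {1..n}" shows "s(1 := i) \<in> Tup"
  using assms k by (auto simp: PiE_def Pi_def extensional_def)

lemma card_compl_bounds:
  assumes i: "i \<in> {1..n}"
  shows "card (compl i) \<le> n ^ (k - 1)" "n ^ (k - 1) \<le> card (compl i) + k\<^sup>2 * (m * n ^ (k - 2))"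
proof -
  let ?C = "{2..k} \<rightarrow>\<^sub>E {1..n}"
  \<comment> \<open>Position 1 is frozen at \<open>i\<close>, so the restricted position
    \<open>b\<close> must be a free one; in a coincidence of two distinct positions at least one is
    free.\<close>
  let ?Q = "\<lambda>a b. a \<noteq> b \<and> b \<in> {2..k}"
  let ?A = "\<lambda>a b. {s \<in> ?C. s b \<in> cl ((s(1 := i)) a) \<inter> {1..n}}"
  have finC: "finite ?C" by (intro finite_PiE) auto
  have cardC: "card ?C = n ^ (k - 1)" by (simp add: card_funcsetE)
  have sub: "compl i \<subseteq> ?C" by (auto simp: generic_completions_def)
  show "card (compl i) \<le> n ^ (k - 1)" using card_mono[OF finC sub] cardC by simp
  have "?C - compl i \<subseteq> (\<Union>(a, b)\<in>{(a, b). a \<in> {1..k} \<and> b \<in> {1..k} \<and> ?Q a b}. ?A a b)"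
  proof
    fix s assume s: "s \<in> ?C - compl i"
    let ?t = "s(1 := i)"
    have tT: "?t \<in> Tup" using upd_Tup[OF _ i] s by blast
    have "\<not> inj_on (\<lambda>j. cl (?t j)) {1..k}"
      using s by (simp add: generic_completions_def cluster_generic_def)
    then obtain a b where ab: "a \<in> {1..k}" "b \<in> {1..k}" "a \<noteq> b" "cl (?t a) = cl (?t b)"
      unfolding inj_on_def by blast
    have *: "s \<in> ?A a b" if ab: "a \<in> {1..k}" "b \<in> {1..k}" "b \<noteq> 1" "cl (?t a) = cl (?t b)" for a b
    proof -
      have "?t b \<in> {1..n}" by (rule Tup_in[OF tT ab(2)])
      note in_cl[OF this] this
      then have "s b \<in> cl (?t a) \<inter> {1..n}" using ab by (simp del: One_nat_def)
      then show ?thesis using s by blast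
    qed
    consider "b \<noteq> 1" | "a \<noteq> 1" using ab by blast
    then show "s \<in> (\<Union>(a, b)\<in>{(a, b). a \<in> {1..k} \<and> b \<in> {1..k} \<and> ?Q a b}. ?A a b)"
    proof cases
      case 1
      then have "b \<in> {2..k}" using ab by auto
      with 1 show ?thesis using *[OF ab(1,2) 1 ab(4)] ab by blast
    next
      case 2
      then have "a \<in> {2..k}" using ab by auto
      with 2 show ?thesis using *[OF ab(2,1) 2 ab(4)[symmetric]] ab by blast
    qed
  qed
  then have "card (?C - compl i) \<le> card (\<Union>(a, b)\<in>{(a, b). a \<in> {1..k} \<and> b \<in> {1..k} \<and> ?Q a b}. ?A a b)"
    by (rule card_mono[rotated]) (rule finite_subset[OF _ finC], auto)
  also have "\<dots> \<le> k\<^sup>2 * (m * n ^ (k - 2))"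
  proof (rule card_UN_pairs_le)
    fix a b assume ab: "a \<in> {1..k}" "b \<in> {1..k}" "?Q a b"
    have "card (?A a b) \<le> m * card {1..n} ^ (card {2..k} - 1)"
    proof (rule card_PiE_dependent_le)
      fix s assume s: "s \<in> ({2..k} - {b}) \<rightarrow>\<^sub>E {1..n}"
      have "(s(1 := i)) a \<in> {1..n}"
      proof (cases "a = 1")
        case False
        then have "s a \<in> {1..n}" by (intro PiE_mem[OF s]) (use ab in auto)
        then show ?thesis using False by simp
      qed (use i in simp)
      then show "card (cl ((s(1 := i)) a) \<inter> {1..n}) \<le> m" by (rule card_cl_le)
    qed (use ab in auto)
    also have "card {2..k} - 1 = k - 2" by simp
    finally show "card (?A a b) \<le> m * n ^ (k - 2)" by simp
  qed
  finally have "card (?C - compl i) \<le> k\<^sup>2 * (m * n ^ (k - 2))" .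
  moreover have "card ?C = card (compl i) + card (?C - compl i)"
    using card_Diff_subset[OF finite_compl sub] card_mono[OF finC sub] by simp
  ultimately show "n ^ (k - 1) \<le> card (compl i) + k\<^sup>2 * (m * n ^ (k - 2))" using cardC by simp
qed

text \<open>Two positions of \<open>t\<close> must fall into the set of units sharing a cluster with
  \<open>t'\<close>, which has at most \<open>k * m\<close> elements.\<close>

lemma card_nonorthogonal_le:
  assumes t': "t' \<in> Generic"
  shows "card {t \<in> Generic. expectation (\<lambda>\<omega>. remainder t' \<omega> * remainder t \<omega>) \<noteq> 0} \<le> k\<^sup>2 * ((k * m)\<^sup>2 * n ^ (k - 2))"
proof -
  define B where "B = (\<Union>l\<in>{1..k}. cl (t' l))"
  let ?A = "\<lambda>a b. {t \<in> Tup. t a \<in> B \<and> t b \<in> B}"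
  have t'P: "cl (t' l) \<in> P" if "l \<in> {1..k}" for l using cl_in Tup_in[OF Generic_Tup[OF t'] that] by blast
  have finB: "finite B" unfolding B_def using t'P finite_cluster by blast
  have cardB: "card B \<le> k * m"
  proof -
    have "card B \<le> (\<Sum>l\<in>{1..k}. card (cl (t' l)))" unfolding B_def by (rule card_UN_le) simp
    also have "\<dots> \<le> of_nat (card {1..k}) * m" using t'P by (intro sum_bounded_above card_cluster_le)
    finally show ?thesis by simp
  qed
  have "{t \<in> Generic. expectation (\<lambda>\<omega>. remainder t' \<omega> * remainder t \<omega>) \<noteq> 0}
      \<subseteq> (\<Union>(a, b)\<in>{(a, b). a \<in> {1..k} \<and> b \<in> {1..k} \<and> a \<noteq> b}. ?A a b)"
  proof
    fix t assume t: "t \<in> {t \<in> Generic. expectation (\<lambda>\<omega>. remainder t' \<omega> * remainder t \<omega>) \<noteq> 0}"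
    then have tG: "t \<in> Generic" by simp
    have hit: "\<exists>l\<in>{1..k} - {j}. t l \<in> B" if j: "j \<in> {1..k}" for j
    proof -
      obtain l where l: "l \<in> {1..k} - {j}" "cl (t l) \<in> (\<lambda>l. cl (t' l)) ` {1..k}"
        using remainder_orthogonal[OF tG t' j] t by blast
      have "t l \<in> cl (t l)" using in_cl Tup_in[OF Generic_Tup[OF tG]] l by blast
      then show ?thesis using l unfolding B_def by blast
    qed
    \<comment> \<open>Omitting position 1 yields one hit \<open>a\<close>; omitting \<open>a\<close>
      then yields a second hit at a different position.\<close>
    obtain a where a: "a \<in> {1..k}" "t a \<in> B" using hit[OF one_in_k(2)] by blast
    obtain b where b: "b \<in> {1..k}" "b \<noteq> a" "t b \<in> B" using hit[OF a(1)] by blast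
    show "t \<in> (\<Union>(a, b)\<in>{(a, b). a \<in> {1..k} \<and> b \<in> {1..k} \<and> a \<noteq> b}. ?A a b)"
      using a b Generic_Tup[OF tG] by blast
  qed
  then have "card {t \<in> Generic. expectation (\<lambda>\<omega>. remainder t' \<omega> * remainder t \<omega>) \<noteq> 0}
      \<le> card (\<Union>(a, b)\<in>{(a, b). a \<in> {1..k} \<and> b \<in> {1..k} \<and> a \<noteq> b}. ?A a b)"
    by (rule card_mono[rotated]) (rule finite_subset[OF _ finite_Tup], auto)
  also have "\<dots> \<le> k\<^sup>2 * ((k * m)\<^sup>2 * n ^ (k - 2))"
  proof (rule card_UN_pairs_le)
    fix a b assume ab: "a \<in> {1..k}" "b \<in> {1..k}" "a \<noteq> b"
    have "card (?A a b) \<le> card B ^ 2 * card {1..n} ^ (card {1..k} - 2)"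
      by (rule card_PiE_two_le) (use ab finB in auto)
    also have "\<dots> \<le> (k * m)\<^sup>2 * n ^ (k - 2)"
      using cardB by (simp add: power_mono)
    finally show "card (?A a b) \<le> (k * m)\<^sup>2 * n ^ (k - 2)" .
  qed
  finally show ?thesis .
qed

lemma remainder_sum_measurable: "(\<lambda>\<omega>. \<Sum>t\<in>Generic. remainder t \<omega>) \<in> borel_measurable M"
  using Generic_Tup by (intro borel_measurable_sum) auto

lemma remainder_mult_integrable:
  "t \<in> Generic \<Longrightarrow> t' \<in> Generic \<Longrightarrow> integrable M (\<lambda>\<omega>. remainder t' \<omega> * remainder t \<omega>)"
  by (intro integrable_mult_of_squares remainder_square remainder_measurable Generic_Tup)

text \<open>Each of at most \<open>n^k\<close> tuples is correlated with at most
  \<open>k^2 (k m)^2 n^(k-2)\<close> tuples, which is the origin of \<open>k^4\<close>; each pairing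
  is at most \<open>(k + 1)^2 K\<close>.\<close>

lemma remainder_sum_square:
  shows "integrable M (\<lambda>\<omega>. (\<Sum>t\<in>Generic. remainder t \<omega>)\<^sup>2)"
    and "expectation (\<lambda>\<omega>. (\<Sum>t\<in>Generic. remainder t \<omega>)\<^sup>2)
      \<le> (real k ^ 4 * (real k + 1)\<^sup>2 * K) * (real m / real n)\<^sup>2 * (real n ^ k)\<^sup>2"
proof -
  let ?R = "(real k + 1)\<^sup>2 * K"
  have R0: "?R \<ge> 0" using K_nonneg by simp
  have sq: "(\<lambda>\<omega>. (\<Sum>t\<in>Generic. remainder t \<omega>)\<^sup>2) = (\<lambda>\<omega>. \<Sum>t'\<in>Generic. \<Sum>t\<in>Generic. remainder t' \<omega> * remainder t \<omega>)"
    by (simp add: power2_eq_square sum_product)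
  show "integrable M (\<lambda>\<omega>. (\<Sum>t\<in>Generic. remainder t \<omega>)\<^sup>2)"
    unfolding sq by (intro Bochner_Integration.integrable_sum remainder_mult_integrable)
  have one: "expectation (\<lambda>\<omega>. remainder t' \<omega> * remainder t \<omega>) \<le> ?R" if "t \<in> Generic" "t' \<in> Generic" for t t'
  proof -
    have T: "t \<in> Tup" "t' \<in> Tup" using that Generic_Tup by auto
    have "expectation (\<lambda>\<omega>. remainder t' \<omega> * remainder t \<omega>) \<le> expectation (\<lambda>\<omega>. ((remainder t' \<omega>)\<^sup>2 + (remainder t \<omega>)\<^sup>2) / 2)"
    proof (rule integral_mono)
      show "remainder t' \<omega> * remainder t \<omega> \<le> ((remainder t' \<omega>)\<^sup>2 + (remainder t \<omega>)\<^sup>2) / 2" for \<omega>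
        using sum_squares_bound[of "remainder t' \<omega>" "remainder t \<omega>"] by simp
    qed (use remainder_mult_integrable[OF that] remainder_square T in auto)
    also have "\<dots> = (expectation (\<lambda>\<omega>. (remainder t' \<omega>)\<^sup>2) + expectation (\<lambda>\<omega>. (remainder t \<omega>)\<^sup>2)) / 2"
      using remainder_square T by simp
    also have "\<dots> \<le> ?R" using remainder_square(2)[OF T(1)] remainder_square(2)[OF T(2)] by simp
    finally show ?thesis .
  qed
  have "expectation (\<lambda>\<omega>. (\<Sum>t\<in>Generic. remainder t \<omega>)\<^sup>2)
      = (\<Sum>t'\<in>Generic. \<Sum>t\<in>Generic. expectation (\<lambda>\<omega>. remainder t' \<omega> * remainder t \<omega>))"
    unfolding sq
    by (subst Bochner_Integration.integral_sum)
      (intro Bochner_Integration.integrable_sum remainder_mult_integrable sum.cong refl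
        Bochner_Integration.integral_sum; assumption)+
  also have "\<dots> \<le> (\<Sum>t'\<in>Generic. real (k\<^sup>2 * ((k * m)\<^sup>2 * n ^ (k - 2))) * ?R)"
  proof (rule sum_mono)
    fix t' assume t': "t' \<in> Generic"
    let ?B = "{t \<in> Generic. expectation (\<lambda>\<omega>. remainder t' \<omega> * remainder t \<omega>) \<noteq> 0}"
    have "(\<Sum>t\<in>Generic. expectation (\<lambda>\<omega>. remainder t' \<omega> * remainder t \<omega>))
        = (\<Sum>t\<in>?B. expectation (\<lambda>\<omega>. remainder t' \<omega> * remainder t \<omega>))"
      by (rule sum.mono_neutral_right) (use finite_Generic in auto)
    also have "\<dots> \<le> of_nat (card ?B) * ?R"
      by (rule sum_bounded_above) (use one t' in auto)
    also have "\<dots> \<le> real (k\<^sup>2 * ((k * m)\<^sup>2 * n ^ (k - 2))) * ?R"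
      using card_nonorthogonal_le[OF t'] R0 by (intro mult_right_mono) (simp_all only: of_nat_le_iff)
    finally show "(\<Sum>t\<in>Generic. expectation (\<lambda>\<omega>. remainder t' \<omega> * remainder t \<omega>))
        \<le> real (k\<^sup>2 * ((k * m)\<^sup>2 * n ^ (k - 2))) * ?R" .
  qed
  also have "\<dots> = real (card Generic) * (real (k\<^sup>2 * ((k * m)\<^sup>2 * n ^ (k - 2))) * ?R)" by simp
  also have "\<dots> \<le> real n ^ k * (real (k\<^sup>2 * ((k * m)\<^sup>2 * n ^ (k - 2))) * ?R)"
  proof (rule mult_right_mono)
    have "card Generic \<le> card Tup" using finite_Tup by (intro card_mono) (auto simp: Generic_def)
    then show "real (card Generic) \<le> real n ^ k" by (simp add: card_funcsetE flip: of_nat_power)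
  qed (use R0 in simp)
  also have "\<dots> = (real k ^ 4 * ?R) * (real m)\<^sup>2 * real n ^ (k - 2) * real n ^ k"
    by (simp add: power2_eq_square power4_eq_xxxx mult_ac)
  also have "real n ^ (k - 2) = real n ^ k / (real n)\<^sup>2"
    using k n by (simp add: power_diff)
  also have "(real k ^ 4 * ?R) * (real m)\<^sup>2 * (real n ^ k / (real n)\<^sup>2) * real n ^ k
    = (real k ^ 4 * (real k + 1)\<^sup>2 * K) * (real m / real n)\<^sup>2 * (real n ^ k)\<^sup>2"
    by (simp add: power_divide power2_eq_square[of "real n ^ k"] mult_ac)
  finally show "expectation (\<lambda>\<omega>. (\<Sum>t\<in>Generic. remainder t \<omega>)\<^sup>2)
      \<le> (real k ^ 4 * (real k + 1)\<^sup>2 * K) * (real m / real n)\<^sup>2 * (real n ^ k)\<^sup>2" .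
qed

section \<open>Averaged projections and the linear part\<close>

lemma compl_Generic: "i \<in> {1..n} \<Longrightarrow> s \<in> compl i \<Longrightarrow> s(1 := i) \<in> Generic"
  unfolding Generic_def generic_completions_def using upd_Tup by blast

lemma mproj_eq:
  "mproj i \<omega> = (\<Sum>s\<in>compl i. proj (s(1 := i)) \<omega>) / real (card (compl i))"
  by (simp add: mean_projection_def first_projection_def proj_def)

lemma sum_proj_Generic:
  "(\<Sum>t\<in>Generic. proj t \<omega>) = (\<Sum>i=1..n. real (card (compl i)) * mproj i \<omega>)"
proof -
  \<comment> \<open>A generic tuple is its first entry together with a completion. Completions are
    extensional on \<open>{2..k}\<close>, so position 1 is reset to
    \<open>undefined\<close>.\<close>
  have bij: "bij_betw (\<lambda>(i, s). s(1 := i)) (Sigma {1..n} compl) Generic"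
  proof (rule bij_betw_byWitness[where f' = "\<lambda>t. (t 1, t(1 := undefined))"])
    show "\<forall>p\<in>Sigma {1..n} compl. (((\<lambda>(i, s). s(1 := i)) p) 1, ((\<lambda>(i, s). s(1 := i)) p)(1 := undefined)) = p"
      by (auto simp: generic_completions_def PiE_def extensional_def fun_eq_iff)
    show "\<forall>t\<in>Generic. (\<lambda>(i, s). s(1 := i)) (t 1, t(1 := undefined)) = t" by auto
    show "(\<lambda>(i, s). s(1 := i)) ` Sigma {1..n} compl \<subseteq> Generic" using compl_Generic by auto
    show "(\<lambda>t. (t 1, t(1 := undefined))) ` Generic \<subseteq> Sigma {1..n} compl"
    proof safe
      fix t assume t: "t \<in> Generic"
      then have T: "t \<in> Tup" by (rule Generic_Tup)
      show "t 1 \<in> {1..n}" using Tup_in[OF T one_in_k(2)] .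
      have "t(1 := undefined) \<in> {2..k} \<rightarrow>\<^sub>E {1..n}"
        using T by (auto simp: PiE_def Pi_def extensional_def)
      then show "t(1 := undefined) \<in> compl (t 1)"
        using t by (simp add: generic_completions_def Generic_def)
    qed
  qed
  have "(\<Sum>t\<in>Generic. proj t \<omega>) = (\<Sum>(i, s)\<in>Sigma {1..n} compl. proj (s(1 := i)) \<omega>)"
    using sum.reindex_bij_betw[OF bij, of "\<lambda>t. proj t \<omega>"] by (simp add: case_prod_beta)
  also have "\<dots> = (\<Sum>i=1..n. \<Sum>s\<in>compl i. proj (s(1 := i)) \<omega>)"
    using finite_compl by (intro sum.Sigma[symmetric]) auto
  also have "\<dots> = (\<Sum>i=1..n. real (card (compl i)) * mproj i \<omega>)"
  proof (rule sum.cong[OF refl])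
    fix i
    \<comment> \<open>Without completions both sides are 0, which the default value of the empty
      average does not disturb.\<close>
    show "(\<Sum>s\<in>compl i. proj (s(1 := i)) \<omega>) = real (card (compl i)) * mproj i \<omega>"
      by (cases "compl i = {}") (use finite_compl[of i] in \<open>auto simp: mproj_eq\<close>)
  qed
  finally show ?thesis .
qed

text \<open>Transposition permutes the generic tuples, so each of the \<open>k\<close> positions
  contributes the same total projection.\<close>

lemma sum_X_Generic:
  "(\<Sum>t\<in>Generic. X t \<omega>) = (\<Sum>t\<in>Generic. remainder t \<omega>) + real k * (\<Sum>i=1..n. real (card (compl i)) * mproj i \<omega>)"
proof -
  have "(\<Sum>t\<in>Generic. X t \<omega>) = (\<Sum>t\<in>Generic. remainder t \<omega> + (\<Sum>j=1..k. proj (t \<circ> Transposition.transpose 1 j) \<omega>))"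
    by (simp add: remainder_def)
  also have "\<dots> = (\<Sum>t\<in>Generic. remainder t \<omega>) + (\<Sum>j=1..k. \<Sum>t\<in>Generic. proj (t \<circ> Transposition.transpose 1 j) \<omega>)"
    unfolding sum.distrib by (subst (2) sum.swap) simp
  also have "(\<Sum>j=1..k. \<Sum>t\<in>Generic. proj (t \<circ> Transposition.transpose 1 j) \<omega>) = (\<Sum>j=1..k. \<Sum>t\<in>Generic. proj t \<omega>)"
    by (intro sum.cong[OF refl] sum.reindex_bij_betw[OF transpose_bij_Generic, of _ "\<lambda>t. proj t \<omega>"])
  finally show ?thesis by (simp add: sum_proj_Generic)
qed

lemma mproj_measurable[measurable]: "mproj i \<in> borel_measurable M"
  unfolding mean_projection_def first_projection_def by measurable

lemma mproj_sig:
  assumes "g \<in> P" "i \<in> g" shows "mproj i \<in> borel_measurable (cluster_sigma {g})"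
proof (rule sig_from_W)
  show "mproj i \<in> borel_measurable (vimage_algebra (space M) (W i) S)"
    unfolding mean_projection_def first_projection_def by measurable
qed (use assms in auto)

text \<open>Jensen's inequality is used twice, for the conditional expectation and for the average
  over completions, and neither step enlarges \<kappa>. The condition \<open>q 0 = 0\<close> serves
  units without completions. The instances are the square and the excess function.\<close>

lemma mproj_convex:
  fixes q :: "real \<Rightarrow> real"
  assumes i: "i \<in> {1..n}" and q: "convex_on UNIV q" "q \<in> borel_measurable borel" "\<And>x. q x \<ge> 0" "q 0 = 0"
    and int: "\<And>t. t \<in> Tup \<Longrightarrow> integrable M (\<lambda>\<omega>. q (X t \<omega>))"
    and le: "\<And>t. t \<in> Tup \<Longrightarrow> expectation (\<lambda>\<omega>. q (X t \<omega>)) \<le> \<kappa>" and \<kappa>: "\<kappa> \<ge> 0"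
  shows "integrable M (\<lambda>\<omega>. q (mproj i \<omega>))" "expectation (\<lambda>\<omega>. q (mproj i \<omega>)) \<le> \<kappa>"
proof -
  have "integrable M (\<lambda>\<omega>. q (mproj i \<omega>)) \<and> expectation (\<lambda>\<omega>. q (mproj i \<omega>)) \<le> \<kappa>"
  proof (cases "compl i = {}")
    case True
    then show ?thesis using q \<kappa> by (simp add: mproj_eq)
  next
    case False
    let ?c = "1 / real (card (compl i))"
    have cpos: "card (compl i) > 0" using False finite_compl by (simp add: card_gt_0_iff)
    have sT: "s(1 := i) \<in> Tup" if "s \<in> compl i" for s
      using compl_Generic[OF i that] by (rule Generic_Tup)
    have le_q: "q (mproj i \<omega>) \<le> (\<Sum>s\<in>compl i. ?c * q (proj (s(1 := i)) \<omega>))" for \<omega>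
      using convex_on_sum[OF finite_compl[of i] False q(1), of "\<lambda>_. ?c" "\<lambda>s. proj (s(1 := i)) \<omega>"] cpos
      by (simp add: mproj_eq sum_divide_distrib)
    have int_p: "integrable M (\<lambda>\<omega>. q (proj (s(1 := i)) \<omega>))"
      "expectation (\<lambda>\<omega>. q (proj (s(1 := i)) \<omega>)) \<le> \<kappa>" if "s \<in> compl i" for s
      using proj_convex[OF sT[OF that] int[OF sT[OF that]] q(1,2)] le[OF sT[OF that]] by auto
    have int_s: "integrable M (\<lambda>\<omega>. \<Sum>s\<in>compl i. ?c * q (proj (s(1 := i)) \<omega>))"
      using int_p by (intro Bochner_Integration.integrable_sum integrable_mult_right) auto
    have int_q: "integrable M (\<lambda>\<omega>. q (mproj i \<omega>))"
    proof (rule Bochner_Integration.integrable_bound[OF int_s])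
      show "(\<lambda>\<omega>. q (mproj i \<omega>)) \<in> borel_measurable M" using q(2) by measurable
      show "AE \<omega> in M. norm (q (mproj i \<omega>)) \<le> norm (\<Sum>s\<in>compl i. ?c * q (proj (s(1 := i)) \<omega>))"
        using le_q q(3) by (intro AE_I2) (auto simp: abs_of_nonneg intro: order_trans[OF _ abs_ge_self])
    qed
    have "expectation (\<lambda>\<omega>. q (mproj i \<omega>)) \<le> (\<Sum>s\<in>compl i. ?c * expectation (\<lambda>\<omega>. q (proj (s(1 := i)) \<omega>)))"
      using integral_mono[OF int_q int_s le_q] int_p by (simp add: Bochner_Integration.integral_sum)
    also have "\<dots> \<le> of_nat (card (compl i)) * (?c * \<kappa>)"
      using int_p by (intro sum_bounded_above mult_left_mono) auto
    also have "\<dots> = \<kappa>" using cpos by simp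
    finally show ?thesis using int_q by simp
  qed
  then show "integrable M (\<lambda>\<omega>. q (mproj i \<omega>))" "expectation (\<lambda>\<omega>. q (mproj i \<omega>)) \<le> \<kappa>" by auto
qed

section \<open>Independent cluster sums\<close>

definition cluster_sum :: "nat set \<Rightarrow> 'a \<Rightarrow> real" where
  "cluster_sum g \<omega> = (\<Sum>i\<in>g. mproj i \<omega>)"

lemma cluster_sum_sig: "g \<in> P \<Longrightarrow> cluster_sum g \<in> borel_measurable (cluster_sigma {g})"
  unfolding cluster_sum_def by (intro borel_measurable_sum mproj_sig)

lemma cluster_sum_measurable[measurable]: "cluster_sum g \<in> borel_measurable M"
  unfolding cluster_sum_def by measurable

text \<open>A third use of Jensen's inequality, now over the units of a cluster. Division by
  \<open>card g\<close> makes the sum an average, and the bound holds under arbitrary dependence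
  within the cluster.\<close>

lemma cluster_sum_convex:
  fixes q :: "real \<Rightarrow> real"
  assumes g: "g \<in> P" and q: "convex_on UNIV q" "q \<in> borel_measurable borel" "\<And>x. q x \<ge> 0" "q 0 = 0"
    and int: "\<And>t. t \<in> Tup \<Longrightarrow> integrable M (\<lambda>\<omega>. q (X t \<omega>))"
    and le: "\<And>t. t \<in> Tup \<Longrightarrow> expectation (\<lambda>\<omega>. q (X t \<omega>)) \<le> \<kappa>" and \<kappa>: "\<kappa> \<ge> 0"
  shows "integrable M (\<lambda>\<omega>. q (cluster_sum g \<omega> / real (card g)))" "expectation (\<lambda>\<omega>. q (cluster_sum g \<omega> / real (card g))) \<le> \<kappa>"
proof -
  let ?c = "1 / real (card g)"
  have g_ne: "g \<noteq> {}" using partition g by (auto simp: partition_on_def)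
  have fin: "finite g" by (rule finite_cluster[OF g])
  have cpos: "card g > 0" using g_ne fin by (simp add: card_gt_0_iff)
  have le_q: "q (cluster_sum g \<omega> / real (card g)) \<le> (\<Sum>i\<in>g. ?c * q (mproj i \<omega>))" for \<omega>
    using convex_on_sum[OF fin g_ne q(1), of "\<lambda>_. ?c" "\<lambda>i. mproj i \<omega>"] cpos
    by (simp add: cluster_sum_def sum_divide_distrib)
  have int_p: "integrable M (\<lambda>\<omega>. q (mproj i \<omega>))"
    "expectation (\<lambda>\<omega>. q (mproj i \<omega>)) \<le> \<kappa>" if "i \<in> g" for i
  proof -
    have i: "i \<in> {1..n}" using P_subset[OF g] that by blast
    show "integrable M (\<lambda>\<omega>. q (mproj i \<omega>))" "expectation (\<lambda>\<omega>. q (mproj i \<omega>)) \<le> \<kappa>"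
      using mproj_convex[OF i q int le \<kappa>] by auto
  qed
  have int_s: "integrable M (\<lambda>\<omega>. \<Sum>i\<in>g. ?c * q (mproj i \<omega>))"
    using int_p by (intro Bochner_Integration.integrable_sum integrable_mult_right) auto
  show int_q: "integrable M (\<lambda>\<omega>. q (cluster_sum g \<omega> / real (card g)))"
  proof (rule Bochner_Integration.integrable_bound[OF int_s])
    show "(\<lambda>\<omega>. q (cluster_sum g \<omega> / real (card g))) \<in> borel_measurable M" using q(2) by measurable
    show "AE \<omega> in M. norm (q (cluster_sum g \<omega> / real (card g))) \<le> norm (\<Sum>i\<in>g. ?c * q (mproj i \<omega>))"
      using le_q q(3) by (intro AE_I2) (auto simp: abs_of_nonneg intro: order_trans[OF _ abs_ge_self])
  qed
  have "expectation (\<lambda>\<omega>. q (cluster_sum g \<omega> / real (card g))) \<le> (\<Sum>i\<in>g. ?c * expectation (\<lambda>\<omega>. q (mproj i \<omega>)))"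
    using integral_mono[OF int_q int_s le_q] int_p by (simp add: Bochner_Integration.integral_sum)
  also have "\<dots> \<le> of_nat (card g) * (?c * \<kappa>)"
    using int_p by (intro sum_bounded_above mult_left_mono) auto
  also have "\<dots> = \<kappa>" using cpos by simp
  finally show "expectation (\<lambda>\<omega>. q (cluster_sum g \<omega> / real (card g))) \<le> \<kappa>" .
qed

lemma mproj_square:
  assumes "i \<in> {1..n}"
  shows "integrable M (\<lambda>\<omega>. (mproj i \<omega>)\<^sup>2)" "expectation (\<lambda>\<omega>. (mproj i \<omega>)\<^sup>2) \<le> K"
  by (rule mproj_convex[OF assms convex_power2 _ _ _ square_int second_moment K_nonneg]; simp)+

lemma mproj_integrable: "i \<in> {1..n} \<Longrightarrow> integrable M (mproj i)"
  by (rule square_integrable_imp_integrable[OF mproj_measurable mproj_square(1)])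

lemma mproj_expectation:
  assumes i: "i \<in> {1..n}" shows "expectation (mproj i) = 0"
proof -
  have s: "s(1 := i) \<in> Generic" "s(1 := i) \<in> Tup" if "s \<in> compl i" for s
    using compl_Generic[OF i that] Generic_Tup by auto
  have "expectation (\<lambda>\<omega>. \<Sum>s\<in>compl i. proj (s(1 := i)) \<omega>) = (\<Sum>s\<in>compl i. expectation (proj (s(1 := i))))"
    using s by (intro Bochner_Integration.integral_sum proj_integrable)
  also have "\<dots> = 0" using s proj_expectation by (intro sum.neutral) blast
  finally have eq: "expectation (\<lambda>\<omega>. \<Sum>s\<in>compl i. proj (s(1 := i)) \<omega>) = 0" .
  have "mproj i = (\<lambda>\<omega>. (\<Sum>s\<in>compl i. proj (s(1 := i)) \<omega>) / real (card (compl i)))"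
    by (intro ext mproj_eq)
  then show ?thesis using eq by (simp only: integral_divide_zero div_0)
qed

lemma cluster_sum_square:
  assumes g: "g \<in> P"
  shows "integrable M (\<lambda>\<omega>. (cluster_sum g \<omega>)\<^sup>2)" "expectation (\<lambda>\<omega>. (cluster_sum g \<omega>)\<^sup>2) \<le> K * (real (card g))\<^sup>2"
proof -
  have c: "card g > 0"
    using partition g finite_cluster[OF g] by (auto simp: partition_on_def card_gt_0_iff)
  have *: "integrable M (\<lambda>\<omega>. (cluster_sum g \<omega> / real (card g))\<^sup>2)" "expectation (\<lambda>\<omega>. (cluster_sum g \<omega> / real (card g))\<^sup>2) \<le> K"
    by (rule cluster_sum_convex[OF g convex_power2 _ _ _ square_int second_moment K_nonneg]; simp)+
  have "integrable M (\<lambda>\<omega>. (real (card g))\<^sup>2 * (cluster_sum g \<omega> / real (card g))\<^sup>2)"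
    by (intro integrable_mult_right *)
  then show "integrable M (\<lambda>\<omega>. (cluster_sum g \<omega>)\<^sup>2)" using c by (simp add: power_divide)
  show "expectation (\<lambda>\<omega>. (cluster_sum g \<omega>)\<^sup>2) \<le> K * (real (card g))\<^sup>2"
    using *(2) c by (simp add: power_divide divide_le_eq)
qed

lemma cluster_sum_integrable: "g \<in> P \<Longrightarrow> integrable M (cluster_sum g)"
  by (rule square_integrable_imp_integrable[OF cluster_sum_measurable cluster_sum_square(1)])

lemma cluster_sum_expectation:
  assumes g: "g \<in> P" shows "expectation (cluster_sum g) = 0"
proof -
  have "i \<in> {1..n}" if "i \<in> g" for i using P_subset[OF g] that by blast
  then show ?thesis
    unfolding cluster_sum_def using mproj_integrable mproj_expectation by (subst Bochner_Integration.integral_sum) auto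
qed

text \<open>The events of a cluster sum are events of the array of its cluster, and independence of
  families of events passes to subfamilies.\<close>

lemma cluster_sum_indep: "indep_vars (\<lambda>_. borel) cluster_sum P"
proof -
  have "indep_sets (\<lambda>g. {(\<lambda>\<omega>. \<lambda>i\<in>g. W i \<omega>) -` A \<inter> space M |A. A \<in> sets (PiM g (\<lambda>_. S))}) P"
    using indep unfolding indep_vars_def2 by blast
  then have "indep_sets (\<lambda>g. {cluster_sum g -` A \<inter> space M |A. A \<in> sets borel}) P"
  proof (rule indep_sets_mono_sets)
    fix g assume g: "g \<in> P"
    have V: "(\<lambda>\<omega>. \<lambda>i\<in>g. W i \<omega>) \<in> space M \<rightarrow> space (PiM g (\<lambda>_. S))"
      using measurable_space[OF restrict_W_measurable[of "{g}"]] g by auto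
    have "{cluster_sum g -` A \<inter> space M |A. A \<in> sets borel} \<subseteq> sets (cluster_sigma {g})"
      using measurable_sets[OF cluster_sum_sig[OF g]] by auto
    then show "{cluster_sum g -` A \<inter> space M |A. A \<in> sets borel}
        \<subseteq> {(\<lambda>\<omega>. \<lambda>i\<in>g. W i \<omega>) -` A \<inter> space M |A. A \<in> sets (PiM g (\<lambda>_. S))}"
      using V by (simp add: cluster_sigma_def sets_vimage_algebra2)
  qed
  then show ?thesis unfolding indep_vars_def2 by simp
qed

lemma sum_mproj: "(\<Sum>i=1..n. mproj i \<omega>) = (\<Sum>g\<in>P. cluster_sum g \<omega>)"
proof -
  have "(\<Sum>g\<in>P. cluster_sum g \<omega>) = sum (\<lambda>i. mproj i \<omega>) (\<Union>P)"
    unfolding cluster_sum_def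
    by (rule sum.Union_disjoint_sets[symmetric, unfolded comp_def])
      (use finite_cluster partition_onD2[OF partition] in auto)
  then show ?thesis by (simp add: union_P)
qed

text \<open>Cross terms vanish by independence and centring; the squares are summed through
  \<open>(card g)^2 <= m * card g\<close> and the fact that cluster sizes add up to
  \<open>n\<close>.\<close>

lemma sum_cluster_sum_square:
  shows "integrable M (\<lambda>\<omega>. (\<Sum>g\<in>P. cluster_sum g \<omega>)\<^sup>2)"
    and "expectation (\<lambda>\<omega>. (\<Sum>g\<in>P. cluster_sum g \<omega>)\<^sup>2) \<le> K * real m * real n"
proof -
  have sq: "(\<lambda>\<omega>. (\<Sum>g\<in>P. cluster_sum g \<omega>)\<^sup>2) = (\<lambda>\<omega>. \<Sum>g\<in>P. \<Sum>h\<in>P. cluster_sum g \<omega> * cluster_sum h \<omega>)"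
    by (simp add: power2_eq_square sum_product)
  have int: "integrable M (\<lambda>\<omega>. cluster_sum g \<omega> * cluster_sum h \<omega>)" if "g \<in> P" "h \<in> P" for g h
    by (intro integrable_mult_of_squares cluster_sum_measurable cluster_sum_square that)
  show "integrable M (\<lambda>\<omega>. (\<Sum>g\<in>P. cluster_sum g \<omega>)\<^sup>2)"
    unfolding sq by (intro Bochner_Integration.integrable_sum int)
  have zero: "expectation (\<lambda>\<omega>. cluster_sum g \<omega> * cluster_sum h \<omega>) = 0" if gh: "g \<in> P" "h \<in> P" "h \<noteq> g" for g h
  proof -
    have "cluster_sum h \<in> borel_measurable (cluster_sigma (P - {g}))"
      unfolding cluster_sum_def
    proof (intro borel_measurable_sum)
      fix i assume i: "i \<in> h"
      show "mproj i \<in> borel_measurable (cluster_sigma (P - {g}))"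
      proof (rule sig_from_W)
        show "mproj i \<in> borel_measurable (vimage_algebra (space M) (W i) S)"
          unfolding mean_projection_def first_projection_def by measurable
      qed (use gh i in auto)
    qed
    then have "indep_var borel (cluster_sum g) borel (cluster_sum h)"
      using gh by (intro indep_var_sig[of "{g}"] cluster_sum_sig) auto
    from indep_var_lebesgue_integral[OF this cluster_sum_integrable cluster_sum_integrable] gh cluster_sum_expectation
    show ?thesis by simp
  qed
  have "expectation (\<lambda>\<omega>. (\<Sum>g\<in>P. cluster_sum g \<omega>)\<^sup>2) = (\<Sum>g\<in>P. \<Sum>h\<in>P. expectation (\<lambda>\<omega>. cluster_sum g \<omega> * cluster_sum h \<omega>))"
    unfolding sq
    by (subst Bochner_Integration.integral_sum)
      (intro Bochner_Integration.integrable_sum int sum.cong refl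
        Bochner_Integration.integral_sum; assumption)+
  also have "\<dots> = (\<Sum>g\<in>P. \<Sum>h\<in>P. if h = g then expectation (\<lambda>\<omega>. (cluster_sum g \<omega>)\<^sup>2) else 0)"
    by (intro sum.cong refl) (auto simp: zero power2_eq_square)
  also have "\<dots> = (\<Sum>g\<in>P. expectation (\<lambda>\<omega>. (cluster_sum g \<omega>)\<^sup>2))"
    using finite_P by (intro sum.cong) auto
  also have "\<dots> \<le> (\<Sum>g\<in>P. K * real m * real (card g))"
  proof (rule sum_mono)
    fix g assume g: "g \<in> P"
    have "(real (card g))\<^sup>2 \<le> real m * real (card g)"
      using card_cluster_le[OF g] by (simp add: power2_eq_square mult_right_mono)
    then have "K * (real (card g))\<^sup>2 \<le> K * (real m * real (card g))"
      using K_nonneg by (rule mult_left_mono)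
    then show "expectation (\<lambda>\<omega>. (cluster_sum g \<omega>)\<^sup>2) \<le> K * real m * real (card g)"
      using cluster_sum_square(2)[OF g] by (simp add: mult.assoc)
  qed
  also have "\<dots> = K * real m * real (\<Sum>g\<in>P. card g)" by (simp add: sum_distrib_left)
  also have "(\<Sum>g\<in>P. card g) = card (\<Union>P)"
    using finite_cluster partition_onD2[OF partition]
    by (intro card_Union_disjoint[symmetric]) (auto simp: disjoint_def pairwise_def disjnt_def)
  finally show "expectation (\<lambda>\<omega>. (\<Sum>g\<in>P. cluster_sum g \<omega>)\<^sup>2) \<le> K * real m * real n" by (simp add: union_P)
qed

section \<open>Bounds for the U-statistic\<close>

abbreviation "U \<equiv> U_stat \<phi> k n W"
abbreviation "\<sigma> \<equiv> sigma_U M S P \<phi> k n W"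
abbreviation "Err \<omega> \<equiv> U \<omega> - real k / real n * (\<Sum>i=1..n. mproj i \<omega>)"

lemma U_measurable[measurable]: "U \<in> borel_measurable M"
  unfolding U_stat_def by (intro borel_measurable_times borel_measurable_const borel_measurable_sum) auto

lemma U_integrable: "integrable M U"
  unfolding U_stat_def
  by (intro integrable_mult_right Bochner_Integration.integrable_sum X_integrable) auto

lemma Err_integrable: "integrable M Err"
  by (intro Bochner_Integration.integrable_diff U_integrable integrable_mult_right
      Bochner_Integration.integrable_sum mproj_integrable)

lemma expectation_abs_le:
  assumes "Y \<in> borel_measurable M" "integrable M (\<lambda>\<omega>. (Y \<omega>)\<^sup>2)" "expectation (\<lambda>\<omega>. (Y \<omega>)\<^sup>2) \<le> K"
  shows "expectation (\<lambda>\<omega>. \<bar>Y \<omega>\<bar>) \<le> (1 + K) / 2"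
  using expectation_abs_le_square[OF assms(1,2), of K 1] assms(3) by simp

text \<open>The summands bound, in turn, the remainders, the nongeneric tuples with distinct
  indices, and the deviating weights of the averaged projections. The 4 comes from bounding the
  falling factorial below by half of \<open>n^k\<close>.\<close>

definition err_const :: real where
  "err_const = (1 + 4 * (real k ^ 4 * (real k + 1)\<^sup>2 * K)) / 2 + real k ^ 2 * (1 + K) + real k ^ 3 * (1 + K)"

lemma Err_bound:
  assumes large: "n \<ge> 2 * k\<^sup>2"
  shows "expectation (\<lambda>\<omega>. \<bar>Err \<omega>\<bar>) \<le> err_const * (real m / real n)"
proof -
  define N where "N = (\<Prod>j<k. real n - real j)"
  define Inj where "Inj = {t \<in> Tup. inj_on t {1..k}}"
  \<comment> \<open>Generic tuples give unit \<open>i\<close> the weight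
    \<open>card (compl i) / N\<close> where the linear part has \<open>1 / n\<close>.\<close>
  define d where "d i = real (card (compl i)) / N - 1 / real n" for i
  have n0: "real n > 0" using n by simp
  have m0: "real m \<ge> 1" using m_bounds by simp
  have K0: "K \<ge> 0" by (rule K_nonneg)
  have "k \<le> k\<^sup>2" using k by (simp add: power2_eq_square)
  then have kn: "k \<le> n" using large by simp
  have "real (2 * k\<^sup>2) \<le> real n" using large by (simp only: of_nat_le_iff)
  \<comment> \<open>Here \<open>n >= 2 k^2\<close> enters: it keeps the falling factorial above
    \<open>n^k / 2\<close>.\<close>
  then have half: "real k ^ 2 / real n \<le> 1 / 2" using n0 by (simp add: field_simps)
  have N_le: "N \<le> real n ^ k" and N_ge: "real n ^ k * (1 - real k ^ 2 / real n) \<le> N"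
    using falling_factorial_bounds[OF kn] n by (auto simp: N_def)
  have N_half: "real n ^ k / 2 \<le> N"
  proof -
    have "real n ^ k * (1 / 2) \<le> real n ^ k * (1 - real k ^ 2 / real n)"
      using half by (intro mult_left_mono) auto
    from order_trans[OF this N_ge] show ?thesis by simp
  qed
  have nk: "real n ^ k > 0" using n0 by simp
  then have N0: "N > 0" using N_half by linarith
  have pow1: "real n ^ k = real n * real n ^ (k - 1)"
    using k by (simp add: power_eq_if)
  have pow2: "real n ^ (k - 1) = real n * real n ^ (k - 2)"
    using k power_Suc[of "real n" "k - 2"] by (simp add: numeral_2_eq_2 Suc_diff_Suc)
  \<comment> \<open>Both \<open>n * card (compl i)\<close> and \<open>N\<close> lie below
    \<open>n^k\<close> by at most \<open>k^2 m n^(k-1)\<close>, so their gap is no larger; it is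
    then divided by \<open>n * N\<close>.\<close>
  have d_le: "\<bar>d i\<bar> \<le> 2 * real k ^ 2 * real m / (real n)\<^sup>2" if i: "i \<in> {1..n}" for i
  proof -
    let ?Q = "real (card (compl i))"
    have "real (card (compl i)) \<le> real (n ^ (k - 1))"
      "real (n ^ (k - 1)) \<le> real (card (compl i) + k\<^sup>2 * (m * n ^ (k - 2)))"
      using card_compl_bounds[OF i] by (simp_all only: of_nat_le_iff)
    then have Q: "?Q \<le> real n ^ (k - 1)" "real n ^ (k - 1) \<le> ?Q + real k ^ 2 * (real m * real n ^ (k - 2))"
      by simp_all
    have "real n * ?Q - N \<le> real n * real n ^ (k - 1) - real n ^ k * (1 - real k ^ 2 / real n)"
      using Q(1) N_ge n0 by (intro diff_mono mult_left_mono) auto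
    also have "\<dots> = real k ^ 2 * real n ^ (k - 1)"
      using n0 by (simp add: pow1 field_simps)
    also have "\<dots> \<le> real k ^ 2 * (real m * real n ^ (k - 1))"
      using m0 by (intro mult_left_mono) (simp_all add: mult_le_cancel_right1)
    finally have up: "real n * ?Q - N \<le> real k ^ 2 * (real m * real n ^ (k - 1))" .
    have "N - real n * ?Q \<le> real n * real n ^ (k - 1) - real n * ?Q"
      using N_le pow1 by simp
    also have "\<dots> = real n * (real n ^ (k - 1) - ?Q)" by (simp add: right_diff_distrib)
    also have "\<dots> \<le> real n * (real k ^ 2 * (real m * real n ^ (k - 2)))"
      using Q(2) n0 by (intro mult_left_mono) auto
    also have "\<dots> = real k ^ 2 * (real m * real n ^ (k - 1))" by (simp add: pow2[unfolded One_nat_def])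
    finally have abs: "\<bar>real n * ?Q - N\<bar> \<le> real k ^ 2 * (real m * real n ^ (k - 1))" using up by simp
    have "d i = (real n * ?Q - N) / (real n * N)" using n0 N0 by (simp add: d_def field_simps)
    then have "\<bar>d i\<bar> = \<bar>real n * ?Q - N\<bar> / (real n * N)" using n0 N0 by simp
    also have "\<dots> \<le> real k ^ 2 * (real m * real n ^ (k - 1)) / (real n * (real n ^ k / 2))"
      using abs N_half n0 nk N0 by (intro frac_le mult_left_mono) auto
    also have "\<dots> = 2 * real k ^ 2 * real m / (real n)\<^sup>2"
      using n0 by (simp add: pow1 power2_eq_square)
    finally show ?thesis .
  qed
  have GenInj: "Generic \<subseteq> Inj"
    unfolding Inj_def Generic_def cluster_generic_def by (auto simp: inj_on_def)
  have finInj: "finite Inj" using finite_Tup by (simp add: Inj_def)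
  have InjT: "t \<in> Tup" if "t \<in> Inj" for t using that by (simp add: Inj_def)
  have cardInj: "real (card (Inj - Generic)) \<le> real k ^ 2 * (real m * real n ^ (k - 1))"
  proof -
    have "card (Inj - Generic) \<le> card (Tup - Generic)" using finite_Tup InjT by (intro card_mono) auto
    also note card_nongeneric_le
    finally have "real (card (Inj - Generic)) \<le> real (k\<^sup>2 * (m * n ^ (k - 1)))"
      by (simp only: of_nat_le_iff)
    then show ?thesis by simp
  qed
  \<comment> \<open>\<open>R\<close> profits from orthogonality and is bounded through its second
    moment; \<open>A\<close> and \<open>Q\<close> are bounded termwise in mean.\<close>
  define R where "R \<omega> = (\<Sum>t\<in>Generic. remainder t \<omega>) / N" for \<omega>
  define A where "A \<omega> = (\<Sum>t\<in>Inj - Generic. \<bar>X t \<omega>\<bar>) / N" for \<omega>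
  define Q where "Q \<omega> = real k * (\<Sum>i=1..n. \<bar>d i\<bar> * \<bar>mproj i \<omega>\<bar>)" for \<omega>
  have decomp: "\<bar>Err \<omega>\<bar> \<le> \<bar>R \<omega>\<bar> + A \<omega> + Q \<omega>" for \<omega>
  proof -
    have "U \<omega> = (\<Sum>t\<in>Inj. X t \<omega>) / N"
      by (simp add: U_stat_def N_def Inj_def)
    also have "(\<Sum>t\<in>Inj. X t \<omega>) = (\<Sum>t\<in>Inj - Generic. X t \<omega>) + (\<Sum>t\<in>Generic. X t \<omega>)"
      by (rule sum.subset_diff[OF GenInj finInj])
    finally have U_eq: "U \<omega> = R \<omega> + (\<Sum>t\<in>Inj - Generic. X t \<omega>) / N
        + real k * (\<Sum>i=1..n. real (card (compl i)) / N * mproj i \<omega>)"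
      by (simp add: sum_X_Generic R_def add_divide_distrib sum_divide_distrib sum_distrib_left)
    have "real k * (\<Sum>i=1..n. real (card (compl i)) / N * mproj i \<omega>) - real k / real n * (\<Sum>i=1..n. mproj i \<omega>)
      = real k * (\<Sum>i=1..n. d i * mproj i \<omega>)"
      by (simp add: d_def left_diff_distrib sum_subtractf right_diff_distrib sum_divide_distrib sum_distrib_left)
    then have "Err \<omega> = R \<omega> + (\<Sum>t\<in>Inj - Generic. X t \<omega>) / N + real k * (\<Sum>i=1..n. d i * mproj i \<omega>)"
      using U_eq by linarith
    moreover have "\<bar>(\<Sum>t\<in>Inj - Generic. X t \<omega>) / N\<bar> \<le> A \<omega>"
      unfolding A_def using N0 by (simp add: divide_right_mono sum_abs)
    moreover have "\<bar>real k * (\<Sum>i=1..n. d i * mproj i \<omega>)\<bar> \<le> Q \<omega>"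
      unfolding Q_def abs_mult
      using sum_abs[of "\<lambda>i. d i * mproj i \<omega>" "{1..n}"] by (simp add: abs_mult mult_left_mono)
    ultimately show ?thesis by linarith
  qed
  have R_meas[measurable]: "R \<in> borel_measurable M"
    unfolding R_def using remainder_sum_measurable by (intro borel_measurable_divide) auto
  have R_int2: "integrable M (\<lambda>\<omega>. (R \<omega>)\<^sup>2)"
    unfolding R_def power_divide by (intro integrable_divide_zero remainder_sum_square) 
  have ER: "expectation (\<lambda>\<omega>. \<bar>R \<omega>\<bar>) \<le> (1 + 4 * (real k ^ 4 * (real k + 1)\<^sup>2 * K)) / 2 * (real m / real n)"
  proof (rule expectation_abs_le_square[OF R_meas R_int2])
    let ?c = "real k ^ 4 * (real k + 1)\<^sup>2 * K"
    have "expectation (\<lambda>\<omega>. (R \<omega>)\<^sup>2) = expectation (\<lambda>\<omega>. (\<Sum>t\<in>Generic. remainder t \<omega>)\<^sup>2) / N\<^sup>2"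
      by (simp add: R_def power_divide)
    also have "\<dots> \<le> (?c * (real m / real n)\<^sup>2 * (real n ^ k)\<^sup>2) / (real n ^ k / 2)\<^sup>2"
      using remainder_sum_square(2) N_half nk K0 by (intro frac_le power_mono) auto
    also have "\<dots> = 4 * ?c * (real m / real n)\<^sup>2"
      using nk by (simp add: power_divide)
    finally show "expectation (\<lambda>\<omega>. (R \<omega>)\<^sup>2) \<le> 4 * ?c * (real m / real n)\<^sup>2" .
  qed (use m0 n0 in simp)
  have A_int: "integrable M A"
    unfolding A_def using InjT
    by (intro integrable_divide_zero Bochner_Integration.integrable_sum integrable_abs X_integrable) auto
  have EA: "expectation A \<le> real k ^ 2 * (1 + K) * (real m / real n)"
  proof -
    have "expectation A = (\<Sum>t\<in>Inj - Generic. expectation (\<lambda>\<omega>. \<bar>X t \<omega>\<bar>)) / N"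
      unfolding A_def using InjT X_integrable
      by (subst integral_divide_zero, subst Bochner_Integration.integral_sum) auto
    also have "\<dots> \<le> of_nat (card (Inj - Generic)) * ((1 + K) / 2) / N"
      using InjT N0 by (intro divide_right_mono sum_bounded_above expectation_abs_le square_int second_moment) auto
    also have "\<dots> \<le> real k ^ 2 * (real m * real n ^ (k - 1)) * ((1 + K) / 2) / (real n ^ k / 2)"
      using cardInj N_half nk K0 by (intro frac_le mult_right_mono) auto
    also have "\<dots> = real k ^ 2 * (1 + K) * (real m / real n)"
      using n0 by (simp add: pow1)
    finally show ?thesis .
  qed
  have Q_int: "integrable M Q"
    unfolding Q_def
    by (intro integrable_mult_right Bochner_Integration.integrable_sum integrable_abs mproj_integrable)
  have EQ: "expectation Q \<le> real k ^ 3 * (1 + K) * (real m / real n)"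
  proof -
    have "expectation Q = real k * (\<Sum>i=1..n. \<bar>d i\<bar> * expectation (\<lambda>\<omega>. \<bar>mproj i \<omega>\<bar>))"
      unfolding Q_def using mproj_integrable
      by (subst integral_mult_right_zero, subst Bochner_Integration.integral_sum) auto
    also have "\<dots> \<le> real k * (of_nat (card {1..n}) * (2 * real k ^ 2 * real m / (real n)\<^sup>2 * ((1 + K) / 2)))"
      using d_le mproj_square K0
      by (intro mult_left_mono sum_bounded_above mult_mono expectation_abs_le mproj_measurable) auto
    also have "\<dots> = real k ^ 3 * (1 + K) * (real m / real n)"
      using n0 by (simp add: power2_eq_square power3_eq_cube)
    finally show ?thesis .
  qed
  have R_int: "integrable M R" by (rule square_integrable_imp_integrable[OF R_meas R_int2])
  have "expectation (\<lambda>\<omega>. \<bar>Err \<omega>\<bar>) \<le> expectation (\<lambda>\<omega>. \<bar>R \<omega>\<bar> + A \<omega> + Q \<omega>)"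
    by (rule integral_mono[OF integrable_abs[OF Err_integrable] _ decomp]) (use R_int A_int Q_int in auto)
  also have "\<dots> = expectation (\<lambda>\<omega>. \<bar>R \<omega>\<bar>) + expectation A + expectation Q"
    using R_int A_int Q_int by simp
  also have "\<dots> \<le> err_const * (real m / real n)"
    using ER EA EQ unfolding err_const_def distrib_right by linarith
  finally show ?thesis .
qed

lemma err_const_nonneg: "err_const \<ge> 0"
  unfolding err_const_def using K_nonneg by (intro add_nonneg_nonneg) auto

lemma U_bound:
  assumes large: "n \<ge> 2 * k\<^sup>2"
  shows "expectation (\<lambda>\<omega>. \<bar>U \<omega>\<bar>) \<le> (err_const + (1 + real k ^ 2 * K) / 2) * sqrt (real m / real n)"
proof -
  let ?s = "sqrt (real m / real n)"
  define L where "L \<omega> = real k / real n * (\<Sum>i=1..n. mproj i \<omega>)" for \<omega>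
  have n0: "real n > 0" using n by simp
  have s: "?s > 0" "?s\<^sup>2 = real m / real n" using m_bounds n by auto
  have mn: "real m / real n \<le> 1" using m_bounds n by simp
  have L_meas[measurable]: "L \<in> borel_measurable M" unfolding L_def by measurable
  have L_sq: "(\<lambda>\<omega>. (L \<omega>)\<^sup>2) = (\<lambda>\<omega>. (real k / real n)\<^sup>2 * (\<Sum>g\<in>P. cluster_sum g \<omega>)\<^sup>2)"
    by (simp add: L_def sum_mproj[unfolded One_nat_def] power_mult_distrib power_divide)
  have L2: "integrable M (\<lambda>\<omega>. (L \<omega>)\<^sup>2)" unfolding L_sq by (intro integrable_mult_right sum_cluster_sum_square)
  have "expectation (\<lambda>\<omega>. (L \<omega>)\<^sup>2) \<le> (real k / real n)\<^sup>2 * (K * real m * real n)"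
    unfolding L_sq integral_mult_right_zero by (intro mult_left_mono sum_cluster_sum_square) auto
  also have "\<dots> = real k ^ 2 * K * ?s\<^sup>2" using n0 by (simp add: s power2_eq_square)
  finally have EL: "expectation (\<lambda>\<omega>. \<bar>L \<omega>\<bar>) \<le> (1 + real k ^ 2 * K) / 2 * ?s"
    by (intro expectation_abs_le_square L_meas L2 s)
  \<comment> \<open>\<open>m <= n\<close> lets the rate \<open>m / n\<close> of the error be
    absorbed into the slower \<open>sqrt (m / n)\<close> of the linear part.\<close>
  have "real m / real n = ?s * ?s" using m_bounds by simp
  also have "\<dots> \<le> 1 * ?s" using mn s by (intro mult_right_mono) auto
  finally have "err_const * (real m / real n) \<le> err_const * ?s"
    using err_const_nonneg by (intro mult_left_mono) auto
  then have EE: "expectation (\<lambda>\<omega>. \<bar>Err \<omega>\<bar>) \<le> err_const * ?s" using Err_bound[OF large] by simp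
  have L1: "integrable M L" by (rule square_integrable_imp_integrable[OF L_meas L2])
  have "expectation (\<lambda>\<omega>. \<bar>U \<omega>\<bar>) \<le> expectation (\<lambda>\<omega>. \<bar>Err \<omega>\<bar> + \<bar>L \<omega>\<bar>)"
  proof (rule integral_mono)
    show "\<bar>U \<omega>\<bar> \<le> \<bar>Err \<omega>\<bar> + \<bar>L \<omega>\<bar>" for \<omega>
      using abs_triangle_ineq[of "Err \<omega>" "L \<omega>"] unfolding L_def diff_add_cancel .
  qed (use U_integrable Err_integrable L1 in auto)
  also have "\<dots> = expectation (\<lambda>\<omega>. \<bar>Err \<omega>\<bar>) + expectation (\<lambda>\<omega>. \<bar>L \<omega>\<bar>)"
    using integrable_abs[OF Err_integrable] integrable_abs[OF L1] by (rule Bochner_Integration.integral_add)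
  finally show ?thesis using EE EL unfolding distrib_right by linarith
qed

section \<open>Normalized cluster sums and Lindeberg's condition\<close>

definition normalized_sum :: "nat set \<Rightarrow> 'a \<Rightarrow> real" where
  "normalized_sum g \<omega> = real k / (sqrt (real n) * \<sigma>) * cluster_sum g \<omega>"

lemma normalized_sum_indep: "indep_vars (\<lambda>_. borel) normalized_sum P"
  unfolding normalized_sum_def by (rule indep_vars_compose2[OF cluster_sum_indep]) simp

lemma normalized_sum_square_integrable: "g \<in> P \<Longrightarrow> integrable M (\<lambda>\<omega>. (normalized_sum g \<omega>)\<^sup>2)"
  unfolding normalized_sum_def power_mult_distrib by (intro integrable_mult_right cluster_sum_square)

lemma normalized_sum_measurable[measurable]: "normalized_sum g \<in> borel_measurable M"
  unfolding normalized_sum_def by measurable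

lemma normalized_sum_expectation: "g \<in> P \<Longrightarrow> expectation (normalized_sum g) = 0"
  unfolding normalized_sum_def integral_mult_right_zero by (simp add: cluster_sum_expectation)

text \<open>The square of \<open>sigma_U\<close> is \<open>k^2 / n\<close> times the total variance
  of the cluster sums, exactly what the factor in \<open>normalized_sum\<close> divides out.\<close>

lemma sum_normalized_sum_square:
  assumes "\<sigma> > 0" shows "(\<Sum>g\<in>P. expectation (\<lambda>\<omega>. (normalized_sum g \<omega>)\<^sup>2)) = 1"
proof -
  have n0: "real n > 0" using n by simp
  define V where "V = (\<Sum>g\<in>P. expectation (\<lambda>\<omega>. (cluster_sum g \<omega>)\<^sup>2))"
  have s: "\<sigma> = sqrt ((real k)\<^sup>2 / real n * V)"
    by (simp add: sigma_U_def V_def cluster_sum_def)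
  have "V \<ge> 0" unfolding V_def by (intro sum_nonneg) auto
  then have s2: "\<sigma>\<^sup>2 = (real k)\<^sup>2 / real n * V" unfolding s by simp
  have "(\<Sum>g\<in>P. expectation (\<lambda>\<omega>. (normalized_sum g \<omega>)\<^sup>2)) = (real k)\<^sup>2 / (real n * \<sigma>\<^sup>2) * V"
    unfolding V_def sum_distrib_left
    by (intro sum.cong refl) (simp add: normalized_sum_def power_mult_distrib power_divide)
  also have "\<dots> = ((real k)\<^sup>2 / real n * V) / \<sigma>\<^sup>2" by simp
  also have "\<dots> = 1" using assms unfolding s2[symmetric] by simp
  finally show ?thesis .
qed

lemma U_eq_normalized_sum:
  "sqrt (real n) * U \<omega> / \<sigma> = (\<Sum>g\<in>P. normalized_sum g \<omega>) + sqrt (real n) / \<sigma> * Err \<omega>"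
proof -
  have "(\<Sum>g\<in>P. normalized_sum g \<omega>) = real k / (sqrt (real n) * \<sigma>) * (\<Sum>i=1..n. mproj i \<omega>)"
    by (simp add: normalized_sum_def sum_mproj[unfolded One_nat_def] sum_distrib_left)
  also have "real k / (sqrt (real n) * \<sigma>) = sqrt (real n) / \<sigma> * (real k / (sqrt (real n) * sqrt (real n)))"
    using n by (simp del: real_sqrt_mult_self)
  also have "sqrt (real n) * sqrt (real n) = real n" by simp
  finally show ?thesis by (simp add: algebra_simps)
qed

text \<open>Where the normalized sum exceeds \<open>e\<close>, the premise \<open>large\<close>
  forces the cluster average beyond \<open>2 B\<close>, so it is at most twice its excess over
  \<open>B\<close>; this is the 2 in \<open>2 * k / l\<close>. As \<open>r >= 2\<close>, the square
  is there at most \<open>e powr (2 - r)\<close> times the \<open>r\<close>-th power, and Jensen's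
  inequality bounds the excess moment by \<kappa>.\<close>

lemma lindeberg_bound:
  assumes l: "l > 0" "\<sigma> \<ge> l" and e: "e > 0" and r: "r \<ge> 2" and B: "B \<ge> 0"
    and large: "2 * B * real k * real m \<le> e * l * sqrt (real n)"
    and int: "\<And>t. t \<in> Tup \<Longrightarrow> integrable M (\<lambda>\<omega>. (max 0 (\<bar>X t \<omega>\<bar> - B)) powr r)"
    and le: "\<And>t. t \<in> Tup \<Longrightarrow> expectation (\<lambda>\<omega>. (max 0 (\<bar>X t \<omega>\<bar> - B)) powr r) \<le> \<kappa>" and \<kappa>: "\<kappa> \<ge> 0"
  shows "(\<Sum>g\<in>P. expectation (\<lambda>\<omega>. (normalized_sum g \<omega>)\<^sup>2 * indicator {\<omega>. \<bar>normalized_sum g \<omega>\<bar> > e} \<omega>))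
    \<le> e powr (2 - r) * (2 * real k / l) powr r * ((\<Sum>g\<in>P. real (card g) powr r) / sqrt (real n) powr r) * \<kappa>"
proof -
  let ?F = "\<lambda>x::real. (max 0 (\<bar>x\<bar> - B)) powr r"
  let ?c = "\<lambda>g. e powr (2 - r) * (2 * real k / l) powr r * (real (card g) / sqrt (real n)) powr r"
  have n0: "real n > 0" using n by simp
  have bound: "expectation (\<lambda>\<omega>. (normalized_sum g \<omega>)\<^sup>2 * indicator {\<omega>. \<bar>normalized_sum g \<omega>\<bar> > e} \<omega>) \<le> ?c g * \<kappa>" if g: "g \<in> P" for g
  proof -
    have c0: "real (card g) > 0"
      using partition g finite_cluster[OF g] by (auto simp: partition_on_def card_gt_0_iff)
    have kc: "real k * real (card g) > 0" using k c0 by simp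
    have F: "integrable M (\<lambda>\<omega>. ?F (cluster_sum g \<omega> / real (card g)))" "expectation (\<lambda>\<omega>. ?F (cluster_sum g \<omega> / real (card g))) \<le> \<kappa>"
      by (rule cluster_sum_convex[OF g _ _ _ _ int le \<kappa>]; use r B convex_excess_powr in simp)+
    have pt: "(normalized_sum g \<omega>)\<^sup>2 * indicator {\<omega>. \<bar>normalized_sum g \<omega>\<bar> > e} \<omega> \<le> ?c g * ?F (cluster_sum g \<omega> / real (card g))" for \<omega>
    proof (cases "\<bar>normalized_sum g \<omega>\<bar> > e")
      case True
      let ?\<tau> = "\<bar>cluster_sum g \<omega> / real (card g)\<bar>"
      have sn: "sqrt (real n) > 0" using n0 by simp
      have ss: "sqrt (real n) * l \<le> sqrt (real n) * \<sigma>" using l sn by simp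
      have sl: "sqrt (real n) * l > 0" using l sn by simp
      have Yeq: "\<bar>normalized_sum g \<omega>\<bar> = real k * real (card g) * ?\<tau> / (sqrt (real n) * \<sigma>)"
        using c0 l by (simp add: normalized_sum_def abs_mult)
      also have "\<dots> \<le> real k * real (card g) * ?\<tau> / (sqrt (real n) * l)"
        using kc by (intro divide_left_mono ss mult_pos_pos[OF less_le_trans[OF sl ss] sl]) auto
      finally have Yle: "\<bar>normalized_sum g \<omega>\<bar> \<le> real k * real (card g) * ?\<tau> / (sqrt (real n) * l)" .
      have "real (card g) \<le> real m" using card_cluster_le[OF g] by simp
      then have "real k * real (card g) * (2 * B) \<le> 2 * B * real k * real m"
        using B by (simp add: mult_left_mono)
      also have "\<dots> \<le> e * (sqrt (real n) * l)" using large by (simp add: mult_ac)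
      also have "\<dots> < \<bar>normalized_sum g \<omega>\<bar> * (sqrt (real n) * l)" using True sl by (rule mult_strict_right_mono)
      also have "\<dots> \<le> real k * real (card g) * ?\<tau>" using Yle sl by (simp add: pos_le_divide_eq)
      finally have "2 * B < ?\<tau>" unfolding mult_less_cancel_left_pos[OF kc] .
      moreover have "x \<le> 2 * max 0 (x - B)" if "2 * B < x" for x
        using that by (simp add: max_def)
      ultimately have \<tau>: "?\<tau> \<le> 2 * max 0 (?\<tau> - B)" by blast
      have "real k * real (card g) * ?\<tau> / (sqrt (real n) * l)
          \<le> real k * real (card g) * (2 * max 0 (?\<tau> - B)) / (sqrt (real n) * l)"
        using \<tau> kc sl by (intro divide_right_mono mult_left_mono) auto
      also have "\<dots> = (2 * real k / l) * (real (card g) / sqrt (real n)) * max 0 (?\<tau> - B)"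
        by (simp add: mult_ac)
      finally have Y1: "\<bar>normalized_sum g \<omega>\<bar> \<le> (2 * real k / l) * (real (card g) / sqrt (real n)) * max 0 (?\<tau> - B)"
        using Yle by simp
      have Y0: "\<bar>normalized_sum g \<omega>\<bar> > 0" using True e by simp
      have "(normalized_sum g \<omega>)\<^sup>2 = \<bar>normalized_sum g \<omega>\<bar> powr 2" using Y0 by simp
      also have "\<dots> = \<bar>normalized_sum g \<omega>\<bar> powr (2 - r) * \<bar>normalized_sum g \<omega>\<bar> powr r" by (simp flip: powr_add)
      \<comment> \<open>The exponent \<open>2 - r\<close> is at most 0, so that power is
        nonincreasing and is estimated at \<open>e\<close>.\<close>
      also have "\<dots> \<le> e powr (2 - r) * ((2 * real k / l) * (real (card g) / sqrt (real n)) * max 0 (?\<tau> - B)) powr r"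
        using True e r Y0 Y1 by (intro mult_mono powr_mono2 powr_mono2') auto
      also have "\<dots> = ?c g * ?F (cluster_sum g \<omega> / real (card g))"
      proof -
        have "(u * v * w) powr r = u powr r * v powr r * w powr r" if "u \<ge> 0" "v \<ge> 0" "w \<ge> 0" for u v w
          using that by (simp add: powr_mult)
        from this[of "2 * real k / l" "real (card g) / sqrt (real n)" "max 0 (?\<tau> - B)"] show ?thesis
          using l by (simp only: mult.assoc) simp
      qed
      finally show ?thesis using True by simp
    qed simp
    have "expectation (\<lambda>\<omega>. (normalized_sum g \<omega>)\<^sup>2 * indicator {\<omega>. \<bar>normalized_sum g \<omega>\<bar> > e} \<omega>)
        \<le> expectation (\<lambda>\<omega>. ?c g * ?F (cluster_sum g \<omega> / real (card g)))"
    proof (rule integral_mono[OF _ _ pt])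
      show "integrable M (\<lambda>\<omega>. ?c g * ?F (cluster_sum g \<omega> / real (card g)))"
        using F(1) by (rule integrable_mult_right)
      show "integrable M (\<lambda>\<omega>. (normalized_sum g \<omega>)\<^sup>2 * indicator {\<omega>. \<bar>normalized_sum g \<omega>\<bar> > e} \<omega>)"
        by (rule Bochner_Integration.integrable_bound[OF normalized_sum_square_integrable[OF g]])
          (auto split: split_indicator)
    qed
    also have "\<dots> \<le> ?c g * \<kappa>"
      unfolding integral_mult_right_zero using F(2) by (intro mult_left_mono) auto
    finally show ?thesis .
  qed
  have "(\<Sum>g\<in>P. expectation (\<lambda>\<omega>. (normalized_sum g \<omega>)\<^sup>2 * indicator {\<omega>. \<bar>normalized_sum g \<omega>\<bar> > e} \<omega>)) \<le> (\<Sum>g\<in>P. ?c g * \<kappa>)"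
    by (rule sum_mono[OF bound])
  also have "\<dots> = e powr (2 - r) * (2 * real k / l) powr r * ((\<Sum>g\<in>P. real (card g) powr r) / sqrt (real n) powr r) * \<kappa>"
    by (simp add: powr_divide sum_distrib_left sum_distrib_right sum_divide_distrib)
  finally show ?thesis .
qed

end

section \<open>Asymptotics\<close>

lemma excess_powr_le:
  fixes x r B :: real
  assumes "B \<ge> 0" "r \<ge> 0"
  shows "(max 0 (\<bar>x\<bar> - B)) powr r \<le> \<bar>x\<bar> powr r * indicator {x. \<bar>x\<bar> > B} x"
  using assms by (auto simp: max_def split: split_indicator intro!: powr_mono2)

text \<open>The 1 covers \<open>|x| <= 1\<close>, where \<open>x^2\<close> may exceed
  \<open>|x| powr r\<close>.\<close>

lemma square_le_tail_powr:
  fixes x r B :: real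
  assumes "r \<ge> 2"
  shows "x\<^sup>2 \<le> B\<^sup>2 + 1 + \<bar>x\<bar> powr r * indicator {x. \<bar>x\<bar> > B} x"
proof (cases "\<bar>x\<bar> > B \<and> \<bar>x\<bar> > 1")
  case True
  then have "x\<^sup>2 = \<bar>x\<bar> powr 2" by simp
  also have "\<dots> \<le> \<bar>x\<bar> powr r" using True assms by (intro powr_mono) auto
  finally show ?thesis using True by (simp add: add_increasing)
next
  case False
  have "x\<^sup>2 \<le> B\<^sup>2 + 1"
  proof (cases "\<bar>x\<bar> > 1")
    case True
    then have "\<bar>x\<bar>\<^sup>2 \<le> B\<^sup>2" using False by (intro power_mono) auto
    then show ?thesis by simp
  next
    case False
    then have "\<bar>x\<bar>\<^sup>2 \<le> 1\<^sup>2" by (intro power_mono) auto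
    then have "x\<^sup>2 \<le> 1" by simp
    then show ?thesis using zero_le_power2[of B] by linarith
  qed
  then show ?thesis by (simp add: add_increasing2)
qed

theorem theorem1:
  fixes M :: "nat \<Rightarrow> 'a measure"
    and S :: "'w measure"
    and W :: "nat \<Rightarrow> nat \<Rightarrow> 'a \<Rightarrow> 'w"
    and P :: "nat \<Rightarrow> nat set set"
    and \<phi> :: "(nat \<Rightarrow> 'w) \<Rightarrow> real"
    and k :: nat
    and r C :: real
  assumes k: "k \<ge> 2"
    and r: "r \<ge> 2"
    and prob: "\<And>n. n \<ge> 1 \<Longrightarrow> prob_space (M n)"
    and S: "standard_borel_space S"
    and partition: "\<And>n. n \<ge> 1 \<Longrightarrow> partition_on {1..n} (P n)"
    and W: "\<And>n i. n \<ge> 1 \<Longrightarrow> i \<in> {1..n} \<Longrightarrow> W n i \<in> measurable (M n) S"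
    and indep: "\<And>n. n \<ge> 1 \<Longrightarrow>
      prob_space.indep_vars (M n) (\<lambda>g. PiM g (\<lambda>_. S)) (\<lambda>g \<omega>. \<lambda>i\<in>g. W n i \<omega>) (P n)"
    and kernel_measurable: "\<phi> \<in> borel_measurable (PiM {1..k} (\<lambda>_. S))"
    and kernel_symmetric: "symmetric_kernel S k \<phi>"
    and kernel_centred: "\<And>n t. n \<ge> 1 \<Longrightarrow> t \<in> {1..k} \<rightarrow>\<^sub>E {1..n} \<Longrightarrow> cluster_generic (P n) k t \<Longrightarrow>
      (\<integral>\<omega>. kernel_at \<phi> k (W n) t \<omega> \<partial>M n) = 0"
    and size_bound: "\<And>n. n \<ge> 1 \<Longrightarrow>
      (\<Sum>g\<in>P n. real (card g) powr r) powr (2 / r) / real n \<le> C"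
    and size_limit: "(\<lambda>n. Max ((\<lambda>g. (real (card g))\<^sup>2 / real n) ` P n)) \<longlonglongrightarrow> 0"
    and uniform_integrability:
      "((\<lambda>B::real. SUP n\<in>{1..}. SUP t \<in> {1..k} \<rightarrow>\<^sub>E {1..n}.
          \<integral>\<^sup>+\<omega>. ennreal (\<bar>kernel_at \<phi> k (W n) t \<omega>\<bar> powr r *
                 indicator {\<omega>. \<bar>kernel_at \<phi> k (W n) t \<omega>\<bar> > B} \<omega>) \<partial>M n)
        \<longlongrightarrow> 0) at_top"
  shows
    "big_Op M
       (\<lambda>n \<omega>. U_stat \<phi> k n (W n) \<omega> -
          real k / real n * (\<Sum>i=1..n. mean_projection (M n) S (P n) \<phi> k n (W n) i \<omega>))
       (\<lambda>n. real (max_cluster_size (P n)) / real n)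
     \<and> (big_Op M (\<lambda>n. U_stat \<phi> k n (W n)) (\<lambda>n. sqrt (real (max_cluster_size (P n)) / real n))
        \<and> small_op M (\<lambda>n. U_stat \<phi> k n (W n)) (\<lambda>_. 1))
     \<and> (\<forall>l>0. (\<forall>\<^sub>F n in sequentially. sigma_U (M n) S (P n) \<phi> k n (W n) \<ge> l) \<longrightarrow>
         weak_conv_m
           (\<lambda>n. distr (M n) borel
              (\<lambda>\<omega>. sqrt (real n) * U_stat \<phi> k n (W n) \<omega> / sigma_U (M n) S (P n) \<phi> k n (W n)))
           std_normal_distribution)"
proof -
  define tail where "tail B n t = (\<integral>\<^sup>+\<omega>. ennreal (\<bar>kernel_at \<phi> k (W n) t \<omega>\<bar> powr r *
      indicator {\<omega>. \<bar>kernel_at \<phi> k (W n) t \<omega>\<bar> > B} \<omega>) \<partial>M n)" for B n t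
  \<comment> \<open>Convergence of the double supremum supplies one threshold \<open>B\<close> valid
    for all \<open>n\<close> and \<open>t\<close> at once.\<close>
  have tail_small: "\<exists>B\<ge>0. \<forall>n\<ge>1. \<forall>t\<in>{1..k} \<rightarrow>\<^sub>E {1..n}. tail B n t \<le> ennreal e" if e: "e > 0" for e
  proof -
    have "\<forall>\<^sub>F B in at_top. (SUP n\<in>{1..}. SUP t\<in>{1..k} \<rightarrow>\<^sub>E {1..n}. tail B n t) < ennreal e"
      using uniform_integrability e unfolding tail_def by (intro order_tendstoD(2)) auto
    moreover have "\<forall>\<^sub>F B::real in at_top. B \<ge> 0" by (rule eventually_ge_at_top)
    ultimately have "\<forall>\<^sub>F B in at_top.
        (SUP n\<in>{1..}. SUP t\<in>{1..k} \<rightarrow>\<^sub>E {1..n}. tail B n t) < ennreal e \<and> B \<ge> 0"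
      by (rule eventually_conj)
    from eventually_happens'[OF trivial_limit_at_top_linorder this]
    obtain B where B: "B \<ge> 0"
      "(SUP n\<in>{1..}. SUP t\<in>{1..k} \<rightarrow>\<^sub>E {1..n}. tail B n t) < ennreal e"
      by blast
    have "tail B n t \<le> ennreal e" if "n \<ge> 1" "t \<in> {1..k} \<rightarrow>\<^sub>E {1..n}" for n t
    proof -
      have "tail B n t \<le> (SUP t\<in>{1..k} \<rightarrow>\<^sub>E {1..n}. tail B n t)" using that by (intro SUP_upper)
      also have "\<dots> \<le> (SUP n\<in>{1..}. SUP t\<in>{1..k} \<rightarrow>\<^sub>E {1..n}. tail B n t)"
        using that by (intro SUP_upper[where f = "\<lambda>n. SUP t\<in>{1..k} \<rightarrow>\<^sub>E {1..n}. tail B n t"]) simp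
      finally show ?thesis using B by simp
    qed
    with B show ?thesis by blast
  qed
  have kernel_meas: "kernel_at \<phi> k (W n) t \<in> borel_measurable (M n)"
    if "n \<ge> 1" "t \<in> {1..k} \<rightarrow>\<^sub>E {1..n}" for n t
    unfolding kernel_at_def
  proof (rule measurable_compose[OF _ kernel_measurable], rule measurable_restrict)
    show "W n (t j) \<in> measurable (M n) S" if "j \<in> {1..k}" for j
      using \<open>n \<ge> 1\<close> PiE_mem[OF \<open>t \<in> _\<close> that] by (rule W)
  qed
  obtain B0 where B0: "B0 \<ge> 0" "\<And>n t. n \<ge> 1 \<Longrightarrow> t \<in> {1..k} \<rightarrow>\<^sub>E {1..n} \<Longrightarrow> tail B0 n t \<le> ennreal 1"
    using tail_small[of 1] by auto
  \<comment> \<open>\<open>B0^2 + 1\<close> comes from \<open>square_le_tail_powr\<close>, the last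
    1 from the tail beyond \<open>B0\<close>.\<close>
  define K where "K = B0\<^sup>2 + 2"
  have clustered: "clustered_kernel (M n) S (W n) (P n) n k \<phi> K" if n: "n \<ge> 1" for n
  proof -
    interpret prob_space "M n" by (rule prob[OF n])
    have sq: "integrable (M n) (\<lambda>\<omega>. (kernel_at \<phi> k (W n) t \<omega>)\<^sup>2)"
      "expectation (\<lambda>\<omega>. (kernel_at \<phi> k (W n) t \<omega>)\<^sup>2) \<le> K" if t: "t \<in> {1..k} \<rightarrow>\<^sub>E {1..n}" for t
    proof -
      let ?X = "kernel_at \<phi> k (W n) t"
      have [measurable]: "?X \<in> borel_measurable (M n)" by (rule kernel_meas[OF n t])
      have "(\<integral>\<^sup>+\<omega>. ennreal ((?X \<omega>)\<^sup>2) \<partial>M n)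
          \<le> (\<integral>\<^sup>+\<omega>. ennreal (B0\<^sup>2 + 1) + ennreal (\<bar>?X \<omega>\<bar> powr r * indicator {\<omega>. \<bar>?X \<omega>\<bar> > B0} \<omega>) \<partial>M n)"
      proof (rule nn_integral_mono)
        fix \<omega>
        have "(?X \<omega>)\<^sup>2 \<le> (B0\<^sup>2 + 1) + \<bar>?X \<omega>\<bar> powr r * indicator {\<omega>. \<bar>?X \<omega>\<bar> > B0} \<omega>"
          using square_le_tail_powr[OF r, of "?X \<omega>" B0] by (simp add: indicator_def)
        then show "ennreal ((?X \<omega>)\<^sup>2)
            \<le> ennreal (B0\<^sup>2 + 1) + ennreal (\<bar>?X \<omega>\<bar> powr r * indicator {\<omega>. \<bar>?X \<omega>\<bar> > B0} \<omega>)"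
          using ennreal_leI by (subst ennreal_plus[symmetric]) (simp_all only: zero_le_power2 add_nonneg_nonneg
            zero_le_one mult_nonneg_nonneg powr_ge_zero indicator_pos_le)
      qed
      also have "\<dots> = ennreal (B0\<^sup>2 + 1) + tail B0 n t"
        unfolding tail_def by (subst nn_integral_add) (auto simp: emeasure_space_1)
      also have "\<dots> \<le> ennreal (B0\<^sup>2 + 1) + ennreal 1"
        using B0(2)[OF n t] by (intro add_left_mono)
      also have "\<dots> = ennreal K" unfolding K_def by (subst ennreal_plus[symmetric]) auto
      finally have le: "(\<integral>\<^sup>+\<omega>. ennreal ((?X \<omega>)\<^sup>2) \<partial>M n) \<le> ennreal K" .
      show "integrable (M n) (\<lambda>\<omega>. (?X \<omega>)\<^sup>2)" "expectation (\<lambda>\<omega>. (?X \<omega>)\<^sup>2) \<le> K"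
        by (rule integral_le_of_nn_integral[OF _ _ le]; simp add: K_def)+
    qed
    show ?thesis
      by (rule clustered_kernel.intro[OF prob[OF n]], rule clustered_kernel_axioms.intro)
        (fact k n partition[OF n] W[OF n] indep[OF n] kernel_measurable kernel_symmetric
          kernel_centred[OF n] sq)+
  qed
  define m where "m n = max_cluster_size (P n)" for n
  have m_bounds: "1 \<le> m n" "m n \<le> n" if "n \<ge> 1" for n
    using clustered_kernel.m_bounds[OF clustered[OF that]] by (auto simp: m_def)
  have m_sq: "(real (m n))\<^sup>2 / real n \<le> Max ((\<lambda>g. (real (card g))\<^sup>2 / real n) ` P n)" if n: "n \<ge> 1" for n
  proof -
    interpret clustered_kernel "M n" S "W n" "P n" n k \<phi> K by (rule clustered[OF n])
    have "1 \<in> {1..n}" using n by simp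
    then have "card ` P n \<noteq> {}" using cl_in by blast
    then have "m n \<in> card ` P n"
      unfolding m_def max_cluster_size_def using finite_P by (intro Max_in) auto
    then obtain g where "g \<in> P n" "m n = card g" by blast
    then show ?thesis using finite_P by (intro Max_ge) auto
  qed
  \<comment> \<open>This is the error rate of (a) times \<open>sqrt n\<close>; its vanishing also
    supplies the premise \<open>large\<close> of \<open>lindeberg_bound\<close>.\<close>
  have lim1: "(\<lambda>n. real (m n) / sqrt (real n)) \<longlonglongrightarrow> 0"
  proof (rule tendsto_sandwich[where f = "\<lambda>_. 0"])
    show "(\<lambda>n. sqrt (Max ((\<lambda>g. (real (card g))\<^sup>2 / real n) ` P n))) \<longlonglongrightarrow> 0"
      using tendsto_real_sqrt[OF size_limit] by simp
    show "\<forall>\<^sub>F n in sequentially. real (m n) / sqrt (real n) \<le> sqrt (Max ((\<lambda>g. (real (card g))\<^sup>2 / real n) ` P n))"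
      using eventually_ge_at_top[of 1]
    proof eventually_elim
      case (elim n)
      have "real (m n) / sqrt (real n) = sqrt ((real (m n))\<^sup>2 / real n)" by (simp add: real_sqrt_divide)
      then show ?case using m_sq[OF elim] by simp
    qed
  qed auto
  have lim2: "(\<lambda>n. sqrt (real (m n) / real n)) \<longlonglongrightarrow> 0"
  proof (rule tendsto_sandwich[where f = "\<lambda>_. 0"])
    show "\<forall>\<^sub>F n in sequentially. sqrt (real (m n) / real n) \<le> real (m n) / sqrt (real n)"
      using eventually_ge_at_top[of 1]
    proof eventually_elim
      case (elim n)
      \<comment> \<open>\<open>m >= 1\<close> gives \<open>m <= m^2\<close>, so this limit follows
        from the previous one.\<close>
      have "sqrt (real (m n)) \<le> sqrt ((real (m n))\<^sup>2)"
        using m_bounds[OF elim] self_le_power[of "real (m n)" 2] by (intro real_sqrt_le_mono) auto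
      then show ?case by (simp add: real_sqrt_divide divide_right_mono)
    qed
  qed (use lim1 in auto)
  have large: "\<forall>\<^sub>F n in sequentially. n \<ge> 1 \<and> n \<ge> 2 * k\<^sup>2"
    by (intro eventually_conj eventually_ge_at_top)
  define c0 where "c0 = clustered_kernel.err_const k K"
  define c1 where "c1 = c0 + (1 + real k ^ 2 * K) / 2"
  define Err where "Err n \<omega> = U_stat \<phi> k n (W n) \<omega> -
      real k / real n * (\<Sum>i=1..n. mean_projection (M n) S (P n) \<phi> k n (W n) i \<omega>)" for n \<omega>
  have Err: "integrable (M n) (Err n)" if "n \<ge> 1" for n
    using clustered_kernel.Err_integrable[OF clustered[OF that]] by (simp add: Err_def[abs_def])
  have Err_le: "(\<integral>\<omega>. \<bar>Err n \<omega>\<bar> \<partial>M n) \<le> c0 * (real (m n) / real n)" if "n \<ge> 1 \<and> n \<ge> 2 * k\<^sup>2" for n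
    using clustered_kernel.Err_bound[OF clustered] that by (simp add: Err_def c0_def m_def)
  have a: "big_Op M Err (\<lambda>n. real (m n) / real n)"
  proof (rule big_Op_of_expectation[where c = c0])
    show "\<forall>\<^sub>F n in sequentially. prob_space (M n) \<and> integrable (M n) (Err n)
      \<and> real (m n) / real n > 0 \<and> (\<integral>\<omega>. \<bar>Err n \<omega>\<bar> \<partial>M n) \<le> c0 * (real (m n) / real n)"
      using large
    proof eventually_elim
      case (elim n)
      then show ?case using prob[of n] Err[of n] Err_le[of n] m_bounds(1)[of n] by simp
    qed
  qed
  have U_le: "integrable (M n) (U_stat \<phi> k n (W n))"
    "(\<integral>\<omega>. \<bar>U_stat \<phi> k n (W n) \<omega>\<bar> \<partial>M n) \<le> c1 * sqrt (real (m n) / real n)" if "n \<ge> 1 \<and> n \<ge> 2 * k\<^sup>2" for n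
    using clustered_kernel.U_bound[OF clustered] clustered_kernel.U_integrable[OF clustered] that
    by (simp_all add: c1_def c0_def m_def)
  have b1: "big_Op M (\<lambda>n. U_stat \<phi> k n (W n)) (\<lambda>n. sqrt (real (m n) / real n))"
  proof (rule big_Op_of_expectation[where c = c1])
    show "\<forall>\<^sub>F n in sequentially. prob_space (M n) \<and> integrable (M n) (U_stat \<phi> k n (W n))
      \<and> sqrt (real (m n) / real n) > 0
      \<and> (\<integral>\<omega>. \<bar>U_stat \<phi> k n (W n) \<omega>\<bar> \<partial>M n) \<le> c1 * sqrt (real (m n) / real n)"
      using large
    proof eventually_elim
      case (elim n)
      then show ?case using prob[of n] U_le[of n] m_bounds(1)[of n] by simp
    qed
  qed
  have b2: "small_op M (\<lambda>n. U_stat \<phi> k n (W n)) (\<lambda>_. 1)"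
  proof (rule small_op_of_expectation)
    show "\<forall>\<^sub>F n in sequentially. prob_space (M n) \<and> integrable (M n) (U_stat \<phi> k n (W n))
      \<and> (\<integral>\<omega>. \<bar>U_stat \<phi> k n (W n) \<omega>\<bar> \<partial>M n) \<le> c1 * sqrt (real (m n) / real n)"
      using large
    proof eventually_elim
      case (elim n)
      then show ?case using prob[of n] U_le[of n] by simp
    qed
    show "(\<lambda>n. c1 * sqrt (real (m n) / real n)) \<longlonglongrightarrow> 0"
      using tendsto_mult_left[OF lim2, of c1] by simp
  qed
  have c: "weak_conv_m
      (\<lambda>n. distr (M n) borel (\<lambda>\<omega>. sqrt (real n) * U_stat \<phi> k n (W n) \<omega> / sigma_U (M n) S (P n) \<phi> k n (W n)))
      std_normal_distribution"
    if l: "l > 0" and ev: "\<forall>\<^sub>F n in sequentially. sigma_U (M n) S (P n) \<phi> k n (W n) \<ge> l" for l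
  proof -
    define \<sigma> where "\<sigma> n = sigma_U (M n) S (P n) \<phi> k n (W n)" for n
    define Yn where "Yn n = clustered_kernel.normalized_sum (M n) S (W n) (P n) n k \<phi>" for n
    define Z where "Z n \<omega> = sqrt (real n) * U_stat \<phi> k n (W n) \<omega> / \<sigma> n" for n \<omega>
    obtain N0 where N0: "\<And>n. n \<ge> N0 \<Longrightarrow> \<sigma> n \<ge> l"
      using ev unfolding eventually_sequentially \<sigma>_def by blast
    \<comment> \<open>Shifting the sequence by \<open>N\<close> turns eventual properties into ones
      valid at every index, since \<open>lindeberg_char\<close> asks for total variance exactly 1 in
      every row; the weak limit is unaffected.\<close>
    define N where "N = max N0 (2 * k\<^sup>2 + 1)"
    have N: "j + N \<ge> 1 \<and> j + N \<ge> 2 * k\<^sup>2" "j + N \<ge> 1" "\<sigma> (j + N) \<ge> l" "\<sigma> (j + N) > 0" for j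
    proof -
      show "\<sigma> (j + N) \<ge> l" by (rule N0) (simp add: N_def)
      with l show "\<sigma> (j + N) > 0" by simp
    qed (auto simp: N_def)
    have C0: "C \<ge> 0" using order_trans[OF _ size_bound[of 1]] by simp
    have lindeberg: "(\<lambda>j. \<Sum>g\<in>P (j + N). \<integral>\<omega>. (Yn (j + N) g \<omega>)\<^sup>2 *
        indicator {\<omega>. \<bar>Yn (j + N) g \<omega>\<bar> > e} \<omega> \<partial>M (j + N)) \<longlonglongrightarrow> 0" if e: "e > 0" for e
    proof (rule tendsto_0_if_eventually_le)
      fix d :: real assume d: "d > 0"
      \<comment> \<open>\<open>A\<close> collects the factors of \<open>lindeberg_bound\<close>
        after the size ratio has been bounded by \<open>C powr (r / 2)\<close>. The choices are
        \<kappa> from \<open>A\<close> and \<open>d\<close>, then \<open>B\<close> from \<kappa>,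
        then \<open>j\<close> large for that \<open>B\<close>; \<open>A + 1\<close> covers
        \<open>A = 0\<close>.\<close>
      define A where "A = e powr (2 - r) * (2 * real k / l) powr r * C powr (r / 2)"
      have A0: "A \<ge> 0" by (simp add: A_def)
      define \<kappa> where "\<kappa> = d / (A + 1)"
      have \<kappa>: "\<kappa> > 0" "A * \<kappa> \<le> d" using d A0 by (auto simp: \<kappa>_def field_simps)
      obtain B where B: "B \<ge> 0" "\<And>n t. n \<ge> 1 \<Longrightarrow> t \<in> {1..k} \<rightarrow>\<^sub>E {1..n} \<Longrightarrow> tail B n t \<le> ennreal \<kappa>"
        using tail_small[OF \<kappa>(1)] by blast
      have "(\<lambda>j. 2 * B * real k * (real (m (j + N)) / sqrt (real (j + N)))) \<longlonglongrightarrow> 2 * B * real k * 0"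
        by (intro tendsto_mult_left LIMSEQ_ignore_initial_segment[OF lim1])
      then have "\<forall>\<^sub>F j in sequentially. 2 * B * real k * (real (m (j + N)) / sqrt (real (j + N))) < e * l"
        using e l by (intro order_tendstoD(2)) auto
      then show "\<forall>\<^sub>F j in sequentially. (\<Sum>g\<in>P (j + N). \<integral>\<omega>. (Yn (j + N) g \<omega>)\<^sup>2 *
        indicator {\<omega>. \<bar>Yn (j + N) g \<omega>\<bar> > e} \<omega> \<partial>M (j + N)) \<le> d"
      proof eventually_elim
        case (elim j)
        define n where "n = j + N"
        have n: "n \<ge> 1" using N by (simp add: n_def)
        then have sn: "sqrt (real n) > 0" by simp
        interpret clustered_kernel "M n" S "W n" "P n" n k \<phi> K by (rule clustered[OF n])
        have excess: "integrable (M n) (\<lambda>\<omega>. (max 0 (\<bar>kernel_at \<phi> k (W n) t \<omega>\<bar> - B)) powr r)"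
          "expectation (\<lambda>\<omega>. (max 0 (\<bar>kernel_at \<phi> k (W n) t \<omega>\<bar> - B)) powr r) \<le> \<kappa>"
          if t: "t \<in> {1..k} \<rightarrow>\<^sub>E {1..n}" for t
        proof -
          have [measurable]: "kernel_at \<phi> k (W n) t \<in> borel_measurable (M n)" by (rule kernel_meas[OF n t])
          have "(\<integral>\<^sup>+\<omega>. ennreal ((max 0 (\<bar>kernel_at \<phi> k (W n) t \<omega>\<bar> - B)) powr r) \<partial>M n) \<le> tail B n t"
            unfolding tail_def
          proof (intro nn_integral_mono ennreal_leI)
            show "(max 0 (\<bar>kernel_at \<phi> k (W n) t \<omega>\<bar> - B)) powr r
              \<le> \<bar>kernel_at \<phi> k (W n) t \<omega>\<bar> powr r * indicator {\<omega>. \<bar>kernel_at \<phi> k (W n) t \<omega>\<bar> > B} \<omega>" for \<omega>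
              using excess_powr_le[OF B(1), of r "kernel_at \<phi> k (W n) t \<omega>"] r by (simp add: indicator_def)
          qed
          also have "\<dots> \<le> ennreal \<kappa>" by (rule B(2)[OF n t])
          finally have le: "(\<integral>\<^sup>+\<omega>. ennreal ((max 0 (\<bar>kernel_at \<phi> k (W n) t \<omega>\<bar> - B)) powr r) \<partial>M n) \<le> ennreal \<kappa>" .
          show "integrable (M n) (\<lambda>\<omega>. (max 0 (\<bar>kernel_at \<phi> k (W n) t \<omega>\<bar> - B)) powr r)"
            "expectation (\<lambda>\<omega>. (max 0 (\<bar>kernel_at \<phi> k (W n) t \<omega>\<bar> - B)) powr r) \<le> \<kappa>"
            using integral_le_of_nn_integral[OF _ _ le] \<kappa> by auto
        qed
        have big: "2 * B * real k * real (max_cluster_size (P n)) \<le> e * l * sqrt (real n)"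
          using elim sn unfolding n_def[symmetric] m_def by (simp add: pos_divide_less_eq)
        have size: "(\<Sum>g\<in>P n. real (card g) powr r) / sqrt (real n) powr r \<le> C powr (r / 2)"
        proof -
          let ?s = "\<Sum>g\<in>P n. real (card g) powr r"
          have s0: "?s \<ge> 0" by (intro sum_nonneg) auto
          have "?s powr (2 / r) / real n \<le> C" by (rule size_bound[OF n])
          \<comment> \<open>Raising the size condition to the power \<open>r / 2\<close> undoes
            \<open>2 / r\<close> and produces \<open>n powr (r / 2)\<close>, the normalization in
            \<open>lindeberg_bound\<close>.\<close>
          then have "(?s powr (2 / r) / real n) powr (r / 2) \<le> C powr (r / 2)"
            using r by (intro powr_mono2) auto
          also have "(?s powr (2 / r) / real n) powr (r / 2) = ?s / real n powr (r / 2)"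
            using r s0 by (simp add: powr_divide powr_powr)
          also have "real n powr (r / 2) = sqrt (real n) powr r"
            by (simp add: powr_half_sqrt[symmetric] powr_powr)
          finally show ?thesis .
        qed
        have "(\<Sum>g\<in>P n. \<integral>\<omega>. (Yn n g \<omega>)\<^sup>2 * indicator {\<omega>. \<bar>Yn n g \<omega>\<bar> > e} \<omega> \<partial>M n)
          \<le> e powr (2 - r) * (2 * real k / l) powr r *
            ((\<Sum>g\<in>P n. real (card g) powr r) / sqrt (real n) powr r) * \<kappa>"
          unfolding Yn_def
          by (rule lindeberg_bound[OF l _ e r B(1) big excess])
            (use N(3)[of j] \<kappa> in \<open>auto simp: n_def \<sigma>_def\<close>)
        also have "\<dots> \<le> A * \<kappa>"
          unfolding A_def using size \<kappa> by (intro mult_right_mono mult_left_mono) auto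
        also note \<kappa>(2)
        finally show ?case by (simp add: n_def)
      qed
    qed (intro sum_nonneg, auto)
    have char1: "(\<lambda>j. char (distr (M (j + N)) borel (\<lambda>\<omega>. \<Sum>g\<in>P (j + N). Yn (j + N) g \<omega>)) t)
        \<longlonglongrightarrow> char std_normal_distribution t" for t
    proof (rule lindeberg_char[OF _ _ _ _ _ _ lindeberg])
      fix j
      interpret clustered_kernel "M (j + N)" S "W (j + N)" "P (j + N)" "j + N" k \<phi> K
        by (rule clustered[OF N(2)])
      show "prob_space (M (j + N))" by (rule prob[OF N(2)])
      show "finite (P (j + N))" by (rule finite_P)
      show "indep_vars (\<lambda>_. borel) (Yn (j + N)) (P (j + N))" unfolding Yn_def by (rule normalized_sum_indep)
      show "integrable (M (j + N)) (\<lambda>\<omega>. (Yn (j + N) g \<omega>)\<^sup>2)" if "g \<in> P (j + N)" for g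
        unfolding Yn_def by (rule normalized_sum_square_integrable[OF that])
      show "expectation (\<lambda>\<omega>. Yn (j + N) g \<omega>) = 0" if "g \<in> P (j + N)" for g
        unfolding Yn_def by (rule normalized_sum_expectation[OF that])
      show "(\<Sum>g\<in>P (j + N). expectation (\<lambda>\<omega>. (Yn (j + N) g \<omega>)\<^sup>2)) = 1"
        unfolding Yn_def by (rule sum_normalized_sum_square) (use N(4)[of j] in \<open>simp add: \<sigma>_def\<close>)
    qed
    \<comment> \<open>After scaling by \<open>sqrt n / \<sigma> n\<close> the error has mean modulus
      at most \<open>c0 / l * (m n / sqrt n)\<close>, so it disappears from the characteristic
      functions in the limit.\<close>
    have char2: "(\<lambda>j. char (distr (M (j + N)) borel (Z (j + N))) t) \<longlonglongrightarrow> char std_normal_distribution t" for t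
    proof (rule Lim_transform[OF char1], rule tendsto_norm_zero_cancel, rule tendsto_sandwich[where f = "\<lambda>_. 0"])
      show "(\<lambda>j. \<bar>t\<bar> * (c0 / l) * (real (m (j + N)) / sqrt (real (j + N)))) \<longlonglongrightarrow> 0"
        using tendsto_mult_left[OF LIMSEQ_ignore_initial_segment[OF lim1, of N], of "\<bar>t\<bar> * (c0 / l)"] by simp
      show "\<forall>\<^sub>F j in sequentially. norm (char (distr (M (j + N)) borel (Z (j + N))) t -
          char (distr (M (j + N)) borel (\<lambda>\<omega>. \<Sum>g\<in>P (j + N). Yn (j + N) g \<omega>)) t)
        \<le> \<bar>t\<bar> * (c0 / l) * (real (m (j + N)) / sqrt (real (j + N)))"
      proof (rule always_eventually, rule allI)
        fix j
        define n where "n = j + N"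
        have nj: "n \<ge> 1" "n \<ge> 1 \<and> n \<ge> 2 * k\<^sup>2" "\<sigma> n \<ge> l" "\<sigma> n > 0" using N[of j] by (simp_all add: n_def)
        interpret clustered_kernel "M n" S "W n" "P n" n k \<phi> K by (rule clustered[OF nj(1)])
        let ?D = "\<lambda>\<omega>. sqrt (real n) / \<sigma> n * Err n \<omega>"
        have Z_eq: "Z n = (\<lambda>\<omega>. (\<Sum>g\<in>P n. Yn n g \<omega>) + ?D \<omega>)"
          using U_eq_normalized_sum by (simp add: Z_def \<sigma>_def Yn_def Err_def fun_eq_iff)
        have sum_meas: "(\<lambda>\<omega>. \<Sum>g\<in>P n. Yn n g \<omega>) \<in> borel_measurable (M n)"
          unfolding Yn_def by measurable
        have char_le: "norm (char (distr (M n) borel (Z n)) t - char (distr (M n) borel (\<lambda>\<omega>. \<Sum>g\<in>P n. Yn n g \<omega>)) t)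
          \<le> \<bar>t\<bar> * expectation (\<lambda>\<omega>. \<bar>?D \<omega>\<bar>)"
          unfolding Z_eq by (rule char_distr_add_diff_le[OF sum_meas]) (intro integrable_mult_right Err nj(1))
        have "expectation (\<lambda>\<omega>. \<bar>?D \<omega>\<bar>) = sqrt (real n) / \<sigma> n * expectation (\<lambda>\<omega>. \<bar>Err n \<omega>\<bar>)"
          using nj(4) by (simp add: abs_mult)
        also have "\<dots> \<le> sqrt (real n) / l * (c0 * (real (m n) / real n))"
        proof (rule mult_mono)
          show "sqrt (real n) / \<sigma> n \<le> sqrt (real n) / l" using nj(3) l by (intro frac_le) auto
        qed (use Err_le[OF nj(2)] l in auto)
        also have "\<dots> = c0 / l * (real (m n) / (real n / sqrt (real n)))" by simp
        also have "real n / sqrt (real n) = sqrt (real n)" by (simp add: real_div_sqrt)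
        finally have "\<bar>t\<bar> * expectation (\<lambda>\<omega>. \<bar>?D \<omega>\<bar>) \<le> \<bar>t\<bar> * (c0 / l * (real (m n) / sqrt (real n)))"
          by (rule mult_left_mono) simp
        with char_le show "norm (char (distr (M (j + N)) borel (Z (j + N))) t -
            char (distr (M (j + N)) borel (\<lambda>\<omega>. \<Sum>g\<in>P (j + N). Yn (j + N) g \<omega>)) t)
          \<le> \<bar>t\<bar> * (c0 / l) * (real (m (j + N)) / sqrt (real (j + N)))"
          unfolding n_def mult.assoc by (rule order_trans)
      qed
    qed auto
    have "weak_conv_m (\<lambda>j. distr (M (j + N)) borel (Z (j + N))) std_normal_distribution"
    proof (rule levy_continuity[OF _ real_dist_normal_dist char2])
      fix j
      interpret clustered_kernel "M (j + N)" S "W (j + N)" "P (j + N)" "j + N" k \<phi> K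
        by (rule clustered[OF N(2)])
      show "real_distribution (distr (M (j + N)) borel (Z (j + N)))"
        unfolding Z_def by (rule real_distribution_distr) measurable
    qed
    then have "weak_conv_m (\<lambda>n. distr (M n) borel (Z n)) std_normal_distribution"
      unfolding weak_conv_m_def weak_conv_def by (blast intro: LIMSEQ_offset[where k = N])
    then show ?thesis unfolding Z_def[abs_def] \<sigma>_def .
  qed
  show ?thesis
  proof (intro conjI allI impI)
    show "big_Op M
       (\<lambda>n \<omega>. U_stat \<phi> k n (W n) \<omega> -
          real k / real n * (\<Sum>i=1..n. mean_projection (M n) S (P n) \<phi> k n (W n) i \<omega>))
       (\<lambda>n. real (max_cluster_size (P n)) / real n)"
      using a unfolding Err_def[abs_def] m_def .
    show "big_Op M (\<lambda>n. U_stat \<phi> k n (W n)) (\<lambda>n. sqrt (real (max_cluster_size (P n)) / real n))"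
      using b1 unfolding m_def .
  qed (fact b2 c)+
qed

end
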